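(* Let $d\geqslant 2$, let $\Omega\subset\mathbb{R}^d$ be a measurable set, and let $f:\Omega\to\mathbb{R}$ be a measurable function attaining its global minimum over $\Omega$ at $\mathbf{0}$, with $f(\mathbf{0})=0$. Suppose that for some $n_1>0$ the integral $I(n)=\int_{\Omega}e^{-nf(\mathbf{t})}\,d\mathbf{t}$ exists and is finite for all $n\geqslant n_1$. Let $\dot f$ vanish at $\mathbf{0}$, let $\ddot f(\mathbf{0})$ exist and be positive definite with $\lambda_{\min}$ being its smallest eigenvalue, and let all third order partial derivatives of $f$ exist at $\mathbf{0}$. Denote $$D:=\frac{d^{3/2}}{6}\max_{i,j,k\in\{1,\ldots,d\}}\left|\frac{\partial^3 f(\mathbf{0})}{\partial t_i\partial t_j\partial t_k}\right|.$$ Assume that: (A1) there exist positive real numbers $r$, $C$ and $\alpha>1$ such that $B_r\subset\Omega$ and for every $\mathbf{t}\in B_r$ $$\left|f(\mathbf{t})-\tfrac12 d^2f(\mathbf{0},\mathbf{t})-\tfrac16 d^3f(\mathbf{0},\mathbf{t})\right|\leqslant C\|\mathbf{t}\|^{2+\alpha};$$ (A2) there exist $\delta>0$ and $\Delta>0$ such that $f$ is convex on $B_\delta\subset\Omega$ and, moreover, $f(\mathbf{t})\geqslant\Delta$ for every $\mathbf{t}\in\Omega\setminus B_{\delta\wedge r}$. Put $\xi=(r^2\lambda_{\min})\wedge(2\Delta)$ and $n_0:=\inf(N_1\cap N_2)$, where $$N_1:=\left\{n\geqslant1:\ d\leqslant(d+2\alpha)\log n\leqslant\xi n\right\},$$ $$N_2:=\left\{n\geqslant1:\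 D\left(\frac{d+2\alpha}{\lambda_{\min}}\right)^{3/2}\frac{\log^{3/2}n}{n^{1/2}}+C\left(\frac{d+2\alpha}{\lambda_{\min}}\right)^{1+\alpha/2}\frac{\log^{1+\alpha/2}n}{n^{\alpha/2}}\leqslant\frac74\right\}.$$ Then for every $n\geqslant n_0$ the following bounds hold: $$I(n)\geqslant\frac{1}{\sqrt{\det\ddot f(\mathbf{0})}}\left(\frac{2\pi}{n}\right)^{d/2}\left[1-\frac{K_{\alpha,1}}{n^{\alpha/2}}-\frac{K_l}{n^{1+\alpha}}\right],$$ $$I(n)\leqslant\frac{1}{\sqrt{\det\ddot f(\mathbf{0})}}\left(\frac{2\pi}{n}\right)^{d/2}\left[1+\frac{K_{\alpha,1}}{n^{\alpha/2}}+\frac{K_1}{n}+\frac{K_{\alpha,2}+K_u}{n^{\alpha}}\right],$$ where $$K_{\alpha,1}=C(2/\lambda_{\min})^{1+\alpha/2}(d/2)_{1+\alpha/2},\qquad K_{\alpha,2}=C^2(2/\lambda_{\min})^{2+\alpha}(d/2)_{2+\alpha},$$ $$K_1=D^2(2/\lambda_{\min})^3(d/2)_3,\qquad K_l=\frac e2\sqrt{\frac d\pi}\left(1+\frac{2\alpha}{d}\right)^{d/2-1},$$ $$K_u=\frac{7\sqrt{\det\ddot f(\mathbf{0})}}{4(2\pi)^{d/2}}\,I(n_1)\,e^{\xi n_1/2}.$$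
   Context: $\dot f(\mathbf{0})$ and $\ddot f(\mathbf{0})$ denote the gradient vector and Hessian matrix of $f$ at $\mathbf{0}\in\mathbb{R}^d$. For $\mathbf{t}=(t_1,\ldots,t_d)'\in\mathbb{R}^d$, $d^2f(\mathbf{0},\mathbf{t})=\mathbf{t}'\ddot f(\mathbf{0})\mathbf{t}$ and $d^3f(\mathbf{0},\mathbf{t})=\sum_{i,j,k=1}^d\frac{\partial^3f(\mathbf{0})}{\partial t_i\partial t_j\partial t_k}t_it_jt_k$. $\|\cdot\|$ is the Euclidean norm, and $B_\rho=\{\mathbf{t}\in\mathbb{R}^d:\|\mathbf{t}\|\leqslant\rho\}$ for $\rho>0$. $a\wedge b=\min(a,b)$. $(x)_a=\Gamma(x+a)/\Gamma(x)$ for $a\geqslant0$ is the Pochhammer symbol. The parameter $n$ is a positive number.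
   Formalization: The bounds are proved for n ≥ n_1 (I(n) may be infinite below n_1) with n in N_1∩N_2 or n ≥ n_0, where n_0 is taken as the infimum of those m with [m,∞) ⊂ N_1∩N_2, since N_1∩N_2 can have gaps in which the literal claim fails. *)

theory Defs
  imports "HOL-Analysis.Analysis"
begin

text \<open>
  Iterated partial derivatives: the multi-index \<open>[i, j, k]\<close> stands for
  \<open>\<partial>_i (\<partial>_j (\<partial>_k f))\<close>, so the last entry of the list is differentiated first.
  Since \<^const>\<open>deriv\<close> is total, the value is meaningful only where
  \<open>partial_exists\<close> (below) holds.
\<close>

fun partial_deriv :: "'d list \<Rightarrow> (real ^ 'd::finite \<Rightarrow> real) \<Rightarrow> real ^ 'd \<Rightarrow> real" where
  "partial_deriv [] f x = f x"
| "partial_deriv (i # is) f x = deriv (\<lambda>s. partial_deriv is f (x + s *\<^sub>R axis i 1)) 0"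

text \<open>
  For \<open>\<partial>_i g\<close> to exist at \<open>x\<close>, the function \<open>g\<close>, itself a partial derivative, has to be
  defined at \<open>x + s e_i\<close> for all small \<open>s\<close> (including \<open>s = 0\<close>), and its difference quotient
  there has to converge. No continuity is required.
\<close>

fun partial_exists :: "'d list \<Rightarrow> (real ^ 'd::finite \<Rightarrow> real) \<Rightarrow> real ^ 'd \<Rightarrow> bool" where
  "partial_exists [] f x = True"
| "partial_exists (i # is) f x \<longleftrightarrow>
     (\<forall>\<^sub>F s in nhds (0::real). partial_exists is f (x + s *\<^sub>R axis i 1)) \<and>
     (\<lambda>s. partial_deriv is f (x + s *\<^sub>R axis i 1)) field_differentiable (at (0::real))"

definition gradient :: "(real ^ 'd::finite \<Rightarrow> real) \<Rightarrow> real ^ 'd \<Rightarrow> real ^ 'd" where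
  "gradient f x = (\<chi> i. partial_deriv [i] f x)"

definition hessian :: "(real ^ 'd::finite \<Rightarrow> real) \<Rightarrow> real ^ 'd \<Rightarrow> real ^ 'd ^ 'd" where
  "hessian f x = (\<chi> i j. partial_deriv [i, j] f x)"

definition d2 :: "(real ^ 'd::finite \<Rightarrow> real) \<Rightarrow> real ^ 'd \<Rightarrow> real ^ 'd \<Rightarrow> real" where
  "d2 f x t = t \<bullet> (hessian f x *v t)"

definition d3 :: "(real ^ 'd::finite \<Rightarrow> real) \<Rightarrow> real ^ 'd \<Rightarrow> real ^ 'd \<Rightarrow> real" where
  "d3 f x t = (\<Sum>i\<in>UNIV. \<Sum>j\<in>UNIV. \<Sum>k\<in>UNIV. partial_deriv [i, j, k] f x * t $ i * t $ j * t $ k)"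

text \<open>As usual, positive definiteness of a real matrix includes symmetry.\<close>

definition positive_definite :: "real ^ 'd ^ 'd::finite \<Rightarrow> bool" where
  "positive_definite A \<longleftrightarrow> transpose A = A \<and> (\<forall>v. v \<noteq> 0 \<longrightarrow> 0 < v \<bullet> (A *v v))"

definition is_eigenvalue :: "real ^ 'd ^ 'd::finite \<Rightarrow> real \<Rightarrow> bool" where
  "is_eigenvalue A l \<longleftrightarrow> (\<exists>v. v \<noteq> 0 \<and> A *v v = l *\<^sub>R v)"

definition is_smallest_eigenvalue :: "real ^ 'd ^ 'd::finite \<Rightarrow> real \<Rightarrow> bool" where
  "is_smallest_eigenvalue A l \<longleftrightarrow> is_eigenvalue A l \<and> (\<forall>m. is_eigenvalue A m \<longrightarrow> l \<le> m)"

text \<open>The library's \<^const>\<open>pochhammer\<close> only covers natural-number orders \<open>a\<close>.\<close>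

definition poch :: "real \<Rightarrow> real \<Rightarrow> real" where
  "poch x a = Gamma (x + a) / Gamma x"

definition laplace_integral :: "(real ^ 'd::finite) set \<Rightarrow> (real ^ 'd \<Rightarrow> real) \<Rightarrow> real \<Rightarrow> real" where
  "laplace_integral \<Omega> f n = (LINT t:\<Omega>|lebesgue. exp (- n * f t))"

definition laplace_integrable :: "(real ^ 'd::finite) set \<Rightarrow> (real ^ 'd \<Rightarrow> real) \<Rightarrow> real \<Rightarrow> bool" where
  "laplace_integrable \<Omega> f n \<longleftrightarrow> set_integrable lebesgue \<Omega> (\<lambda>t. exp (- n * f t))"

text \<open>
  The infimum of those points of \<open>N\<close> from which on no further point is missing. It equals
  \<open>Inf N\<close> if \<open>N\<close> is upward closed. This is not automatic for sets given by upper bounds on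
  \<open>ln n / n\<close> or \<open>ln n powr a / n powr b\<close>, since these increase before they decrease; then
  \<open>Inf N \<le> n\<close> does not imply \<open>n \<in> N\<close>.
\<close>

definition threshold :: "real set \<Rightarrow> real" where
  "threshold N = Inf {m \<in> N. {m..} \<subseteq> N}"

end

(*
  Rescale f by n. On the ellipsoid U = {n t'Ht/2 <= x}, x = (d/2 + alpha) ln n, the cubic term u and
  the remainder v satisfy |u| + v <= 7/4, so exp(-nf) lies between exp(-n t'Ht/2) times 1 + u - v and
  times 1 + y + y^2, y = u + v. The odd terms u and uv integrate to 0, the others are gamma moments
  because t'Ht has a gamma-type distribution under Lebesgue measure; the mass outside U is an incomplete gamma
  integral, bounded with Stirling's inequality.

  Outside U convexity is needed. Evaluating f on the boundary of U only yields the factor exp(7/4) in place of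
  7/4 in Ku. The factor 7/4 is obtained by keeping the majorant exp(-n t'Ht/2) (1 + y + y^2) there as
  well: along a ray the function nf is convex and close to a parabola, hence it lies above chords joining a point
  where it is small to a point where it is large, and this lower bound shows
  exp(-nf) <= exp(-n t'Ht/2) (1 + y + y^2) + 7/4 exp(-x).
*)

theory Submission
  imports Defs "HOL-Real_Asymp.Real_Asymp"
begin

text \<open>The number 7/4 is a convenient rational below the point, near 1.79, where
  \<open>exp y\<close> overtakes the quadratic \<open>1 + y + y\<^sup>2\<close>; it fixes both the
  condition in \<open>N2\<close> and the factor in \<open>Ku\<close>. The value of \<open>x\<close>
  is dictated by the error sought: measured against the Gaussian integral, which is of order
  \<open>n powr (- d/2)\<close>, the quantity \<open>exp (- x)\<close> is of order
  \<open>n powr (- \<alpha>)\<close>. The obstacle is the part of the ball outside the ellipsoid,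
  where u and v may be large. It is treated ray by ray because the three Taylor terms then scale
  like the powers 2, 3 and 2 + \<alpha> of one variable, and \<alpha> > 1 lets the cube dominate the
  remainder. What is left depends on two real numbers only: \<open>x\<close>, now the value of the
  quadratic term at a suitable radius, and the ratio \<open>s \<ge> 1\<close> of the point to that
  radius. Compact ranges of both are settled by rational certificates, the unbounded ones by
  monotonicity.\<close>

subsection \<open>Exponential inequalities\<close>

text \<open>
  For \<open>m = p + 1\<close>, \<open>t - 7/4\<close> is the tangent of \<open>K t ^ m\<close> at \<open>t = 7 m / (4 p)\<close>, where \<open>1 / K\<close> is the bound on
  \<open>exp \<rho>\<close>. This turns an inequality between sums of exponentials into one between exponents.
\<close>

lemma exp_le_add_of_power:
  fixes T q M \<rho> :: real and p :: nat
  assumes p: "p > 0" and M: "M > 0"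
    and \<rho>: "exp \<rho> \<le> real (Suc p) ^ Suc p * (7 / (4 * real p)) ^ p"
    and le: "real (Suc p) * T + q \<le> \<rho> + ln M"
  shows "exp T \<le> 7/4 + M * exp (- q)"
proof -
  define t0 where "t0 = 7/4 * real (Suc p) / real p"
  have t0: "t0 > 0" using p by (simp add: t0_def)
  have "1 + real (Suc p) * (exp T / t0 - 1) \<le> (1 + (exp T / t0 - 1)) ^ Suc p"
    by (rule Bernoulli_inequality) (use t0 in \<open>simp add: field_simps\<close>)
  also have "\<dots> = exp (real (Suc p) * T) / t0 ^ Suc p"
    by (simp add: power_divide exp_of_nat_mult del: of_nat_Suc)
  also have "exp (real (Suc p) * T) \<le> exp (\<rho> + ln M - q)"
    using le by simp
  also have "\<dots> = exp \<rho> * M * exp (- q)"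
    using M by (simp add: exp_diff exp_add exp_minus divide_inverse)
  also have "\<dots> \<le> real (Suc p) ^ Suc p * (7 / (4 * real p)) ^ p * M * exp (- q)"
    using \<rho> M by (intro mult_right_mono) auto
  finally have "1 + real (Suc p) * (exp T / t0 - 1) \<le>
      real (Suc p) ^ Suc p * (7 / (4 * real p)) ^ p * M * exp (- q) / t0 ^ Suc p"
    using t0 by (simp add: divide_right_mono)
  also have "\<dots> = 4 * real p / 7 * (M * exp (- q))"
    using p by (simp add: t0_def power_divide power_mult_distrib field_simps del: of_nat_Suc)
  finally have *: "1 + real (Suc p) * (exp T / t0 - 1) \<le> 4 * real p / 7 * (M * exp (- q))" .
  have "1 + real (Suc p) * (exp T / t0 - 1) = 4 * real p / 7 * (exp T - 7/4)"
    using p by (simp add: t0_def field_simps)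
  with * have "4 * real p / 7 * (exp T - 7/4) \<le> 4 * real p / 7 * (M * exp (- q))" by simp
  then show ?thesis using p by simp
qed

text \<open>The second derivative has the sign of \<open>7/4 * s ^ 3 - 1\<close>, which is positive
  from \<open>s = 1\<close> on. Added to a convex quadratic, this makes a difference of exponents
  convex in \<open>s\<close>, so that only the ends of intervals have to be inspected.\<close>

lemma convex_on_neg_ln_cubic: "convex_on {1::real..} (\<lambda>s. - ln (7/4 * s ^ 3 + 1/2))"
proof (rule f''_ge0_imp_convex)
  fix s :: real assume s: "s \<in> {1..}"
  have s3: "s ^ 3 \<ge> 1" using s by (intro one_le_power) auto
  then have P: "7/4 * s ^ 3 + 1/2 > 0" by simp
  show "((\<lambda>s. - ln (7/4 * s ^ 3 + 1/2)) has_real_derivative - (21/4 * s\<^sup>2 / (7/4 * s ^ 3 + 1/2))) (at s)"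
    using P by (auto intro!: derivative_eq_intros simp: field_simps)
  have "0 < s * s ^ 3 * 2 + s * s ^ 6 * 7" if "s > 0" for s :: real using that by (simp add: add_pos_pos)
  show "((\<lambda>s. - (21/4 * s\<^sup>2 / (7/4 * s ^ 3 + 1/2))) has_real_derivative
          (21/4 * s * (7/4 * s ^ 3 - 1)) / (7/4 * s ^ 3 + 1/2)\<^sup>2) (at s)"
    using P by (auto intro!: derivative_eq_intros simp: power2_eq_square)
      (simp add: divide_simps, simp add: algebra_simps power2_eq_square power3_eq_cube)
  show "0 \<le> (21/4 * s * (7/4 * s ^ 3 - 1)) / (7/4 * s ^ 3 + 1/2)\<^sup>2"
    proof (intro divide_nonneg_nonneg mult_nonneg_nonneg)
    show "0 \<le> 7/4 * s ^ 3 - 1" using s3 by linarith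
  qed (use s in auto)
qed simp

text \<open>With \<open>a \<ge> 0\<close> the left side minus the logarithm is convex in
  \<open>s\<close>, hence at most its larger endpoint value. \<open>c1\<close> and \<open>c2\<close>
  are lower bounds for the logarithm at the ends, given in exponential form so that rational
  arithmetic can certify them.\<close>

lemma quadratic_le_ln_cubic:
  fixes a b c \<rho> s1 s2 s :: real
  assumes a: "a \<ge> 0" and s: "1 \<le> s1" "s1 \<le> s" "s \<le> s2"
    and l1: "exp c1 \<le> (7/4 * s1 ^ 3 + 1/2)\<^sup>2" "a * s1\<^sup>2 + b * s1 + c \<le> \<rho> + c1"
    and l2: "exp c2 \<le> (7/4 * s2 ^ 3 + 1/2)\<^sup>2" "a * s2\<^sup>2 + b * s2 + c \<le> \<rho> + c2"
  shows "a * s\<^sup>2 + b * s + c \<le> \<rho> + ln ((7/4 * s ^ 3 + 1/2)\<^sup>2)"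
proof -
  define h where "h = (\<lambda>s. (a * s\<^sup>2 + b * s + c) + 2 * (- ln (7/4 * s ^ 3 + 1/2)))"
  have cube: "s ^ 3 \<ge> 1" if "s \<ge> 1" for s :: real using that by (intro one_le_power)
  have "convex_on {1..} (\<lambda>s. a * s\<^sup>2 + b * s + c)"
    by (intro f''_ge0_imp_convex[where f' = "\<lambda>s. 2 * a * s + b" and f'' = "\<lambda>s. 2 * a"])
      (use a in \<open>auto intro!: derivative_eq_intros simp: algebra_simps\<close>)
  then have cv: "convex_on {1..} h"
    unfolding h_def by (intro convex_on_add[of "{1..}" "\<lambda>s. a * s\<^sup>2 + b * s + c"] convex_on_cmul convex_on_neg_ln_cubic) auto
  have ln2: "ln ((7/4 * s ^ 3 + 1/2)\<^sup>2) = 2 * ln (7/4 * s ^ 3 + 1/2)" if "s \<ge> 1" for s :: real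
    using cube[OF that] by (subst ln_realpow) auto
  have end1: "h s1 \<le> \<rho>"
  proof -
    have "c1 \<le> ln ((7/4 * s1 ^ 3 + 1/2)\<^sup>2)"
      using l1(1) cube[OF s(1)] by (subst ln_ge_iff) auto
    then show ?thesis using l1(2) ln2[OF s(1)] by (simp add: h_def)
  qed
  have end2: "h s2 \<le> \<rho>"
  proof -
    have "s2 \<ge> 1" using s by simp
    have "c2 \<le> ln ((7/4 * s2 ^ 3 + 1/2)\<^sup>2)"
      using l2(1) cube[OF \<open>s2 \<ge> 1\<close>] by (subst ln_ge_iff) auto
    then show ?thesis using l2(2) ln2[OF \<open>s2 \<ge> 1\<close>] by (simp add: h_def)
  qed
  have "h s \<le> max (h s1) (h s2)"
  proof -
    have "convex_on {s1..s2} h" using cv by (rule convex_on_subset) (use s in auto)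
    then show ?thesis by (rule convex_on_le_max) (use s in auto)
  qed
  with end1 end2 have "h s \<le> \<rho>" by simp
  then show ?thesis using ln2[of s] s by (simp add: h_def)
qed

text \<open>Multiples of 1/50 are written as \<open>h / 2 + j / 50\<close>, which leaves a
  comparison of rational powers. \<open>1649/1000\<close> is just above the square root of e, and
  \<open>2551/2500\<close> is \<open>1 + 1/50 + 1/2500\<close>, the quadratic bound for
  \<open>exp (1/50)\<close>.\<close>

lemma exp_le_of_powers:
  fixes R :: real
  assumes "(1649/1000) ^ h * (2551/2500) ^ j \<le> R"
  shows "exp (real h / 2 + real j / 50) \<le> R"
proof -
  have "exp (1/2 :: real) ^ 2 = exp 1"
    by (simp add: power2_eq_square flip: exp_add)
  moreover have "exp 1 \<le> (1649/1000 :: real) ^ 2"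
  proof -
    have "exp 1 - 5837465777 / 2147483648 \<le> inverse (2 ^ 32 :: real)"
      using e_approx_32 by linarith
    then show ?thesis by (simp add: power2_eq_square)
  qed
  ultimately have "exp (1/2 :: real) ^ 2 \<le> (1649/1000) ^ 2"
    by simp
  then have 1: "exp (1/2 :: real) \<le> 1649/1000"
    by (rule power2_le_imp_le) simp
  have 2: "exp (1/50 :: real) \<le> 2551/2500"
    using exp_bound[of "1/50 :: real"] by (simp add: power2_eq_square)
  have "exp (real h / 2 + real j / 50) = exp (1/2) ^ h * exp (1/50) ^ j"
    by (simp add: exp_add flip: exp_of_nat_mult)
  also have "\<dots> \<le> (1649/1000) ^ h * (2551/2500) ^ j"
    using 1 2 by (intro mult_mono power_mono) auto
  finally show ?thesis using assms by simp
qed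

text \<open>The gap is \<open>(x - p)\<^sup>2 * (D - \<gamma> * x)\<close> plus an affine function
  of \<open>x\<close>. The product is nonnegative up to \<open>x = 7/2\<close>, and the affine part
  needs checking only at 0 and 7/2. \<open>L\<close> is the derivative of the cubic at
  \<open>p\<close>, so a rational \<open>p\<close> close to an interior maximiser makes the affine
  part nearly constant.\<close>

lemma cubic_le:
  fixes x \<alpha> \<beta> \<gamma> p r :: real
  assumes x: "0 \<le> x" "x \<le> 7/2" and "\<gamma> \<ge> 0"
    and D: "7/2 * \<gamma> \<le> \<beta> - 2 * \<gamma> * p"
    and r0: "p\<^sup>2 * (\<beta> - 2 * \<gamma> * p) \<le> r"
    and r1: "p\<^sup>2 * (\<beta> - 2 * \<gamma> * p) + 7/2 * (\<alpha> - 2 * p * (\<beta> - 2 * \<gamma> * p) - \<gamma> * p\<^sup>2) \<le> r"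
  shows "\<alpha> * x - \<beta> * x\<^sup>2 + \<gamma> * x ^ 3 \<le> r"
proof -
  define D where "D = \<beta> - 2 * \<gamma> * p"
  define L where "L = \<alpha> - 2 * p * D - \<gamma> * p\<^sup>2"
  have "\<gamma> * x \<le> \<gamma> * (7/2)" using assms by (intro mult_left_mono)
  then have "0 \<le> (x - p)\<^sup>2 * (D - \<gamma> * x)" using D by (simp add: D_def)
  moreover have "p\<^sup>2 * D + x * L \<le> r"
  proof (cases "L \<ge> 0")
    case True
    then have "x * L \<le> 7/2 * L" using x by (intro mult_right_mono)
    moreover have "p\<^sup>2 * D + 7/2 * L \<le> r" using r1 by (simp only: D_def L_def)
    ultimately show ?thesis by linarith
  next
    case False
    then have "x * L \<le> 0" using x by (simp add: mult_nonneg_nonpos)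
    moreover have "p\<^sup>2 * D \<le> r" using r0 by (simp only: D_def)
    ultimately show ?thesis by linarith
  qed
  moreover have "r - (\<alpha> * x - \<beta> * x\<^sup>2 + \<gamma> * x ^ 3) = (x - p)\<^sup>2 * (D - \<gamma> * x) + (r - (p\<^sup>2 * D + x * L))"
    by (simp add: D_def L_def power2_eq_square power3_eq_cube algebra_simps)
  ultimately show ?thesis by linarith
qed

text \<open>One piece of the \<open>s\<close> axis. In the applications \<open>T\<close> is affine
  and \<open>q\<close> quadratic in \<open>s\<close>, so the combined exponent is a quadratic in
  \<open>s\<close> and the checks at the two breakpoints settle the piece.\<close>

lemma exp_le_add_between:
  fixes a b c s s1 s2 T q \<rho> c1 c2 :: real and p :: nat
  assumes "p > 0" "exp \<rho> \<le> real (Suc p) ^ Suc p * (7 / (4 * real p)) ^ p"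
    and "a \<ge> 0" "1 \<le> s1" "s1 \<le> s" "s \<le> s2"
    and "exp c1 \<le> (7/4 * s1 ^ 3 + 1/2)\<^sup>2" "a * s1\<^sup>2 + b * s1 + c \<le> \<rho> + c1"
    and "exp c2 \<le> (7/4 * s2 ^ 3 + 1/2)\<^sup>2" "a * s2\<^sup>2 + b * s2 + c \<le> \<rho> + c2"
    and "real (Suc p) * T + q = a * s\<^sup>2 + b * s + c"
  shows "exp T \<le> 7/4 + (7/4 * s ^ 3 + 1/2)\<^sup>2 * exp (- q)"
proof (rule exp_le_add_of_power[OF assms(1) _ assms(2)])
  have "s ^ 3 \<ge> 0" using \<open>1 \<le> s1\<close> \<open>s1 \<le> s\<close> by simp
  then show "0 < (7/4 * s ^ 3 + 1/2)\<^sup>2"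
    by (intro zero_less_power) linarith
  show "real (Suc p) * T + q \<le> \<rho> + ln ((7/4 * s ^ 3 + 1/2)\<^sup>2)"
    unfolding assms(11)
    by (rule quadratic_le_ln_cubic[OF assms(3-10)])
qed

text \<open>
  The exponents \<open>m\<close> and the breakpoints 1, 1.3, 1.5, 1.65, 1.8, 2.1, 2.8 for \<open>s\<close> were found
  numerically. By convexity in \<open>s\<close> only the breakpoints have to be checked, and there the
  inequality is a cubic one in \<open>x\<close>.
\<close>

lemma exp_le_tangent_const_2: "exp (97/50) \<le> real (Suc 1) ^ Suc 1 * (7 / (4 * real 1)) ^ 1"
  using exp_le_of_powers[of 3 22 "real (Suc 1) ^ Suc 1 * (7 / (4 * real 1)) ^ 1"]
  by (simp add: power_divide)

lemma exp_le_tangent_const_3: "exp (151/50) \<le> real (Suc 2) ^ Suc 2 * (7 / (4 * real 2)) ^ 2"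
  using exp_le_of_powers[of 6 1 "real (Suc 2) ^ Suc 2 * (7 / (4 * real 2)) ^ 2"]
  by (simp add: power_divide)

lemma exp_le_tangent_const_4: "exp (196/50) \<le> real (Suc 3) ^ Suc 3 * (7 / (4 * real 3)) ^ 3"
  using exp_le_of_powers[of 7 21 "real (Suc 3) ^ Suc 3 * (7 / (4 * real 3)) ^ 3"]
  by (simp add: power_divide)

lemma exp_le_tangent_const_5: "exp (236/50) \<le> real (Suc 4) ^ Suc 4 * (7 / (4 * real 4)) ^ 4"
  using exp_le_of_powers[of 9 11 "real (Suc 4) ^ Suc 4 * (7 / (4 * real 4)) ^ 4"]
  by (simp add: power_divide)

lemma exp_le_tangent_const_7: "exp (311/50) \<le> real (Suc 6) ^ Suc 6 * (7 / (4 * real 6)) ^ 6"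
  using exp_le_of_powers[of 12 11 "real (Suc 6) ^ Suc 6 * (7 / (4 * real 6)) ^ 6"]
  by (simp add: power_divide)

lemma exp_le_tangent_const_11: "exp (446/50) \<le> real (Suc 10) ^ Suc 10 * (7 / (4 * real 10)) ^ 10"
  using exp_le_of_powers[of 17 21 "real (Suc 10) ^ Suc 10 * (7 / (4 * real 10)) ^ 10"]
  by (simp add: power_divide)

lemma exp_le_at_breakpoint_0: "exp (81/50) \<le> (7/4 * (1) ^ 3 + 1/2 :: real)\<^sup>2"
  using exp_le_of_powers[of 3 6 "(7/4 * (1) ^ 3 + 1/2)\<^sup>2"]
  by (simp add: power_divide)

lemma exp_le_at_breakpoint_1: "exp (146/50) \<le> (7/4 * (13/10) ^ 3 + 1/2 :: real)\<^sup>2"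
  using exp_le_of_powers[of 5 21 "(7/4 * (13/10) ^ 3 + 1/2)\<^sup>2"]
  by (simp add: power_divide)

lemma exp_le_at_breakpoint_2: "exp (185/50) \<le> (7/4 * (3/2) ^ 3 + 1/2 :: real)\<^sup>2"
  using exp_le_of_powers[of 7 10 "(7/4 * (3/2) ^ 3 + 1/2)\<^sup>2"]
  by (simp add: power_divide)

lemma exp_le_at_breakpoint_3: "exp (212/50) \<le> (7/4 * (33/20) ^ 3 + 1/2 :: real)\<^sup>2"
  using exp_le_of_powers[of 8 12 "(7/4 * (33/20) ^ 3 + 1/2)\<^sup>2"]
  by (simp add: power_divide)

lemma exp_le_at_breakpoint_4: "exp (236/50) \<le> (7/4 * (9/5) ^ 3 + 1/2 :: real)\<^sup>2"
  using exp_le_of_powers[of 9 11 "(7/4 * (9/5) ^ 3 + 1/2)\<^sup>2"]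
  by (simp add: power_divide)

lemma exp_le_at_breakpoint_5: "exp (281/50) \<le> (7/4 * (21/10) ^ 3 + 1/2 :: real)\<^sup>2"
  using exp_le_of_powers[of 11 6 "(7/4 * (21/10) ^ 3 + 1/2)\<^sup>2"]
  by (simp add: power_divide)

lemma exp_le_at_breakpoint_6: "exp (365/50) \<le> (7/4 * (14/5) ^ 3 + 1/2 :: real)\<^sup>2"
  using exp_le_of_powers[of 14 15 "(7/4 * (14/5) ^ 3 + 1/2)\<^sup>2"]
  by (simp add: power_divide)

text \<open>\<open>111/200\<close> is slightly below \<open>ln (7/4)\<close>. Once an exponent falls
  below it, the summand \<open>7/4\<close> alone is enough; this settles the unbounded last range of
  \<open>s\<close>.\<close>

lemma exp_111_200: "exp (111/200 :: real) \<le> 7/4"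
proof -
  have "exp (11/200 :: real) \<le> 106/100"
    using exp_bound[of "11/200 :: real"] by (simp add: power2_eq_square)
  then have "exp (1/2 :: real) * exp (11/200) \<le> 1649/1000 * (106/100)"
    using exp_le_of_powers[of 1 0 "1649/1000"] by (intro mult_mono) auto
  then show ?thesis by (simp flip: exp_add)
qed

text \<open>
  Here \<open>x\<close> and \<open>x s\<^sup>2\<close> are the values of the quadratic term at the boundary of the ellipsoid
  and at the point considered; \<open>7/4 * s ^ 3\<close> is a lower bound for \<open>y\<close> and the exponent on the left is
  \<open>x\<close> minus a chord bound for the convex function, see \<open>exp_bound_of_low_up\<close>.
\<close>

lemma exp_chord_le:
  fixes x s :: real
  assumes x: "0 \<le> x" "x \<le> 7/2" and s: "s \<ge> 1"
  shows "exp (x - 41/250 * s * x\<^sup>2 + 59/10000 * x ^ 3) \<le> 7/4 + (7/4 * s ^ 3 + 1/2)\<^sup>2 * exp (- (x * (s\<^sup>2 - 1)))"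
proof -
  have "exp (x - 41/250 * s * x\<^sup>2 + 59/10000 * x ^ 3) \<le> 7/4 + (7/4 * s ^ 3 + 1/2)\<^sup>2 * exp (- (x * (s\<^sup>2 - 1)))" if "1 \<le> s" "s \<le> 13/10"
  proof (rule exp_le_add_between[OF _ exp_le_tangent_const_2 _ _ that exp_le_at_breakpoint_0 _ exp_le_at_breakpoint_1])
    \<comment> \<open>The numerals passed to \<open>cubic_le\<close> are the cubic and the quadratic
      coefficient, the expansion point \<open>p\<close>, the target and the linear coefficient. Here
      \<open>p\<close> sits at the right end because the cubic increases up to 7/2.\<close>
    show "x * (1)\<^sup>2 + (- 2*41/250 * x\<^sup>2) * (1) + (1 * x + 2*59/10000 * x ^ 3) \<le> 97/50 + 81/50"
      using cubic_le[OF x, of "2*59/10000" "2*41/250*(1)" "349/100" "178/50" "1 + (1)\<^sup>2"] by (simp add: power2_eq_square field_simps)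
    show "x * (13/10)\<^sup>2 + (- 2*41/250 * x\<^sup>2) * (13/10) + (1 * x + 2*59/10000 * x ^ 3) \<le> 97/50 + 146/50"
      using cubic_le[OF x, of "2*59/10000" "2*41/250*(13/10)" "349/100" "243/50" "1 + (13/10)\<^sup>2"] by (simp add: power2_eq_square field_simps)
  qed (use x in \<open>simp_all add: field_simps power2_eq_square\<close>)
  moreover have "exp (x - 41/250 * s * x\<^sup>2 + 59/10000 * x ^ 3) \<le> 7/4 + (7/4 * s ^ 3 + 1/2)\<^sup>2 * exp (- (x * (s\<^sup>2 - 1)))" if "13/10 \<le> s" "s \<le> 3/2"
  proof (rule exp_le_add_between[OF _ exp_le_tangent_const_3 _ _ that exp_le_at_breakpoint_1 _ exp_le_at_breakpoint_2])
    show "x * (13/10)\<^sup>2 + (- 3*41/250 * x\<^sup>2) * (13/10) + (2 * x + 3*59/10000 * x ^ 3) \<le> 151/50 + 146/50"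
      using cubic_le[OF x, of "3*59/10000" "3*41/250*(13/10)" "67/20" "297/50" "2 + (13/10)\<^sup>2"] by (simp add: power2_eq_square field_simps)
    show "x * (3/2)\<^sup>2 + (- 3*41/250 * x\<^sup>2) * (3/2) + (2 * x + 3*59/10000 * x ^ 3) \<le> 151/50 + 185/50"
      using cubic_le[OF x, of "3*59/10000" "3*41/250*(3/2)" "163/50" "336/50" "2 + (3/2)\<^sup>2"] by (simp add: power2_eq_square field_simps)
  qed (use x in \<open>simp_all add: field_simps power2_eq_square\<close>)
  moreover have "exp (x - 41/250 * s * x\<^sup>2 + 59/10000 * x ^ 3) \<le> 7/4 + (7/4 * s ^ 3 + 1/2)\<^sup>2 * exp (- (x * (s\<^sup>2 - 1)))" if "3/2 \<le> s" "s \<le> 33/20"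
  proof (rule exp_le_add_between[OF _ exp_le_tangent_const_4 _ _ that exp_le_at_breakpoint_2 _ exp_le_at_breakpoint_3])
    show "x * (3/2)\<^sup>2 + (- 4*41/250 * x\<^sup>2) * (3/2) + (3 * x + 4*59/10000 * x ^ 3) \<le> 196/50 + 185/50"
      using cubic_le[OF x, of "4*59/10000" "4*41/250*(3/2)" "299/100" "381/50" "3 + (3/2)\<^sup>2"] by (simp add: power2_eq_square field_simps)
    show "x * (33/20)\<^sup>2 + (- 4*41/250 * x\<^sup>2) * (33/20) + (3 * x + 4*59/10000 * x ^ 3) \<le> 196/50 + 212/50"
      using cubic_le[OF x, of "4*59/10000" "4*41/250*(33/20)" "73/25" "408/50" "3 + (33/20)\<^sup>2"] by (simp add: power2_eq_square field_simps)
  qed (use x in \<open>simp_all add: field_simps power2_eq_square\<close>)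
  moreover have "exp (x - 41/250 * s * x\<^sup>2 + 59/10000 * x ^ 3) \<le> 7/4 + (7/4 * s ^ 3 + 1/2)\<^sup>2 * exp (- (x * (s\<^sup>2 - 1)))" if "33/20 \<le> s" "s \<le> 9/5"
  proof (rule exp_le_add_between[OF _ exp_le_tangent_const_5 _ _ that exp_le_at_breakpoint_3 _ exp_le_at_breakpoint_4])
    show "x * (33/20)\<^sup>2 + (- 5*41/250 * x\<^sup>2) * (33/20) + (4 * x + 5*59/10000 * x ^ 3) \<le> 236/50 + 212/50"
      using cubic_le[OF x, of "5*59/10000" "5*41/250*(33/20)" "68/25" "448/50" "4 + (33/20)\<^sup>2"] by (simp add: power2_eq_square field_simps)
    show "x * (9/5)\<^sup>2 + (- 5*41/250 * x\<^sup>2) * (9/5) + (4 * x + 5*59/10000 * x ^ 3) \<le> 236/50 + 236/50"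
      using cubic_le[OF x, of "5*59/10000" "5*41/250*(9/5)" "133/50" "472/50" "4 + (9/5)\<^sup>2"] by (simp add: power2_eq_square field_simps)
  qed (use x in \<open>simp_all add: field_simps power2_eq_square\<close>)
  moreover have "exp (x - 41/250 * s * x\<^sup>2 + 59/10000 * x ^ 3) \<le> 7/4 + (7/4 * s ^ 3 + 1/2)\<^sup>2 * exp (- (x * (s\<^sup>2 - 1)))" if "9/5 \<le> s" "s \<le> 21/10"
  proof (rule exp_le_add_between[OF _ exp_le_tangent_const_7 _ _ that exp_le_at_breakpoint_4 _ exp_le_at_breakpoint_5])
    show "x * (9/5)\<^sup>2 + (- 7*41/250 * x\<^sup>2) * (9/5) + (6 * x + 7*59/10000 * x ^ 3) \<le> 311/50 + 236/50"
      using cubic_le[OF x, of "7*59/10000" "7*41/250*(9/5)" "241/100" "547/50" "6 + (9/5)\<^sup>2"] by (simp add: power2_eq_square field_simps)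
    show "x * (21/10)\<^sup>2 + (- 7*41/250 * x\<^sup>2) * (21/10) + (6 * x + 7*59/10000 * x ^ 3) \<le> 311/50 + 281/50"
      using cubic_le[OF x, of "7*59/10000" "7*41/250*(21/10)" "229/100" "592/50" "6 + (21/10)\<^sup>2"] by (simp add: power2_eq_square field_simps)
  qed (use x in \<open>simp_all add: field_simps power2_eq_square\<close>)
  moreover have "exp (x - 41/250 * s * x\<^sup>2 + 59/10000 * x ^ 3) \<le> 7/4 + (7/4 * s ^ 3 + 1/2)\<^sup>2 * exp (- (x * (s\<^sup>2 - 1)))" if "21/10 \<le> s" "s \<le> 14/5"
  proof (rule exp_le_add_between[OF _ exp_le_tangent_const_11 _ _ that exp_le_at_breakpoint_5 _ exp_le_at_breakpoint_6])
    show "x * (21/10)\<^sup>2 + (- 11*41/250 * x\<^sup>2) * (21/10) + (10 * x + 11*59/10000 * x ^ 3) \<le> 446/50 + 281/50"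
      using cubic_le[OF x, of "11*59/10000" "11*41/250*(21/10)" "2" "727/50" "10 + (21/10)\<^sup>2"] by (simp add: power2_eq_square field_simps)
    show "x * (14/5)\<^sup>2 + (- 11*41/250 * x\<^sup>2) * (14/5) + (10 * x + 11*59/10000 * x ^ 3) \<le> 446/50 + 365/50"
      using cubic_le[OF x, of "11*59/10000" "11*41/250*(14/5)" "183/100" "811/50" "10 + (14/5)\<^sup>2"] by (simp add: power2_eq_square field_simps)
  qed (use x in \<open>simp_all add: field_simps power2_eq_square\<close>)
  moreover have "exp (x - 41/250 * s * x\<^sup>2 + 59/10000 * x ^ 3) \<le> 7/4 + (7/4 * s ^ 3 + 1/2)\<^sup>2 * exp (- (x * (s\<^sup>2 - 1)))" if "14/5 \<le> s"
  proof -
    have "14/5 * x\<^sup>2 \<le> s * x\<^sup>2" using that by (intro mult_right_mono) auto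
    then have "x - 41/250 * s * x\<^sup>2 + 59/10000 * x ^ 3 \<le> 111/200"
      using cubic_le[OF x, of "59/10000" "41/250*(14/5)" "223/200" "111/200" "1"] by (simp add: power2_eq_square)
    then have "exp (x - 41/250 * s * x\<^sup>2 + 59/10000 * x ^ 3) \<le> exp (111/200)" by simp
    also have "\<dots> \<le> 7/4" by (rule exp_111_200)
    finally show ?thesis by (simp add: add_increasing2)
  qed
  ultimately show ?thesis using s by linarith
qed

text \<open>The chord from \<open>t = 1/4\<close> to \<open>t = 1\<close> bounds the convex function
  from below by \<open>x - 7/4 + (5/4 * x - 2379/1000) * (s - 1)\<close>, the last numeral being
  rounded up. The breakpoint conditions are affine and nonincreasing in \<open>x\<close>, so
  \<open>x = 7/2\<close> is the worst case.\<close>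

lemma exp_chord_le_large:
  fixes x s :: real
  assumes x: "7/2 \<le> x" and s: "s \<ge> 1"
  shows "exp (7/4 - (5/4 * x - 2379/1000) * (s - 1)) \<le> 7/4 + (7/4 * s ^ 3 + 1/2)\<^sup>2 * exp (- (x * (s\<^sup>2 - 1)))"
proof -
  have "exp (7/4 - (5/4 * x - 2379/1000) * (s - 1)) \<le> 7/4 + (7/4 * s ^ 3 + 1/2)\<^sup>2 * exp (- (x * (s\<^sup>2 - 1)))" if "1 \<le> s" "s \<le> 13/10"
  proof (rule exp_le_add_between[OF _ exp_le_tangent_const_2 _ _ that exp_le_at_breakpoint_0 _ exp_le_at_breakpoint_1])
    show "x * (1)\<^sup>2 + (- 2 * (5/4 * x - 2379/1000)) * (1) + (2 * (7/4 + (5/4 * x - 2379/1000)) - x) \<le> 97/50 + 81/50"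
      using x by (simp add: power2_eq_square field_simps)
    show "x * (13/10)\<^sup>2 + (- 2 * (5/4 * x - 2379/1000)) * (13/10) + (2 * (7/4 + (5/4 * x - 2379/1000)) - x) \<le> 97/50 + 146/50"
      using x by (simp add: power2_eq_square field_simps)
  qed (use x in \<open>simp_all add: field_simps power2_eq_square\<close>)
  moreover have "exp (7/4 - (5/4 * x - 2379/1000) * (s - 1)) \<le> 7/4 + (7/4 * s ^ 3 + 1/2)\<^sup>2 * exp (- (x * (s\<^sup>2 - 1)))" if "13/10 \<le> s" "s \<le> 3/2"
  proof (rule exp_le_add_between[OF _ exp_le_tangent_const_3 _ _ that exp_le_at_breakpoint_1 _ exp_le_at_breakpoint_2])
    show "x * (13/10)\<^sup>2 + (- 3 * (5/4 * x - 2379/1000)) * (13/10) + (3 * (7/4 + (5/4 * x - 2379/1000)) - x) \<le> 151/50 + 146/50"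
      using x by (simp add: power2_eq_square field_simps)
    show "x * (3/2)\<^sup>2 + (- 3 * (5/4 * x - 2379/1000)) * (3/2) + (3 * (7/4 + (5/4 * x - 2379/1000)) - x) \<le> 151/50 + 185/50"
      using x by (simp add: power2_eq_square field_simps)
  qed (use x in \<open>simp_all add: field_simps power2_eq_square\<close>)
  moreover have "exp (7/4 - (5/4 * x - 2379/1000) * (s - 1)) \<le> 7/4 + (7/4 * s ^ 3 + 1/2)\<^sup>2 * exp (- (x * (s\<^sup>2 - 1)))" if "3/2 \<le> s" "s \<le> 33/20"
  proof (rule exp_le_add_between[OF _ exp_le_tangent_const_4 _ _ that exp_le_at_breakpoint_2 _ exp_le_at_breakpoint_3])
    show "x * (3/2)\<^sup>2 + (- 4 * (5/4 * x - 2379/1000)) * (3/2) + (4 * (7/4 + (5/4 * x - 2379/1000)) - x) \<le> 196/50 + 185/50"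
      using x by (simp add: power2_eq_square field_simps)
    show "x * (33/20)\<^sup>2 + (- 4 * (5/4 * x - 2379/1000)) * (33/20) + (4 * (7/4 + (5/4 * x - 2379/1000)) - x) \<le> 196/50 + 212/50"
      using x by (simp add: power2_eq_square field_simps)
  qed (use x in \<open>simp_all add: field_simps power2_eq_square\<close>)
  moreover have "exp (7/4 - (5/4 * x - 2379/1000) * (s - 1)) \<le> 7/4 + (7/4 * s ^ 3 + 1/2)\<^sup>2 * exp (- (x * (s\<^sup>2 - 1)))" if "33/20 \<le> s"
  proof -
    have "(5/4 * (7/2) - 2379/1000) * (33/20 - 1) \<le> (5/4 * x - 2379/1000) * (s - 1)"
      using that x by (intro mult_mono) auto
    then have "7/4 - (5/4 * x - 2379/1000) * (s - 1) \<le> 111/200" by simp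
    then have "exp (7/4 - (5/4 * x - 2379/1000) * (s - 1)) \<le> exp (111/200)" by simp
    also have "\<dots> \<le> 7/4" by (rule exp_111_200)
    finally show ?thesis by (simp add: add_increasing2)
  qed
  ultimately show ?thesis using s by linarith
qed

text \<open>The counterpart for the chord from the origin, with \<open>7/8 * x\<close> in place of
  \<open>x\<close>. The best second endpoint is \<open>t = 2 * x / 7\<close>, where the slope
  \<open>x * t - 7/4 * t\<^sup>2\<close> takes its maximum \<open>x\<^sup>2 / 7\<close>.\<close>

lemma exp_cone_le:
  fixes x s :: real
  assumes x: "0 \<le> x" "x \<le> 7/2" and s: "s \<ge> 1"
  shows "exp (7/8 * x - s * x\<^sup>2 / 7) \<le> 7/4 + (7/4 * s ^ 3 + 1/2)\<^sup>2 * exp (- (x * (s\<^sup>2 - 7/8)))"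
proof -
  have "exp (7/8 * x - s * x\<^sup>2 / 7) \<le> 7/4 + (7/4 * s ^ 3 + 1/2)\<^sup>2 * exp (- (x * (s\<^sup>2 - 7/8)))" if "1 \<le> s" "s \<le> 33/20"
  proof (rule exp_le_add_between[OF _ exp_le_tangent_const_3 _ _ that exp_le_at_breakpoint_0 _ exp_le_at_breakpoint_3])
    show "x * (1)\<^sup>2 + (- 3/7 * x\<^sup>2) * (1) + (7/8 * 2 * x) \<le> 151/50 + 81/50"
      using cubic_le[OF x, of "0" "3/7*(1)" "16/5" "232/50" "7/8*2 + (1)\<^sup>2"] by (simp add: power2_eq_square field_simps)
    show "x * (33/20)\<^sup>2 + (- 3/7 * x\<^sup>2) * (33/20) + (7/8 * 2 * x) \<le> 151/50 + 212/50"
      using cubic_le[OF x, of "0" "3/7*(33/20)" "79/25" "363/50" "7/8*2 + (33/20)\<^sup>2"] by (simp add: power2_eq_square field_simps)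
  qed (use x in \<open>simp_all add: field_simps power2_eq_square\<close>)
  moreover have "exp (7/8 * x - s * x\<^sup>2 / 7) \<le> 7/4 + (7/4 * s ^ 3 + 1/2)\<^sup>2 * exp (- (x * (s\<^sup>2 - 7/8)))" if "33/20 \<le> s" "s \<le> 14/5"
  proof (rule exp_le_add_between[OF _ exp_le_tangent_const_11 _ _ that exp_le_at_breakpoint_3 _ exp_le_at_breakpoint_6])
    show "x * (33/20)\<^sup>2 + (- 11/7 * x\<^sup>2) * (33/20) + (7/8 * 10 * x) \<le> 446/50 + 212/50"
      using cubic_le[OF x, of "0" "11/7*(33/20)" "221/100" "658/50" "7/8*10 + (33/20)\<^sup>2"] by (simp add: power2_eq_square field_simps)
    show "x * (14/5)\<^sup>2 + (- 11/7 * x\<^sup>2) * (14/5) + (7/8 * 10 * x) \<le> 446/50 + 365/50"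
      using cubic_le[OF x, of "0" "11/7*(14/5)" "47/25" "811/50" "7/8*10 + (14/5)\<^sup>2"] by (simp add: power2_eq_square field_simps)
  qed (use x in \<open>simp_all add: field_simps power2_eq_square\<close>)
  moreover have "exp (7/8 * x - s * x\<^sup>2 / 7) \<le> 7/4 + (7/4 * s ^ 3 + 1/2)\<^sup>2 * exp (- (x * (s\<^sup>2 - 7/8)))" if "14/5 \<le> s"
  proof -
    have "14/5 * x\<^sup>2 \<le> s * x\<^sup>2" using that by (intro mult_right_mono) auto
    then have "7/8 * x - s * x\<^sup>2 / 7 \<le> 111/200"
      using cubic_le[OF x, of "0" "2/5" "35/32" "111/200" "7/8"] by (simp add: power2_eq_square)
    then have "exp (7/8 * x - s * x\<^sup>2 / 7) \<le> exp (111/200)" by simp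
    also have "\<dots> \<le> 7/4" by (rule exp_111_200)
    finally show ?thesis by (simp add: add_increasing2)
  qed
  ultimately show ?thesis using s by linarith
qed

text \<open>For \<open>x > 7/2\<close> the point \<open>2 * x / 7\<close> lies beyond the unit
  interval, so the chord from the origin ends at \<open>t = 1\<close>, at height
  \<open>x - 7/4\<close>.\<close>

lemma exp_cone_le_large:
  fixes x s :: real
  assumes x: "7/2 \<le> x" and s: "s \<ge> 1"
  shows "exp (7/8 * x - s * (x - 7/4)) \<le> 7/4 + (7/4 * s ^ 3 + 1/2)\<^sup>2 * exp (- (x * (s\<^sup>2 - 7/8)))"
proof -
  have "exp (7/8 * x - s * (x - 7/4)) \<le> 7/4 + (7/4 * s ^ 3 + 1/2)\<^sup>2 * exp (- (x * (s\<^sup>2 - 7/8)))" if "1 \<le> s" "s \<le> 33/20"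
  proof (rule exp_le_add_between[OF _ exp_le_tangent_const_3 _ _ that exp_le_at_breakpoint_0 _ exp_le_at_breakpoint_3])
    show "x * (1)\<^sup>2 + (- 3 * (x - 7/4)) * (1) + (7/8 * 2 * x) \<le> 151/50 + 81/50"
      using x by (simp add: power2_eq_square field_simps)
    show "x * (33/20)\<^sup>2 + (- 3 * (x - 7/4)) * (33/20) + (7/8 * 2 * x) \<le> 151/50 + 212/50"
      using x by (simp add: power2_eq_square field_simps)
  qed (use x in \<open>simp_all add: field_simps power2_eq_square\<close>)
  moreover have "exp (7/8 * x - s * (x - 7/4)) \<le> 7/4 + (7/4 * s ^ 3 + 1/2)\<^sup>2 * exp (- (x * (s\<^sup>2 - 7/8)))" if "33/20 \<le> s" "s \<le> 14/5"
  proof (rule exp_le_add_between[OF _ exp_le_tangent_const_11 _ _ that exp_le_at_breakpoint_3 _ exp_le_at_breakpoint_6])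
    show "x * (33/20)\<^sup>2 + (- 11 * (x - 7/4)) * (33/20) + (7/8 * 10 * x) \<le> 446/50 + 212/50"
      using x by (simp add: power2_eq_square field_simps)
    show "x * (14/5)\<^sup>2 + (- 11 * (x - 7/4)) * (14/5) + (7/8 * 10 * x) \<le> 446/50 + 365/50"
      using x by (simp add: power2_eq_square field_simps)
  qed (use x in \<open>simp_all add: field_simps power2_eq_square\<close>)
  moreover have "exp (7/8 * x - s * (x - 7/4)) \<le> 7/4 + (7/4 * s ^ 3 + 1/2)\<^sup>2 * exp (- (x * (s\<^sup>2 - 7/8)))" if "14/5 \<le> s"
  proof -
    have "14/5 * (x - 7/4) \<le> s * (x - 7/4)" using that x by (intro mult_right_mono) auto
    then have "7/8 * x - s * (x - 7/4) \<le> 111/200" using x by simp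
    then have "exp (7/8 * x - s * (x - 7/4)) \<le> exp (111/200)" by simp
    also have "\<dots> \<le> 7/4" by (rule exp_111_200)
    finally show ?thesis by (simp add: add_increasing2)
  qed
  ultimately show ?thesis using s by linarith
qed

subsection \<open>Convex functions close to a parabola on a ray\<close>

text \<open>\<open>g\<close> decreases up to 0, where its value is 1, increases up to 1 and
  decreases again. Only its value at the right end \<open>7/4\<close> therefore has to be compared
  with 1.\<close>

lemma exp_le_quadratic:
  fixes y :: real
  assumes "y \<le> 7/4"
  shows "exp y \<le> 1 + y + y\<^sup>2"
proof -
  define g where "g = (\<lambda>y::real. (1 + y + y\<^sup>2) * exp (- y))"
  have deriv: "(g has_real_derivative y * (1 - y) * exp (- y)) (at y)" for y
    unfolding g_def by (auto intro!: derivative_eq_intros simp: algebra_simps power2_eq_square)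
  have g0: "g 0 = 1" by (simp add: g_def)
  have "1 \<le> g y"
  proof -
    consider "y \<le> 0" | "0 \<le> y" "y \<le> 1" | "1 \<le> y" by linarith
    then show ?thesis
    proof cases
      case 1
      have "g 0 \<le> g y"
        by (rule DERIV_nonpos_imp_nonincreasing[OF 1])
          (use deriv in \<open>force simp: mult_nonpos_nonneg\<close>)
      then show ?thesis by (simp add: g0)
    next
      case 2
      have "g 0 \<le> g y"
        by (rule DERIV_nonneg_imp_nondecreasing[OF 2(1)])
          (use deriv 2 in \<open>force simp: mult_nonneg_nonneg\<close>)
      then show ?thesis by (simp add: g0)
    next
      case 3
      \<comment> \<open>\<open>93/16\<close> is \<open>1 + y + y\<^sup>2\<close> at
        \<open>y = 7/4\<close>; the fourth power replaces \<open>exp (7/4)\<close> by an integer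
        power of e.\<close>
      have "exp (7/4 :: real) ^ 4 = exp 1 ^ 7"
        by (simp flip: exp_of_nat_mult)
      also have "\<dots> \<le> (272/100) ^ 7"
        using e_less_272 by (intro power_mono) auto
      also have "\<dots> \<le> (93/16) ^ 4" by (simp add: power_divide)
      finally have "exp (7/4 :: real) \<le> 93/16" by (rule power_le_imp_le_base[where n = 3, simplified]) simp
      then have "1 \<le> g (7/4)"
        by (simp add: g_def power2_eq_square exp_minus divide_simps)
      also have "g (7/4) \<le> g y"
        by (rule DERIV_nonpos_imp_nonincreasing[OF assms])
          (use deriv 3 in \<open>force simp: mult_nonneg_nonpos mult_nonpos_nonneg\<close>)
      finally show ?thesis .
    qed
  qed
  then show ?thesis by (simp add: g_def exp_minus divide_simps)
qed

text \<open>Serves as a lower bound for \<open>\<psi> 1\<close>: beyond \<open>b\<close> a convex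
  function lies above the chord through \<open>a\<close> and \<open>b\<close>.\<close>

lemma convex_on_chord_le:
  fixes \<psi> :: "real \<Rightarrow> real"
  assumes "convex_on {0..1} \<psi>" "0 \<le> a" "a < b" "b \<le> 1"
  shows "(1 - a) * \<psi> b \<le> (1 - b) * \<psi> a + (b - a) * \<psi> 1"
proof -
  define t where "t = (b - a) / (1 - a)"
  have a: "1 - a > 0" using assms by simp
  then have ta: "t * (1 - a) = b - a" by (simp add: t_def)
  have "b = (1 - t) * a + t * 1" using ta by (simp add: algebra_simps)
  moreover have "0 \<le> t" "t \<le> 1" using assms a by (auto simp: t_def)
  ultimately have t: "0 \<le> t" "t \<le> 1" "b = (1 - t) * a + t * 1" by blast+
  have "\<psi> b \<le> (1 - t) * \<psi> a + t * \<psi> 1"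
    using convex_onD[OF assms(1) t(1,2), of a 1] assms t(3) by simp
  then have "(1 - a) * \<psi> b \<le> (1 - a) * ((1 - t) * \<psi> a + t * \<psi> 1)"
    using a by (intro mult_left_mono) auto
  also have "\<dots> = (1 - a) * (1 - t) * \<psi> a + (1 - a) * t * \<psi> 1"
    by (simp add: algebra_simps)
  also have "(1 - a) * t = b - a" using a by (simp add: t_def)
  also have "(1 - a) * (1 - t) = 1 - b" using a by (simp add: t_def field_simps)
  finally show ?thesis .
qed

text \<open>
  Without an upper bound the best chord starts at the origin; after multiplication by
  \<open>exp (- 7/8 * x)\<close> its last term is \<open>7/4 * exp (- 7/8 * x)\<close>, and that chord does not suffice
  for \<open>7/4 * exp (- x)\<close>. With the upper bound the chord from
  \<open>t = x / 14\<close> to \<open>t = 9/35 * x\<close> is nearly the common tangent of the two cubics (from \<open>1/4\<close> to \<open>1\<close>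
  for \<open>x > 7/2\<close>).
\<close>

lemma exp_bound_of_low_up:
  fixes \<psi> :: "real \<Rightarrow> real" and h x s F :: real
  assumes cv: "convex_on {0..1} \<psi>" and \<psi>0: "\<psi> 0 = 0"
    and h: "0 < h" "h \<le> 1" and x: "x > 0"
    and low: "\<And>t. 0 \<le> t \<Longrightarrow> t \<le> 1 \<Longrightarrow> x * t\<^sup>2 - 7/4 * t ^ 3 \<le> \<psi> (t * h)"
  shows exp_bound_of_low:
      "exp (7/8 * x - \<psi> 1) \<le> 7/4 + (7/4 * (1 / h) ^ 3 + 1/2)\<^sup>2 * exp (- (x * ((1 / h)\<^sup>2 - 7/8)))"
    and exp_bound_of_up: "(\<And>t. 0 \<le> t \<Longrightarrow> t \<le> 1/4 \<Longrightarrow> \<psi> (t * h) \<le> x * t\<^sup>2 + 35/16 * t ^ 3) \<Longrightarrow>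
      exp (x - \<psi> 1) \<le> 7/4 + (7/4 * (1 / h) ^ 3 + 1/2)\<^sup>2 * exp (- (x * ((1 / h)\<^sup>2 - 1)))"
proof -
  define s where "s = 1 / h"
  have s: "s \<ge> 1" "s > 0" using h by (auto simp: s_def)
  have hs: "h = 1 / s" using h by (simp add: s_def)
  have cone: "s * \<psi> (t * h) \<le> t * \<psi> 1" if "0 < t" "t \<le> 1" for t
  proof -
    have "\<psi> (t * h) \<le> t * h * \<psi> 1"
      using convex_on_chord_le[OF cv, of 0 "t * h"] that h \<psi>0 by (simp add: mult_le_one)
    then show ?thesis using s by (simp add: hs field_simps)
  qed
  have "exp (7/8 * x - \<psi> 1) \<le> 7/4 + (7/4 * s ^ 3 + 1/2)\<^sup>2 * exp (- (x * (s\<^sup>2 - 7/8)))"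
  proof (cases "x \<le> 7/2")
    case True
    have "s * (2 * x ^ 3 / 49) \<le> s * \<psi> (2 * x / 7 * h)"
      using low[of "2 * x / 7"] True x s
      by (intro mult_left_mono) (simp_all add: power2_eq_square power3_eq_cube field_simps)
    also have "\<dots> \<le> 2 * x / 7 * \<psi> 1" using cone[of "2 * x / 7"] True x by simp
    finally have "2 * x / 7 * (s * x\<^sup>2 / 7) \<le> 2 * x / 7 * \<psi> 1"
      by (simp add: power2_eq_square power3_eq_cube algebra_simps)
    then have "s * x\<^sup>2 / 7 \<le> \<psi> 1" using x by (simp add: mult_le_cancel_left)
    then have "exp (7/8 * x - \<psi> 1) \<le> exp (7/8 * x - s * x\<^sup>2 / 7)" by simp
    also have "\<dots> \<le> 7/4 + (7/4 * s ^ 3 + 1/2)\<^sup>2 * exp (- (x * (s\<^sup>2 - 7/8)))"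
      using exp_cone_le[of x s] True x s by simp
    finally show ?thesis .
  next
    case False
    have "s * (x - 7/4) \<le> s * \<psi> (1 * h)"
      using low[of 1] s by (intro mult_left_mono) auto
    also have "\<dots> \<le> \<psi> 1" using cone[of 1] by simp
    finally have "exp (7/8 * x - \<psi> 1) \<le> exp (7/8 * x - s * (x - 7/4))" by simp
    also have "\<dots> \<le> 7/4 + (7/4 * s ^ 3 + 1/2)\<^sup>2 * exp (- (x * (s\<^sup>2 - 7/8)))"
      using exp_cone_le_large[of x s] False s by simp
    finally show ?thesis .
  qed
  then show "exp (7/8 * x - \<psi> 1) \<le> 7/4 + (7/4 * (1 / h) ^ 3 + 1/2)\<^sup>2 * exp (- (x * ((1 / h)\<^sup>2 - 7/8)))"
    by (simp only: s_def)
  \<comment> \<open>\<open>35/16\<close> is \<open>7/4 * (5/4)\<close>; the factor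
    \<open>5/4\<close> bounds the cube of the ratio of the two radii in the case where this upper
    bound is used.\<close>
  assume up: "\<And>t. 0 \<le> t \<Longrightarrow> t \<le> 1/4 \<Longrightarrow> \<psi> (t * h) \<le> x * t\<^sup>2 + 35/16 * t ^ 3"
  have chord: "(s - a) * L \<le> (s - b) * U + (b - a) * \<psi> 1"
    if "0 \<le> a" "a < b" "b \<le> 1" "L \<le> \<psi> (b * h)" "\<psi> (a * h) \<le> U" for a b L U
  proof -
    have "b * h \<le> 1" using that h by (simp add: mult_le_one)
    then have "(1 - a * h) * \<psi> (b * h) \<le> (1 - b * h) * \<psi> (a * h) + (b * h - a * h) * \<psi> 1"
      using convex_on_chord_le[OF cv, of "a * h" "b * h"] that h by simp
    then have "s * ((1 - a * h) * \<psi> (b * h)) \<le> s * ((1 - b * h) * \<psi> (a * h) + (b * h - a * h) * \<psi> 1)"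
      using s by (intro mult_left_mono) auto
    then have "(s - a) * \<psi> (b * h) \<le> (s - b) * \<psi> (a * h) + (b - a) * \<psi> 1"
      using s by (simp add: hs algebra_simps)
    moreover have "(s - a) * L \<le> (s - a) * \<psi> (b * h)" "(s - b) * \<psi> (a * h) \<le> (s - b) * U"
      using that s by (auto intro!: mult_left_mono)
    ultimately show ?thesis by linarith
  qed
  have "exp (x - \<psi> 1) \<le> 7/4 + (7/4 * s ^ 3 + 1/2)\<^sup>2 * exp (- (x * (s\<^sup>2 - 1)))"
  proof (cases "x \<le> 7/2")
    case True
    have "6237/171500 * x ^ 3 \<le> \<psi> (9/35 * x * h)"
      using low[of "9/35 * x"] True x by (simp add: power2_eq_square power3_eq_cube field_simps)
    moreover have "\<psi> (x / 14 * h) \<le> 37/6272 * x ^ 3"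
      using up[of "x / 14"] True x by (simp add: power2_eq_square power3_eq_cube field_simps)
    ultimately have "(s - x / 14) * (6237/171500 * x ^ 3) \<le> (s - 9/35 * x) * (37/6272 * x ^ 3) + (9/35 * x - x / 14) * \<psi> 1"
      using True x by (intro chord) auto
    then have "x * ((s - x / 14) * (6237/171500 * x\<^sup>2)) \<le> x * ((s - 9/35 * x) * (37/6272 * x\<^sup>2) + 13/70 * \<psi> 1)"
      by (simp add: power2_eq_square power3_eq_cube algebra_simps)
    then have "(s - x / 14) * (6237/171500 * x\<^sup>2) \<le> (s - 9/35 * x) * (37/6272 * x\<^sup>2) + 13/70 * \<psi> 1"
      using x by (simp add: mult_le_cancel_left)
    moreover have "(s - x / 14) * (6237/171500 * x\<^sup>2) = 6237/171500 * (s * x\<^sup>2) - 891/343000 * x ^ 3"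
      "(s - 9/35 * x) * (37/6272 * x\<^sup>2) = 37/6272 * (s * x\<^sup>2) - 333/219520 * x ^ 3"
      by (simp_all add: power2_eq_square power3_eq_cube field_simps)
    ultimately have ineq: "6237/171500 * (s * x\<^sup>2) - 891/343000 * x ^ 3
        \<le> 37/6272 * (s * x\<^sup>2) - 333/219520 * x ^ 3 + 13/70 * \<psi> 1"
      by (simp only:)
    \<comment> \<open>Solving the chord inequality for \<open>R\<close> gives the coefficients
      0.16406 and 0.00582 approximately; the first is rounded down, the second up.\<close>
    have "41/250 * P - 59/10000 * Q \<le> R"
      if "6237/171500 * P - 891/343000 * Q \<le> 37/6272 * P - 333/219520 * Q + 13/70 * R" "0 \<le> P" "0 \<le> Q"
      for P Q R :: real using that by simp
    from this[OF ineq] have "41/250 * (s * x\<^sup>2) - 59/10000 * x ^ 3 \<le> \<psi> 1"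
      using s x by simp
    then have "exp (x - \<psi> 1) \<le> exp (x - 41/250 * s * x\<^sup>2 + 59/10000 * x ^ 3)" by (simp add: mult.assoc)
    also have "\<dots> \<le> 7/4 + (7/4 * s ^ 3 + 1/2)\<^sup>2 * exp (- (x * (s\<^sup>2 - 1)))"
      using exp_chord_le[of x s] True x s by simp
    finally show ?thesis .
  next
    case False
    have "x - 7/4 \<le> \<psi> (1 * h)" using low[of 1] by simp
    moreover have "\<psi> (1/4 * h) \<le> x / 16 + 35/1024"
      using up[of "1/4"] by (simp add: power2_eq_square power3_eq_cube)
    ultimately have "(s - 1/4) * (x - 7/4) \<le> (s - 1) * (x / 16 + 35/1024) + (1 - 1/4) * \<psi> 1"
      by (intro chord) auto
    then have "(x - 7/4) + (5/4 * x - 2379/1000) * (s - 1) \<le> \<psi> 1"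
      using s by (simp add: field_simps)
    then have "exp (x - \<psi> 1) \<le> exp (7/4 - (5/4 * x - 2379/1000) * (s - 1))" by simp
    also have "\<dots> \<le> 7/4 + (7/4 * s ^ 3 + 1/2)\<^sup>2 * exp (- (x * (s\<^sup>2 - 1)))"
      using exp_chord_le_large[of x s] False s by simp
    finally show ?thesis .
  qed
  then show "exp (x - \<psi> 1) \<le> 7/4 + (7/4 * (1 / h) ^ 3 + 1/2)\<^sup>2 * exp (- (x * ((1 / h)\<^sup>2 - 1)))"
    by (simp only: s_def)
qed

text \<open>
  The bound is reduced to \<open>exp_bound_of_low_up\<close> at the point \<open>h0 \<ge> h\<close> where the error at \<open>1\<close>,
  scaled by the cube, reaches \<open>7/4\<close>. If \<open>h0\<close> is much larger than \<open>h\<close>, the last term gains enough for the chord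
  from the origin; otherwise the upper bound at \<open>h\<close> is still good enough at \<open>h0\<close>.
\<close>

lemma exp_bound_ray:
  fixes \<psi> :: "real \<Rightarrow> real" and z u v \<alpha> h :: real
  assumes cv: "convex_on {0..1} \<psi>" and \<psi>0: "\<psi> 0 = 0"
    and h: "0 < h" "h \<le> 1" and z: "z > 0" and v: "v \<ge> 0" and \<alpha>: "\<alpha> \<ge> 1"
    and bound: "\<And>t. 0 \<le> t \<Longrightarrow> t \<le> 1 \<Longrightarrow> \<bar>\<psi> t - (z * t\<^sup>2 - u * t ^ 3)\<bar> \<le> v * t powr (2 + \<alpha>)"
    and small: "\<bar>u\<bar> * h ^ 3 + v * h powr (2 + \<alpha>) \<le> 7/4"
  shows "exp (- \<psi> 1) \<le> exp (- z) * (1 + (u + v) + (u + v)\<^sup>2) + 7/4 * exp (- (z * h\<^sup>2))"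
proof (cases "u + v \<le> 7/4")
  case True
  have "- \<psi> 1 \<le> - z + (u + v)" using bound[of 1] by simp
  then have "exp (- \<psi> 1) \<le> exp (- z + (u + v))" by simp
  also have "\<dots> = exp (- z) * exp (u + v)" by (rule exp_add)
  also have "\<dots> \<le> exp (- z) * (1 + (u + v) + (u + v)\<^sup>2)"
    using exp_le_quadratic[OF True] by simp
  finally show ?thesis by (simp add: add_increasing2)
next
  case False
  define y where "y = u + v"
  have y: "y > 7/4" using False by (simp add: y_def)
  define h1 where "h1 = root 3 (7 / (4 * y))"
  have h1: "0 < h1" "h1 \<le> 1" "y * h1 ^ 3 = 7/4"
    using y by (simp_all add: h1_def)
  define h0 where "h0 = max h h1"
  have h0: "0 < h0" "h0 \<le> 1" "h \<le> h0" "h1 \<le> h0" using h h1 by (auto simp: h0_def)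
  \<comment> \<open>The place where \<open>\<alpha> \<ge> 1\<close> enters: on the unit interval the
    remainder shrinks at least as fast as the cube.\<close>
  have powr_le: "t powr (2 + \<alpha>) \<le> t ^ 3" if "0 \<le> t" "t \<le> 1" for t :: real
  proof (cases "t = 0")
    case False
    then have "t powr (2 + \<alpha>) \<le> t powr 3" using that \<alpha> by (intro powr_mono') auto
    then show ?thesis using that False by (simp add: powr_numeral)
  qed simp
  have within: "\<bar>u\<bar> * (t * h) ^ 3 + v * (t * h) powr (2 + \<alpha>) \<le> 7/4 * t ^ 3" if "0 \<le> t" "t \<le> 1" for t
  proof -
    have "v * (t * h) powr (2 + \<alpha>) = t powr (2 + \<alpha>) * (v * h powr (2 + \<alpha>))"
      using that h by (simp add: powr_mult)
    also have "\<dots> \<le> t ^ 3 * (v * h powr (2 + \<alpha>))"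
      using v by (intro mult_right_mono powr_le that) auto
    finally have "\<bar>u\<bar> * (t * h) ^ 3 + v * (t * h) powr (2 + \<alpha>) \<le> t ^ 3 * (\<bar>u\<bar> * h ^ 3 + v * h powr (2 + \<alpha>))"
      by (simp add: power_mult_distrib algebra_simps)
    also have "\<dots> \<le> t ^ 3 * (7/4)" using small that by (intro mult_left_mono) auto
    finally show ?thesis by simp
  qed
  \<comment> \<open>If \<open>h0 = h1\<close>, only \<open>u + v\<close> is under control at this
    radius, not \<open>\<bar>u\<bar> + v\<close>. That is enough for a lower bound on
    \<open>\<psi>\<close>; the upper bound has to come from \<open>within\<close>, at the price of a
    constant factor.\<close>
  have low_err: "u * (t * h0) ^ 3 + v * (t * h0) powr (2 + \<alpha>) \<le> 7/4 * t ^ 3" if t: "0 \<le> t" "t \<le> 1" for t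
  proof (cases "h1 \<le> h")
    case True
    then have "h0 = h" by (simp add: h0_def)
    moreover have "u * (t * h) ^ 3 \<le> \<bar>u\<bar> * (t * h) ^ 3"
      using t h by (intro mult_right_mono) auto
    ultimately show ?thesis using within[OF t] by simp
  next
    case False
    then have eq: "h0 = h1" by (simp add: h0_def)
    have "v * (t * h1) powr (2 + \<alpha>) \<le> v * (t * h1) ^ 3"
      using t h1 v by (intro mult_left_mono powr_le) (auto simp: mult_le_one)
    then have "u * (t * h1) ^ 3 + v * (t * h1) powr (2 + \<alpha>) \<le> y * h1 ^ 3 * t ^ 3"
      by (simp add: y_def power_mult_distrib algebra_simps)
    then show ?thesis by (simp add: eq h1(3))
  qed
  define x where "x = z * h0\<^sup>2"
  have x: "x > 0" using z h0 by (simp add: x_def)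
  have low: "x * t\<^sup>2 - 7/4 * t ^ 3 \<le> \<psi> (t * h0)" if t: "0 \<le> t" "t \<le> 1" for t
  proof -
    have "t * h0 \<le> 1" using t h0 by (simp add: mult_le_one)
    then have "z * (t * h0)\<^sup>2 - u * (t * h0) ^ 3 - v * (t * h0) powr (2 + \<alpha>) \<le> \<psi> (t * h0)"
      using bound[of "t * h0"] t h0 by (simp add: abs_le_iff)
    then show ?thesis using low_err[OF t] by (simp add: x_def power_mult_distrib algebra_simps)
  qed
  \<comment> \<open>The square \<open>(y + 1/2)\<^sup>2\<close> falls short of
    \<open>1 + y + y\<^sup>2\<close> by only \<open>3/4\<close>, and its logarithm is twice that of
    a cubic in \<open>1 / h0\<close>, for which the convexity argument is available.\<close>
  define M where "M = (7/4 * (1 / h0) ^ 3 + 1/2)\<^sup>2"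
  have "M \<le> (y + 1/2)\<^sup>2"
  proof -
    have "7/4 \<le> y * h0 ^ 3"
      using h1(3) h0 h1 y by (metis less_eq_real_def mult_left_mono order.trans power_mono zero_less_divide_iff zero_less_numeral)
    then have "7/4 * (1 / h0) ^ 3 \<le> y" using h0 by (simp add: field_simps)
    then show ?thesis unfolding M_def using h0 by (intro power_mono) auto
  qed
  also have "\<dots> \<le> 1 + y + y\<^sup>2" by (simp add: power2_eq_square algebra_simps)
  finally have M: "M \<le> 1 + y + y\<^sup>2" .
  have z_eq: "x * (1 / h0)\<^sup>2 = z" using h0 by (simp add: x_def power_divide)
  have split: "exp (- c) * (7/4 + M * exp (- d)) = exp (- z) * M + 7/4 * exp (- c)" if "c + d = z" for c d
  proof -
    have "exp (- z) = exp (- c) * exp (- d)" using that by (simp flip: exp_add)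
    then show ?thesis by (simp add: algebra_simps)
  qed
  have key: "exp (- \<psi> 1) \<le> exp (- z) * M + 7/4 * exp (- (z * h\<^sup>2))"
  proof (cases "h\<^sup>2 \<le> 7/8 * h0\<^sup>2")
    case True
    have "exp (- \<psi> 1) = exp (- (7/8 * x)) * exp (7/8 * x - \<psi> 1)"
      by (simp flip: exp_add)
    also have "\<dots> \<le> exp (- (7/8 * x)) * (7/4 + M * exp (- (x * ((1 / h0)\<^sup>2 - 7/8))))"
      using exp_bound_of_low[OF cv \<psi>0 h0(1,2) x low] by (intro mult_left_mono) (auto simp: M_def)
    also have "\<dots> = exp (- z) * M + 7/4 * exp (- (7/8 * x))"
      by (rule split) (use z_eq in \<open>simp add: right_diff_distrib\<close>)
    also have "exp (- (7/8 * x)) \<le> exp (- (z * h\<^sup>2))"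
      using mult_left_mono[OF True, of z] z by (simp add: x_def)
    finally show ?thesis by simp
  next
    case False
    define w where "w = h0 / h"
    have w: "w > 0" "h0 = w * h" using h h0 by (auto simp: w_def)
    \<comment> \<open>Since \<open>(8/7) ^ 3 < (5/4)\<^sup>2\<close>, a ratio of squared radii of at
      most \<open>8/7\<close> means a ratio of cubes of at most \<open>5/4\<close>.\<close>
    have "w\<^sup>2 \<le> 8/7" using False h by (simp add: w power_mult_distrib)
    then have "(w\<^sup>2) ^ 3 \<le> (8/7) ^ 3" by (intro power_mono) auto
    then have "(w ^ 3)\<^sup>2 \<le> (5/4)\<^sup>2" by (simp add: power2_eq_square power3_eq_cube algebra_simps)
    then have w3: "w ^ 3 \<le> 5/4" by (rule power2_le_imp_le) simp
    have "w ^ 3 \<le> 2 ^ 3" using w3 by simp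
    then have w2: "w \<le> 2" using w by (subst (asm) power_mono_iff) auto
    have up: "\<psi> (t * h0) \<le> x * t\<^sup>2 + 35/16 * t ^ 3" if t: "0 \<le> t" "t \<le> 1/4" for t
    proof -
      have tw: "t * w \<le> 1" using t w w2 mult_mono[of t "1/4" w 2] by simp
      have "t * h0 \<le> 1" using t h0 by (simp add: mult_le_one)
      then have "\<psi> (t * h0) \<le> z * (t * h0)\<^sup>2 - u * (t * h0) ^ 3 + v * (t * h0) powr (2 + \<alpha>)"
        using bound[of "t * h0"] t h0 by (simp add: abs_le_iff)
      also have "- u * (t * h0) ^ 3 \<le> \<bar>u\<bar> * (t * h0) ^ 3"
        using t h0 by (intro mult_right_mono) auto
      then have "z * (t * h0)\<^sup>2 - u * (t * h0) ^ 3 + v * (t * h0) powr (2 + \<alpha>)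
          \<le> z * (t * h0)\<^sup>2 + (\<bar>u\<bar> * (t * w * h) ^ 3 + v * (t * w * h) powr (2 + \<alpha>))"
        by (simp add: w(2) mult.assoc)
      also have "\<bar>u\<bar> * (t * w * h) ^ 3 + v * (t * w * h) powr (2 + \<alpha>) \<le> 7/4 * (t * w) ^ 3"
        using within[of "t * w"] t w tw by simp
      also have "7/4 * (t * w) ^ 3 = 7/4 * t ^ 3 * w ^ 3" by (simp add: power_mult_distrib)
      also have "\<dots> \<le> 7/4 * t ^ 3 * (5/4)" using w3 t by (intro mult_left_mono) auto
      finally show ?thesis by (simp add: x_def power_mult_distrib algebra_simps)
    qed
    have "exp (- \<psi> 1) = exp (- x) * exp (x - \<psi> 1)"
      by (simp flip: exp_add)
    also have "\<dots> \<le> exp (- x) * (7/4 + M * exp (- (x * ((1 / h0)\<^sup>2 - 1))))"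
      using exp_bound_of_up[OF cv \<psi>0 h0(1,2) x low up] by (intro mult_left_mono) (auto simp: M_def)
    also have "\<dots> = exp (- z) * M + 7/4 * exp (- x)"
      by (rule split) (use z_eq in \<open>simp add: right_diff_distrib\<close>)
    also have "exp (- x) \<le> exp (- (z * h\<^sup>2))"
      using z h h0 by (simp add: x_def power_mono)
    finally show ?thesis by simp
  qed
  also have "exp (- z) * M \<le> exp (- z) * (1 + y + y\<^sup>2)" using M by simp
  finally show ?thesis by (simp add: y_def)
qed

subsection \<open>Positive definite quadratic forms\<close>

lemma symmetric_form:
  fixes H :: "real ^ 'd ^ 'd::finite"
  assumes "transpose H = H"
  shows "x \<bullet> (H *v y) = y \<bullet> (H *v x)"
  by (metis assms dot_lmul_matrix inner_commute vector_transpose_matrix)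

text \<open>The minimum \<open>m\<close> of the form on the unit sphere is an eigenvalue: moving
  from a minimiser \<open>v\<close> against the residual \<open>w = H v - m v\<close> would push the
  form below \<open>m\<close> times the squared norm to first order, unless
  \<open>w = 0\<close>.\<close>

lemma smallest_eigenvalue_le_form:
  fixes H :: "real ^ 'd ^ 'd::finite"
  assumes sym: "transpose H = H" and l: "is_smallest_eigenvalue H l"
  shows "l * (norm x)\<^sup>2 \<le> x \<bullet> (H *v x)"
proof -
  have cont: "continuous_on UNIV (\<lambda>x. x \<bullet> (H *v x))"
    by (intro continuous_intros linear_continuous_on_compose[where g = "(*v) H"] continuous_on_id) auto
  have "\<exists>v\<in>sphere 0 1. \<forall>y\<in>sphere (0 :: real ^ 'd) 1. v \<bullet> (H *v v) \<le> y \<bullet> (H *v y)"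
  proof (rule continuous_attains_inf)
    have "axis undefined 1 \<in> sphere (0 :: real ^ 'd) 1" by (simp add: norm_axis_1)
    then show "sphere (0 :: real ^ 'd) 1 \<noteq> {}" by blast
  qed (use cont continuous_on_subset in auto)
  then obtain v where v: "norm v = 1" and min: "\<And>y. norm y = 1 \<Longrightarrow> v \<bullet> (H *v v) \<le> y \<bullet> (H *v y)"
    by auto
  define m where "m = v \<bullet> (H *v v)"
  have m_le: "m * (norm y)\<^sup>2 \<le> y \<bullet> (H *v y)" for y
  proof (cases "y = 0")
    case False
    have "m \<le> (y /\<^sub>R norm y) \<bullet> (H *v (y /\<^sub>R norm y))"
      unfolding m_def using False by (intro min) simp
    also have "\<dots> = y \<bullet> (H *v y) / (norm y)\<^sup>2"
      by (simp add: matrix_vector_mult_scaleR power2_eq_square divide_simps)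
    finally show ?thesis using False by (simp add: field_simps)
  qed simp
  define w where "w = H *v v - m *\<^sub>R v"
  define b where "b = w \<bullet> (H *v w) - m * (norm w)\<^sup>2"
  have quad: "0 \<le> 2 * s * (norm w)\<^sup>2 + s\<^sup>2 * b" for s
  proof -
    have "m * (norm (v + s *\<^sub>R w))\<^sup>2 \<le> (v + s *\<^sub>R w) \<bullet> (H *v (v + s *\<^sub>R w))"
      by (rule m_le)
    also have "(v + s *\<^sub>R w) \<bullet> (H *v (v + s *\<^sub>R w)) = m + 2 * s * (w \<bullet> (H *v v)) + s\<^sup>2 * (w \<bullet> (H *v w))"
      using symmetric_form[OF sym, of v w]
      by (simp add: m_def matrix_vector_right_distrib matrix_vector_mult_scaleR algebra_simps power2_eq_square)
    also have "(norm (v + s *\<^sub>R w))\<^sup>2 = 1 + 2 * s * (w \<bullet> v) + s\<^sup>2 * (norm w)\<^sup>2"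
      unfolding power2_norm_eq_inner using v
      by (simp add: inner_left_distrib inner_right_distrib inner_commute norm_eq_1 power2_eq_square algebra_simps)
    finally have "0 \<le> 2 * s * (w \<bullet> (H *v v) - m * (w \<bullet> v)) + s\<^sup>2 * b"
      by (simp add: b_def algebra_simps)
    also have "w \<bullet> (H *v v) - m * (w \<bullet> v) = (norm w)\<^sup>2"
      by (simp add: w_def power2_norm_eq_inner algebra_simps)
    finally show ?thesis .
  qed
  have "w = 0"
  proof -
    define c where "c = (norm w)\<^sup>2"
    \<comment> \<open>\<open>k\<close> exceeds \<open>b\<close>, so at \<open>s = - c / k\<close>
      the first-order gain is at least twice the quadratic loss.\<close>
    define k where "k = \<bar>b\<bar> + 1"
    have "0 \<le> 2 * (- c / k) * c + (- c / k)\<^sup>2 * b"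
      using quad[of "- c / k"] by (simp only: c_def)
    also have "\<dots> \<le> 2 * (- c / k) * c + (- c / k)\<^sup>2 * k"
      by (intro add_left_mono mult_left_mono) (auto simp: k_def)
    also have "\<dots> = - (c\<^sup>2 / k)" by (simp add: k_def power2_eq_square divide_simps)
    finally have "c\<^sup>2 / k \<le> 0" by simp
    moreover have "k > 0" by (simp add: k_def)
    ultimately have "c = 0" by (simp add: divide_le_0_iff)
    then show ?thesis by (simp add: c_def)
  qed
  then have "is_eigenvalue H m"
    unfolding is_eigenvalue_def w_def using v by (intro exI[of _ v]) auto
  then have "l \<le> m" using l by (simp add: is_smallest_eigenvalue_def)
  then have "l * (norm x)\<^sup>2 \<le> m * (norm x)\<^sup>2" by (intro mult_right_mono) auto
  also have "\<dots> \<le> x \<bullet> (H *v x)" by (rule m_le)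
  finally show ?thesis .
qed

text \<open>Gram-Schmidt for the inner product given by \<open>H\<close>, adding in each step the
  normalised residual of a vector outside the span.\<close>

lemma orthonormal_for_form_exists:
  fixes H :: "real ^ 'd ^ 'd::finite"
  assumes H: "positive_definite H" and "k \<le> CARD('d)"
  shows "\<exists>S. finite S \<and> card S = k \<and> (\<forall>x\<in>S. \<forall>y\<in>S. x \<bullet> (H *v y) = (if x = y then 1 else 0))"
  using assms(2)
proof (induction k)
  case 0
  show ?case by (intro exI[of _ "{}"]) auto
next
  case (Suc k)
  then obtain S where S: "finite S" "card S = k"
    and orth: "\<And>x y. x \<in> S \<Longrightarrow> y \<in> S \<Longrightarrow> x \<bullet> (H *v y) = (if x = y then 1 else 0)"
    by auto
  have sym: "transpose H = H" and pos: "\<And>v. v \<noteq> 0 \<Longrightarrow> 0 < v \<bullet> (H *v v)"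
    using H by (auto simp: positive_definite_def)
  have "dim S < DIM(real ^ 'd)"
    using dim_le_card[OF span_superset S(1)] S(2) Suc.prems by simp
  then have "span S \<noteq> UNIV"
    using dim_span[of S] by (intro notI) simp
  then obtain w where w: "w \<notin> span S" by blast
  define w' where "w' = w - (\<Sum>v\<in>S. (v \<bullet> (H *v w)) *\<^sub>R v)"
  have "w' \<noteq> 0"
  proof
    assume "w' = 0"
    then have "w = (\<Sum>v\<in>S. (v \<bullet> (H *v w)) *\<^sub>R v)" by (simp add: w'_def)
    also have "\<dots> \<in> span S" by (intro span_sum span_scale span_base)
    finally show False using w by contradiction
  qed
  then have pos': "w' \<bullet> (H *v w') > 0" by (rule pos)
  have orth': "x \<bullet> (H *v w') = 0" if "x \<in> S" for x
  proof -
    have "x \<bullet> (H *v (\<Sum>v\<in>S. (v \<bullet> (H *v w)) *\<^sub>R v)) = (\<Sum>v\<in>S. (v \<bullet> (H *v w)) * (x \<bullet> (H *v v)))"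
      by (simp add: linear_sum[OF matrix_vector_mul_linear] inner_sum_right matrix_vector_mult_scaleR)
    also have "\<dots> = (\<Sum>v\<in>S. if v = x then v \<bullet> (H *v w) else 0)"
      using that by (intro sum.cong) (auto simp: orth)
    also have "\<dots> = x \<bullet> (H *v w)" using that S by simp
    finally show ?thesis
      by (simp add: w'_def matrix_vector_mult_diff_distrib inner_diff_right)
  qed
  define e where "e = w' /\<^sub>R sqrt (w' \<bullet> (H *v w'))"
  have e1: "e \<bullet> (H *v e) = 1"
  proof -
    define c where "c = sqrt (w' \<bullet> (H *v w'))"
    have c: "c > 0" "w' \<bullet> (H *v w') = c * c" using pos' by (simp_all add: c_def)
    have "e = w' /\<^sub>R c" by (simp add: e_def c_def)
    then show ?thesis using c by (simp add: matrix_vector_mult_scaleR divide_simps)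
  qed
  have e0: "x \<bullet> (H *v e) = 0" if "x \<in> S" for x
    using orth'[OF that] by (simp add: e_def matrix_vector_mult_scaleR)
  have "e \<notin> S"
  proof
    assume "e \<in> S"
    from e0[OF this] e1 show False by simp
  qed
  then have "card (insert e S) = Suc k" using S by simp
  moreover have "x \<bullet> (H *v y) = (if x = y then 1 else 0)" if xy: "x \<in> insert e S" "y \<in> insert e S" for x y
  proof -
    consider "x = e" "y = e" | "x = e" "y \<in> S" | "x \<in> S" "y = e" | "x \<in> S" "y \<in> S"
      using xy by blast
    then show ?thesis
    proof cases
      case 1
      then show ?thesis using e1 by simp
    next
      case 2
      then have "x \<noteq> y" using \<open>e \<notin> S\<close> by blast
      then show ?thesis using 2 e0[of y] symmetric_form[OF sym, of e y] by simp
    next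
      case 3
      then have "x \<noteq> y" using \<open>e \<notin> S\<close> by blast
      then show ?thesis using 3 e0[of x] by simp
    next
      case 4
      then show ?thesis by (rule orth)
    qed
  qed
  ultimately show ?case using S(1) by (intro exI[of _ "insert e S"]) blast
qed

text \<open>The columns of \<open>V\<close> are orthonormal for \<open>H\<close>, so
  \<open>transpose V ** H ** V\<close> is the identity, and taking determinants yields
  \<open>det V\<close> up to sign. The substitution by \<open>V\<close> turns the ellipsoids of the
  form into balls.\<close>

lemma positive_definite_diagonalize:
  fixes H :: "real ^ 'd ^ 'd::finite"
  assumes "positive_definite H"
  obtains V where "\<And>s. (V *v s) \<bullet> (H *v (V *v s)) = (norm s)\<^sup>2"
    and "\<bar>det V\<bar> = 1 / sqrt (det H)" "det H > 0"
proof -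
  obtain S where S: "finite S" "card S = CARD('d)"
    and orth: "\<And>x y. x \<in> S \<Longrightarrow> y \<in> S \<Longrightarrow> x \<bullet> (H *v y) = (if x = y then 1 else 0)"
    using orthonormal_for_form_exists[OF assms order.refl] by blast
  have "\<exists>f. bij_betw f (UNIV :: 'd set) S"
    by (rule finite_same_card_bij) (simp_all add: S)
  then obtain f :: "'d \<Rightarrow> real ^ 'd" where f: "bij_betw f UNIV S" ..
  define V where "V = (\<chi> i j. f j $ i)"
  have Vs: "V *v s = (\<Sum>j\<in>UNIV. s $ j *\<^sub>R f j)" for s
    by (simp add: V_def matrix_vector_mult_def vec_eq_iff mult.commute[of "s $ _"])
  have orth_f: "f i \<bullet> (H *v f j) = (if i = j then 1 else 0)" for i j
  proof -
    have "f i \<in> S" "f j \<in> S" using f by (auto simp: bij_betw_def)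
    moreover have "f i = f j \<longleftrightarrow> i = j" using f by (simp add: bij_betw_def inj_eq)
    ultimately show ?thesis by (simp add: orth)
  qed
  have form: "(V *v s) \<bullet> (H *v (V *v s')) = s \<bullet> s'" for s s'
  proof -
    have "H *v (V *v s') = (\<Sum>j\<in>UNIV. s' $ j *\<^sub>R (H *v f j))"
      by (simp add: Vs linear_sum[OF matrix_vector_mul_linear] matrix_vector_mult_scaleR)
    then have "(V *v s) \<bullet> (H *v (V *v s')) = (\<Sum>i\<in>UNIV. s $ i *\<^sub>R f i) \<bullet> (\<Sum>j\<in>UNIV. s' $ j *\<^sub>R (H *v f j))"
      by (simp add: Vs)
    also have "\<dots> = (\<Sum>i\<in>UNIV. \<Sum>j\<in>UNIV. s $ i * (s' $ j * (f i \<bullet> (H *v f j))))"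
      unfolding inner_sum_left[of _ UNIV]
      by (intro sum.cong refl) (simp add: inner_sum_right sum_distrib_left mult.left_commute)
    also have "\<dots> = (\<Sum>i\<in>UNIV. \<Sum>j\<in>UNIV. if i = j then s $ i * s' $ j else 0)"
      by (intro sum.cong refl) (simp add: orth_f)
    also have "\<dots> = s \<bullet> s'" by (simp add: inner_vec_def)
    finally show ?thesis .
  qed
  have "transpose V ** H ** V = mat 1"
  proof -
    have "(transpose V ** H ** V) *v s' = mat 1 *v s'" for s'
    proof -
      have "s \<bullet> ((transpose V ** H ** V) *v s') = s \<bullet> s'" for s
      proof -
        have "(transpose V ** H ** V) *v s' = (H *v (V *v s')) v* V"
          by (simp only: matrix_vector_mul_assoc[symmetric] transpose_matrix_vector)
        then have "s \<bullet> ((transpose V ** H ** V) *v s') = (H *v (V *v s')) \<bullet> (V *v s)"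
          by (simp add: inner_commute[of s] dot_lmul_matrix)
        also have "\<dots> = s \<bullet> s'" by (subst inner_commute) (rule form)
        finally show ?thesis .
      qed
      then have "(transpose V ** H ** V) *v s' = s'"
        using vector_eq_ldot[of "(transpose V ** H ** V) *v s'" s'] by blast
      then show ?thesis by (simp only: matrix_vector_mul_lid)
    qed
    then show ?thesis by (simp only: matrix_eq) blast
  qed
  then have "det (transpose V ** H ** V) = 1" by (simp only: det_I)
  then have det: "(det V)\<^sup>2 * det H = 1"
    by (simp add: det_mul power2_eq_square algebra_simps)
  have "(det V)\<^sup>2 \<noteq> 0" using det by (intro notI) simp
  then have "(det V)\<^sup>2 > 0" by simp
  moreover have "0 < (det V)\<^sup>2 * det H" by (simp only: det zero_less_one)
  ultimately have dH: "det H > 0" by (rule zero_less_mult_pos[rotated])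
  have "sqrt ((det V)\<^sup>2 * det H) = 1" by (simp only: det real_sqrt_one)
  then have "\<bar>det V\<bar> * sqrt (det H) = 1" by (simp only: real_sqrt_mult real_sqrt_abs)
  then have detV: "\<bar>det V\<bar> = 1 / sqrt (det H)" using dH by (intro eq_divide_imp) auto
  have "(V *v s) \<bullet> (H *v (V *v s)) = (norm s)\<^sup>2" for s
    unfolding power2_norm_eq_inner by (rule form)
  from that[OF this detV dH] show ?thesis .
qed

subsection \<open>Linear images under Lebesgue measure\<close>

text \<open>\<open>r\<close> joins two types, so the permutations on the two sides lie in different
  groups. Induction over transpositions works because relabelling sends a transposition to a
  transposition.\<close>

lemma sign_conjugate:
  fixes r :: "'b::finite \<Rightarrow> 'a::finite"
  assumes r: "bij r" and p: "p permutes UNIV"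
  shows "sign (r \<circ> p \<circ> inv r) = sign p"
  using p finite
proof (induction rule: permutes_induct)
  case id
  have "r \<circ> id \<circ> inv r = id" using r by (simp add: fun_eq_iff bij_is_surj surj_f_inv_f)
  then show ?case by (simp only: sign_id)
next
  case (swap a b p)
  have inj: "r x = r y \<longleftrightarrow> x = y" for x y using r by (simp add: bij_is_inj inj_eq)
  have perm: "permutation q" if "bij q" for q :: "'c::finite \<Rightarrow> 'c"
    using that by (simp add: permutation finite_subset)
  have bp: "bij p" using swap.hyps by (simp add: permutes_bij)
  have "r (Transposition.transpose a b x) = Transposition.transpose (r a) (r b) (r x)" for x
    by (simp add: Transposition.transpose_def inj)
  then have eq: "r \<circ> (Transposition.transpose a b \<circ> p) \<circ> inv r = Transposition.transpose (r a) (r b) \<circ> (r \<circ> p \<circ> inv r)"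
    by (simp add: fun_eq_iff)
  have "permutation (r \<circ> p \<circ> inv r)"
    by (intro perm bij_comp bij_imp_bij_inv r bp)
  then have "sign (Transposition.transpose (r a) (r b) \<circ> (r \<circ> p \<circ> inv r))
      = sign (Transposition.transpose (r a) (r b)) * sign (r \<circ> p \<circ> inv r)"
    by (intro sign_compose permutation_swap_id)
  also have "\<dots> = sign (Transposition.transpose a b) * sign p"
    by (simp only: swap.IH sign_swap_id inj)
  also have "\<dots> = sign (Transposition.transpose a b \<circ> p)"
    by (intro sign_compose[symmetric] permutation_swap_id perm bp)
  finally show ?case unfolding eq .
qed

lemma permutes_UNIV: "p permutes UNIV \<longleftrightarrow> bij p"
proof
  assume "bij p"
  then show "p permutes UNIV" by (intro bij_imp_permutes) auto
qed (rule permutes_bij)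

text \<open>In the Leibniz formula, conjugation with \<open>r\<close> is a bijection between the two
  permutation groups that preserves signs and products.\<close>

lemma det_reindex:
  fixes A :: "real ^ 'a::finite ^ 'a" and r :: "'b::finite \<Rightarrow> 'a"
  assumes r: "bij r"
  shows "det (\<chi> i j. A $ r i $ r j) = det A"
proof -
  have inv: "inv r (r x) = x" "r (inv r y) = y" for x y
    using r by (simp_all add: bij_is_inj bij_is_surj surj_f_inv_f)
  have bij: "bij_betw (\<lambda>p. r \<circ> p \<circ> inv r) {p. p permutes (UNIV :: 'b set)} {p. p permutes (UNIV :: 'a set)}"
  proof (rule bij_betw_byWitness[where f' = "\<lambda>q. inv r \<circ> q \<circ> r"])
    show "(\<lambda>p. r \<circ> p \<circ> inv r) ` {p. p permutes (UNIV :: 'b set)} \<subseteq> {p. p permutes (UNIV :: 'a set)}"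
      by (intro image_subsetI) (simp add: permutes_UNIV bij_comp bij_imp_bij_inv r)
    show "(\<lambda>q. inv r \<circ> q \<circ> r) ` {p. p permutes (UNIV :: 'a set)} \<subseteq> {p. p permutes (UNIV :: 'b set)}"
      by (intro image_subsetI) (simp add: permutes_UNIV bij_comp bij_imp_bij_inv r)
  qed (simp_all add: fun_eq_iff inv)
  have "det A = (\<Sum>p | p permutes (UNIV :: 'b set). of_int (sign (r \<circ> p \<circ> inv r)) * (\<Prod>i\<in>UNIV. A $ i $ (r \<circ> p \<circ> inv r) i))"
    unfolding det_def by (rule sum.reindex_bij_betw[OF bij, symmetric])
  also have "\<dots> = (\<Sum>p | p permutes (UNIV :: 'b set). of_int (sign p) * (\<Prod>i\<in>UNIV. A $ r i $ r (p i)))"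
  proof (intro sum.cong refl, goal_cases)
    case (1 p)
    have "(\<Prod>i\<in>UNIV. A $ i $ (r \<circ> p \<circ> inv r) i) = (\<Prod>i\<in>UNIV. A $ r i $ (r \<circ> p \<circ> inv r) (r i))"
      by (rule prod.reindex_bij_betw[OF r, symmetric])
    then show ?case using 1 sign_conjugate[OF r] by (simp add: inv)
  qed
  finally show ?thesis by (simp add: det_def)
qed

lemma prod_Basis_cart: "(\<Prod>b\<in>Basis. x \<bullet> b) = (\<Prod>i\<in>UNIV. x $ i)" for x :: "real ^ 'a::finite"
proof -
  have Basis: "(Basis :: (real ^ 'a) set) = range (\<lambda>i. axis i 1)" by (auto simp: Basis_vec_def)
  have inj: "inj (\<lambda>i. axis i (1 :: real) :: real ^ 'a)" by (auto simp: inj_on_def axis_eq_axis)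
  have "(\<Prod>b\<in>Basis. x \<bullet> b) = (\<Prod>i\<in>UNIV. x \<bullet> axis i 1)"
    unfolding Basis by (rule prod.reindex[OF inj, unfolded o_def])
  then show ?thesis by (simp add: inner_axis)
qed

text \<open>Boxes determine the measure, and the preimage of a box is a box with the same side
  lengths in another order.\<close>

lemma lborel_reindex:
  fixes r :: "'b::finite \<Rightarrow> 'a::finite"
  assumes r: "bij r"
  shows "distr lborel borel (\<lambda>x :: real ^ 'a. \<chi> i. x $ r i) = (lborel :: (real ^ 'b) measure)"
proof (rule lborel_eqI[symmetric])
  fix l u :: "real ^ 'b" assume lu: "\<And>b. b \<in> Basis \<Longrightarrow> l \<bullet> b \<le> u \<bullet> b"
  have lu': "l $ i \<le> u $ i" for i
    using lu[of "axis i 1"] by (simp add: inner_axis axis_in_Basis_iff)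
  have inv: "inv r (r x) = x" "r (inv r y) = y" for x y
    using r by (simp_all add: bij_is_inj bij_is_surj surj_f_inv_f)
  have meas: "(\<lambda>x :: real ^ 'a. \<chi> i. x $ r i) \<in> borel_measurable borel"
    by (intro borel_measurable_continuous_onI continuous_intros)
  define l' u' where "l' = (\<chi> j. l $ inv r j)" and "u' = (\<chi> j. u $ inv r j)"
  have "l' $ j < x $ j \<and> x $ j < u' $ j" if "\<forall>i. l $ i < x $ r i \<and> x $ r i < u $ i" for x j
    using that[rule_format, of "inv r j"] by (simp add: l'_def u'_def inv)
  moreover have "l $ i < x $ r i \<and> x $ r i < u $ i" if "\<forall>j. l' $ j < x $ j \<and> x $ j < u' $ j" for x i
    using that[rule_format, of "r i"] by (simp add: l'_def u'_def inv)
  ultimately have "(\<lambda>x. \<chi> i. x $ r i) -` box l u = box l' u'"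
    unfolding vimage_def set_eq_iff mem_Collect_eq mem_box_cart vec_lambda_beta by blast
  then have "emeasure (distr lborel borel (\<lambda>x :: real ^ 'a. \<chi> i. x $ r i)) (box l u) = emeasure lborel (box l' u')"
    using meas by (simp add: emeasure_distr)
  also have "\<dots> = (\<Prod>b\<in>Basis. (u' - l') \<bullet> b)"
  proof (rule emeasure_lborel_box)
    fix b :: "real ^ 'a" assume "b \<in> Basis"
    then obtain i where "b = axis i 1" by (auto simp: Basis_vec_def)
    then show "l' \<bullet> b \<le> u' \<bullet> b" using lu' by (simp add: inner_axis l'_def u'_def)
  qed
  also have "(\<Prod>b\<in>Basis. (u' - l') \<bullet> b) = (\<Prod>i\<in>UNIV. (u' - l') $ r i)"
    unfolding prod_Basis_cart by (rule prod.reindex_bij_betw[OF r, symmetric])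
  also have "\<dots> = (\<Prod>b\<in>Basis. (u - l) \<bullet> b)"
    unfolding prod_Basis_cart by (simp add: l'_def u'_def inv)
  finally show "emeasure (distr lborel borel (\<lambda>x :: real ^ 'a. \<chi> i. x $ r i)) (box l u) = (\<Prod>b\<in>Basis. (u - l) \<bullet> b)" .
qed simp

text \<open>A copy of a finite type carrying some well-order: the library proves the effect of linear
  maps on Lebesgue measure only for well-ordered index types.\<close>

typedef 'a ordered = "UNIV :: 'a set" by simp

lemma bij_Rep_ordered: "bij (Rep_ordered :: 'a ordered \<Rightarrow> 'a)"
  by (rule bij_betw_byWitness[where f' = Abs_ordered]) (auto simp: Rep_ordered_inverse Abs_ordered_inverse)

instance ordered :: (finite) finite
proof
  have "finite (Rep_ordered -` (UNIV :: 'a set))"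
    by (rule finite_vimageI) (simp_all add: bij_is_inj bij_Rep_ordered)
  then show "finite (UNIV :: 'a ordered set)" by simp
qed

instantiation ordered :: (finite) wellorder
begin

definition less_eq_ordered :: "'a ordered \<Rightarrow> 'a ordered \<Rightarrow> bool"
  where "x \<le> y \<longleftrightarrow> to_nat (Rep_ordered x) \<le> to_nat (Rep_ordered y)"

definition less_ordered :: "'a ordered \<Rightarrow> 'a ordered \<Rightarrow> bool"
  where "x < y \<longleftrightarrow> to_nat (Rep_ordered x) < to_nat (Rep_ordered y)"

instance
proof
  fix P :: "'a ordered \<Rightarrow> bool" and a
  assume step: "\<And>x. (\<And>y. y < x \<Longrightarrow> P y) \<Longrightarrow> P x"
  show "P a"
    by (induction "to_nat (Rep_ordered a)" arbitrary: a rule: less_induct)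
      (blast intro: step[unfolded less_ordered_def])
qed (auto simp: less_eq_ordered_def less_ordered_def Rep_ordered_inject)

end

text \<open>The relabelling \<open>R\<close> carries \<open>A\<close> to the matrix \<open>B\<close>
  over a well-ordered index type and changes neither volumes nor the determinant. Compactness keeps
  every image closed, hence Borel.\<close>

lemma measure_linear_image_compact:
  fixes A :: "real ^ 'a ^ 'a::finite"
  assumes S: "compact S"
  shows "measure lborel ((*v) A ` S) = \<bar>det A\<bar> * measure lborel S"
proof -
  define r :: "'a ordered \<Rightarrow> 'a" where "r = Rep_ordered"
  have r: "bij r" unfolding r_def by (rule bij_Rep_ordered)
  have inv: "r (inv r y) = y" for y
    using r by (simp add: bij_is_surj surj_f_inv_f)
  define R :: "real ^ 'a \<Rightarrow> real ^ 'a ordered" where "R = (\<lambda>x. \<chi> i. x $ r i)"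
  have inj: "inj R"
  proof (rule injI)
    fix x y assume "R x = R y"
    then have "x $ r (inv r i) = y $ r (inv r i)" for i by (simp add: R_def vec_eq_iff)
    then show "x = y" by (simp add: inv vec_eq_iff)
  qed
  have contR: "continuous_on T R" for T
    unfolding R_def by (intro continuous_intros)
  have measR: "R \<in> borel_measurable borel"
    by (intro borel_measurable_continuous_onI contR)
  have R: "measure lborel (R ` T) = measure lborel T" if "compact T" for T
  proof -
    have "R ` T \<in> sets borel"
      using that by (intro borel_closed compact_imp_closed compact_continuous_image contR)
    then have "measure lborel (R ` T) = measure lborel (R -` R ` T)"
      unfolding lborel_reindex[OF r, symmetric] R_def[symmetric]
      using measR by (simp add: measure_distr)
    also have "R -` R ` T = T" using inj by (simp add: inj_vimage_image_eq)
    finally show ?thesis .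
  qed
  define B :: "real ^ 'a ordered ^ 'a ordered" where "B = (\<chi> i j. A $ r i $ r j)"
  have RA: "R (A *v x) = B *v R x" for x
  proof (rule vec_eq_iff[THEN iffD2], rule allI)
    fix i
    have "(\<Sum>j\<in>UNIV. A $ r i $ j * x $ j) = (\<Sum>j\<in>UNIV. A $ r i $ r j * x $ r j)"
      by (rule sum.reindex_bij_betw[OF r, symmetric])
    then show "R (A *v x) $ i = (B *v R x) $ i"
      by (simp add: R_def B_def matrix_vector_mult_def)
  qed
  have cA: "compact ((*v) A ` S)"
    by (intro compact_continuous_image[OF _ S] linear_continuous_on) (rule matrix_vector_mul_bounded_linear)
  have cR: "compact (R ` S)" by (rule compact_continuous_image[OF contR S])
  have cB: "compact ((*v) B ` R ` S)"
    by (intro compact_continuous_image[OF _ cR] linear_continuous_on) (rule matrix_vector_mul_bounded_linear)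
  have "measure lborel ((*v) A ` S) = measure lborel (R ` (*v) A ` S)" using R[OF cA] by simp
  also have "R ` (*v) A ` S = (*v) B ` R ` S" by (simp add: image_image RA)
  also have "measure lborel ((*v) B ` R ` S) = measure lebesgue ((*v) B ` R ` S)"
    using borel_compact[OF cB] by (simp only: measure_completion sets_lborel)
  also have "\<dots> = \<bar>det B\<bar> * measure lebesgue (R ` S)"
    using measure_linear_image[OF matrix_vector_mul_linear lmeasurable_compact[OF cR], of B] by simp
  also have "measure lebesgue (R ` S) = measure lborel (R ` S)"
    using borel_compact[OF cR] by (simp only: measure_completion sets_lborel)
  also have "\<dots> = measure lborel S" by (rule R[OF S])
  also have "det B = det A" unfolding B_def by (rule det_reindex[OF r])
  finally show ?thesis .
qed

subsection \<open>The distribution of a positive definite quadratic form\<close>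

lemma nn_integral_powr_from_0:
  fixes a x :: real
  assumes "a > 0"
  shows "(\<integral>\<^sup>+ z. ennreal (z powr (a - 1)) * indicator {0..} z * indicator {..x} z \<partial>lborel)
     = ennreal (if 0 \<le> x then x powr a / a else 0)"
proof (cases "0 \<le> x")
  case True
  have "((\<lambda>z. z powr (a - 1)) has_integral (x powr a / a)) {0..x}"
    using has_integral_powr_from_0[of "a - 1" x] assms True by simp
  from nn_integral_has_integral_lebesgue[OF _ this]
  have "(\<integral>\<^sup>+ z. ennreal (indicator {0..x} z * z powr (a - 1)) \<partial>lborel) = ennreal (x powr a / a)"
    by simp
  moreover have "ennreal (z powr (a - 1)) * indicator {0..} z * indicator {..x} z
      = ennreal (indicator {0..x} z * z powr (a - 1))" for z
    by (simp add: indicator_def)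
  ultimately show ?thesis using True by simp
next
  case False
  have eq: "ennreal (z powr (a - 1)) * indicator {0..} z * indicator {..x} z = 0" for z
    using False by (simp add: indicator_def)
  show ?thesis unfolding eq using False by simp
qed

text \<open>The sublevel sets of \<open>Z\<close> are linear images of balls.\<close>

lemma distr_quadratic_form:
  fixes H :: "real ^ 'd ^ 'd::finite" and n :: real
  defines "Z \<equiv> \<lambda>t. n / 2 * (t \<bullet> (H *v t))"
    and "G \<equiv> 1 / sqrt (det H) * (2 * pi / n) powr (CARD('d) / 2)"
    and "a \<equiv> real CARD('d) / 2"
  assumes H: "positive_definite H" and n: "n > 0"
  shows "distr lborel borel Z = density lborel (\<lambda>z. ennreal (G / Gamma a * z powr (a - 1)) * indicator {0..} z)"
proof -
  have a: "a > 0" by (simp add: a_def)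
  have Z_borel [measurable]: "Z \<in> borel_measurable borel"
    unfolding Z_def by (intro borel_measurable_continuous_onI continuous_intros linear_continuous_on_compose[where g = "(*v) H"]) auto
  obtain V where V: "\<And>s. (V *v s) \<bullet> (H *v (V *v s)) = (norm s)\<^sup>2"
    and detV: "\<bar>det V\<bar> = 1 / sqrt (det H)" and detH: "det H > 0"
    using positive_definite_diagonalize[OF H] by blast
  have "det V \<noteq> 0" using detV detH by auto
  then have "invertible V" by (simp add: invertible_det_nz)
  then have surjV: "\<exists>s. t = V *v s" for t
  proof -
    obtain W where "V ** W = mat 1" using \<open>invertible V\<close> by (auto simp: invertible_def)
    then have "t = V *v (W *v t)" by (simp add: matrix_vector_mul_assoc)
    then show ?thesis by blast
  qed
  have nonneg: "Z t \<ge> 0" for t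
    using surjV[of t] n by (auto simp: Z_def V)
  have sublevel: "{t. Z t \<le> x} = (*v) V ` cball 0 (sqrt (2 * x / n))" if "x \<ge> 0" for x
  proof -
    have iff: "Z (V *v s) \<le> x \<longleftrightarrow> norm s \<le> sqrt (2 * x / n)" for s
    proof -
      have "Z (V *v s) \<le> x \<longleftrightarrow> (norm s)\<^sup>2 \<le> 2 * x / n"
        using n by (simp add: Z_def V field_simps)
      also have "\<dots> \<longleftrightarrow> norm s \<le> sqrt (2 * x / n)"
        using real_sqrt_le_iff[of "(norm s)\<^sup>2" "2 * x / n"] by (simp del: real_sqrt_le_iff)
      finally show ?thesis .
    qed
    show ?thesis
    proof (intro set_eqI iffI)
      fix t assume "t \<in> {t. Z t \<le> x}"
      moreover obtain s where s: "t = V *v s" using surjV by blast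
      ultimately have "norm s \<le> sqrt (2 * x / n)" by (simp add: iff)
      then show "t \<in> (*v) V ` cball 0 (sqrt (2 * x / n))" unfolding s by (intro imageI) simp
    next
      fix t assume "t \<in> (*v) V ` cball 0 (sqrt (2 * x / n))"
      then obtain s where "t = V *v s" "norm s \<le> sqrt (2 * x / n)" by (auto simp only: mem_cball_0)
      then show "t \<in> {t. Z t \<le> x}" by (simp add: iff)
    qed
  qed
  have ball: "emeasure lborel {t. Z t \<le> x} = ennreal (if 0 \<le> x then G / Gamma a * (x powr a / a) else 0)" for x
  proof (cases "0 \<le> x")
    case True
    define r where "r = sqrt (2 * x / n)"
    have r: "r \<ge> 0" using True n by (simp add: r_def)
    have cb: "measure lborel (cball (0 :: real ^ 'd) r) = unit_ball_vol CARD('d) * r ^ CARD('d)"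
      using r by (simp add: measure_def emeasure_cball)
    have "compact ((*v) V ` cball 0 r)"
      by (intro compact_continuous_image[OF _ compact_cball] linear_continuous_on)
        (rule matrix_vector_mul_bounded_linear)
    then have "emeasure lborel {t. Z t \<le> x} = ennreal (measure lborel ((*v) V ` cball 0 r))"
      unfolding sublevel[OF True] r_def[symmetric]
      by (intro emeasure_eq_ennreal_measure) (use emeasure_compact_finite in \<open>force simp: less_top[symmetric]\<close>)
    also have "measure lborel ((*v) V ` cball 0 r) = 1 / sqrt (det H) * (unit_ball_vol CARD('d) * r ^ CARD('d))"
      unfolding measure_linear_image_compact[OF compact_cball] cb detV ..
    also have "r ^ CARD('d) = (2 * x / n) powr a"
    proof (cases "x = 0")
      case False
      then have "2 * x / n > 0" using True n by simp
      then show ?thesis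
        using powr_realpow[of "(2 * x / n) powr (1/2)" "CARD('d)"] n False
        by (simp add: r_def a_def powr_powr flip: powr_half_sqrt)
    qed (simp add: r_def)
    also have "1 / sqrt (det H) * (unit_ball_vol CARD('d) * (2 * x / n) powr a) = G / Gamma a * (x powr a / a)"
    proof -
      \<comment> \<open>The factor \<open>a\<close> in the volume of the unit ball is the one
        produced by integrating \<open>z powr (a - 1)\<close>; this is why the density has the
        constant \<open>G / Gamma a\<close>.\<close>
      have "Gamma (a + 1) = a * Gamma a" by (rule Gamma_plus1) (use a in \<open>auto dest: nonpos_Ints_nonpos\<close>)
      moreover have "unit_ball_vol CARD('d) = pi powr a / Gamma (a + 1)"
        by (simp add: unit_ball_vol_def a_def)
      ultimately have "unit_ball_vol CARD('d) = pi powr a / (a * Gamma a)"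
        by simp
      moreover have "pi powr a * (2 * x / n) powr a = (2 * pi / n) powr a * x powr a"
        using n True by (simp add: powr_mult powr_divide)
      ultimately show ?thesis by (simp add: G_def a_def[symmetric] field_simps)
    qed
    finally show ?thesis using True by simp
  next
    case False
    have "\<not> Z t \<le> x" for t using nonneg[of t] False by linarith
    then have "{t. Z t \<le> x} = {}" by blast
    then show ?thesis using False by simp
  qed
  show ?thesis
  proof (rule measure_eqI_generator_eq[where E = "range (\<lambda>x::real. {..x})" and \<Omega> = UNIV and A = "\<lambda>i. {..real i}"])
    show "Int_stable (range (\<lambda>x::real. {..x}))" by (auto simp: Int_stable_def)
    show "sets (distr lborel borel Z) = sigma_sets UNIV (range (\<lambda>x::real. {..x}))"
      by (simp add: borel_eq_atMost sets_measure_of)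
    show "sets (density lborel (\<lambda>z. ennreal (G / Gamma a * z powr (a - 1)) * indicator {0..} z)) = sigma_sets UNIV (range (\<lambda>x::real. {..x}))"
      by (simp add: borel_eq_atMost sets_measure_of)
    fix X assume "X \<in> range (\<lambda>x::real. {..x})"
    then obtain x where X: "X = {..x}" by blast
    define c where "c = G / Gamma a"
    have c: "c \<ge> 0" using a detH by (simp add: c_def G_def)
    have "emeasure (distr lborel borel Z) X = emeasure lborel {t. Z t \<le> x}"
      by (subst emeasure_distr) (auto simp: X vimage_def)
    also have "\<dots> = ennreal c * ennreal (if 0 \<le> x then x powr a / a else 0)"
      unfolding ball c_def[symmetric] using c a by (auto simp flip: ennreal_mult)
    also have "\<dots> = ennreal c * (\<integral>\<^sup>+ z. ennreal (z powr (a - 1)) * indicator {0..} z * indicator {..x} z \<partial>lborel)"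
      using a by (simp add: nn_integral_powr_from_0)
    also have "\<dots> = (\<integral>\<^sup>+ z. ennreal c * (ennreal (z powr (a - 1)) * indicator {0..} z * indicator {..x} z) \<partial>lborel)"
      by (rule nn_integral_cmult[symmetric]) simp
    also have "\<dots> = (\<integral>\<^sup>+ z. ennreal (c * z powr (a - 1)) * indicator {0..} z * indicator {..x} z \<partial>lborel)"
      using c by (intro nn_integral_cong) (simp add: ennreal_mult mult.assoc)
    also have "\<dots> = emeasure (density lborel (\<lambda>z. ennreal (G / Gamma a * z powr (a - 1)) * indicator {0..} z)) X"
      unfolding c_def[symmetric] by (subst emeasure_density) (auto simp: X)
    finally show "emeasure (distr lborel borel Z) X = emeasure (density lborel (\<lambda>z. ennreal (G / Gamma a * z powr (a - 1)) * indicator {0..} z)) X" .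
  next
    show "(\<Union>i. {..real i}) = (UNIV :: real set)" by (auto simp: real_arch_simple)
    show "emeasure (distr lborel borel Z) {..real i} \<noteq> \<infinity>" for i
    proof -
      have "emeasure (distr lborel borel Z) {..real i} = emeasure lborel {t. Z t \<le> real i}"
        by (subst emeasure_distr) (auto simp: vimage_def)
      then show ?thesis by (simp add: ball)
    qed
  qed auto
qed

text \<open>\<open>F\<close> is a primitive of \<open>f\<close>, and \<open>f\<close> dominates the
  integrand beyond \<open>a\<close> because \<open>a * ((a - 1) / z) \<le> a - 1\<close> there. As
  \<open>F\<close> vanishes at infinity, the tail is at most \<open>- F x\<close>.\<close>

lemma nn_integral_Gamma_tail:
  fixes a x :: real
  assumes a: "a \<ge> 1" and x: "x \<ge> a"
  shows "(\<integral>\<^sup>+ z. ennreal (z powr (a - 1) * exp (- z)) * indicator {x..} z \<partial>lborel)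
    \<le> ennreal (a * x powr (a - 1) * exp (- x))"
proof -
  define F where "F = (\<lambda>z. - (a * z powr (a - 1) * exp (- z)))"
  define f where "f = (\<lambda>z. a * z powr (a - 1) * exp (- z) * (1 - (a - 1) / z))"
  have dom: "z powr (a - 1) * exp (- z) \<le> f z" if "x \<le> z" for z
  proof -
    have z: "z \<ge> a" "z > 0" using that a x by auto
    have "a * ((a - 1) / z) \<le> a - 1"
      using z a mult_right_mono[of a z "a - 1"] by (simp add: field_simps)
    then have "1 \<le> a * (1 - (a - 1) / z)" by (simp add: algebra_simps)
    then have "z powr (a - 1) * exp (- z) * 1 \<le> z powr (a - 1) * exp (- z) * (a * (1 - (a - 1) / z))"
      by (intro mult_left_mono) auto
    then show ?thesis by (simp add: f_def mult_ac)
  qed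
  have nonneg: "0 \<le> f z" if "x \<le> z" for z
    using dom[OF that] by (rule order.trans[rotated]) simp
  have "(\<integral>\<^sup>+ z. ennreal (z powr (a - 1) * exp (- z)) * indicator {x..} z \<partial>lborel)
      \<le> (\<integral>\<^sup>+ z. ennreal (f z) * indicator {x..} z \<partial>lborel)"
    using dom by (intro nn_integral_mono) (auto simp: indicator_def intro!: ennreal_leI)
  also have "\<dots> = ennreal (0 - F x)"
  proof (rule nn_integral_FTC_atLeast)
    show "f \<in> borel_measurable borel" unfolding f_def by measurable
    show "(F has_real_derivative f z) (at z)" if "x \<le> z" for z
    proof -
      have z: "z > 0" using that a x by auto
      have "((\<lambda>z. exp (- z)) has_real_derivative - exp (- z)) (at z)"
        by (auto intro!: derivative_eq_intros)
      from DERIV_mult[OF has_real_derivative_powr[OF z, of "a - 1"] this]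
      have "((\<lambda>z. - a * (z powr (a - 1) * exp (- z))) has_real_derivative
          - a * ((a - 1) * z powr (a - 1 - 1) * exp (- z) + - exp (- z) * z powr (a - 1))) (at z)"
        by (rule DERIV_cmult)
      also have "z powr (a - 1 - 1) = z powr (a - 1) / z" using z by (simp add: powr_diff power2_eq_square)
      also have "- a * ((a - 1) * (z powr (a - 1) / z) * exp (- z) + - exp (- z) * z powr (a - 1)) = f z"
        by (simp add: f_def algebra_simps diff_divide_distrib)
      also have "(\<lambda>z. - a * (z powr (a - 1) * exp (- z))) = F"
        by (simp add: F_def mult.assoc)
      finally show ?thesis .
    qed
    have "((\<lambda>z. a * z powr (a - 1) * exp (- z)) \<longlongrightarrow> 0) at_top" using a by real_asymp
    from tendsto_minus[OF this] show "(F \<longlongrightarrow> 0) at_top" by (simp add: F_def)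
  qed (rule nonneg)
  finally show ?thesis by (simp add: F_def)
qed

lemma nn_integral_Gamma:
  fixes b :: real
  assumes "b > 0"
  shows "(\<integral>\<^sup>+ z. ennreal (z powr (b - 1) * exp (- z)) * indicator {0..} z \<partial>lborel) = ennreal (Gamma b)"
proof -
  have "(\<integral>\<^sup>+ z. ennreal (indicator {0..} z * (z powr (b - 1) / exp z)) \<partial>lborel) = ennreal (Gamma b)"
    by (rule nn_integral_has_integral_lebesgue[OF _ Gamma_integral_real[OF assms]]) simp
  moreover have "ennreal (z powr (b - 1) * exp (- z)) * indicator {0..} z
      = ennreal (indicator {0..} z * (z powr (b - 1) / exp z))" for z
    by (simp add: indicator_def exp_minus divide_inverse)
  ultimately show ?thesis by simp
qed

section \<open>Moments and tail of the quadratic form under its Gaussian weight\<close>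

locale gaussian_form =
  fixes H :: "real ^ 'd ^ 'd::finite" and n :: real and Z :: "real ^ 'd \<Rightarrow> real" and G a :: real
  assumes H: "positive_definite H" and n: "n > 0"
    and Z_def: "Z = (\<lambda>t. n / 2 * (t \<bullet> (H *v t)))"
    and G_def: "G = 1 / sqrt (det H) * (2 * pi / n) powr a"
    and a_def: "a = real CARD('d) / 2"
begin

lemma a_pos: "a > 0" by (simp add: a_def)

lemma det_pos: "det H > 0"
  using positive_definite_diagonalize[OF H] by blast

lemma G_pos: "G > 0" using det_pos n by (simp add: G_def)

lemma Z_nonneg: "Z t \<ge> 0"
  using H n unfolding Z_def positive_definite_def by (cases "t = 0") (auto intro: less_imp_le)

lemma Z_measurable [measurable]: "Z \<in> borel_measurable borel"
  unfolding Z_def by (intro borel_measurable_continuous_onI continuous_intros linear_continuous_on_compose[where g = "(*v) H"]) auto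

lemma nn_integral_Z:
  fixes h :: "real \<Rightarrow> real"
  assumes [measurable]: "h \<in> borel_measurable borel" and h: "\<And>z. h z \<ge> 0"
  shows "(\<integral>\<^sup>+ t. ennreal (h (Z t)) \<partial>lborel)
    = ennreal (G / Gamma a) * (\<integral>\<^sup>+ z. ennreal (h z * z powr (a - 1)) * indicator {0..} z \<partial>lborel)"
proof -
  have "(\<integral>\<^sup>+ t. ennreal (h (Z t)) \<partial>lborel) = (\<integral>\<^sup>+ z. ennreal (h z) \<partial>distr lborel borel Z)"
    by (subst nn_integral_distr) simp_all
  also have "distr lborel borel Z = density lborel (\<lambda>z. ennreal (G / Gamma a * z powr (a - 1)) * indicator {0..} z)"
    using distr_quadratic_form[OF H n] by (simp add: Z_def G_def a_def)
  also have "(\<integral>\<^sup>+ z. ennreal (h z) \<partial>\<dots>) = (\<integral>\<^sup>+ z. ennreal (G / Gamma a * z powr (a - 1)) * indicator {0..} z * ennreal (h z) \<partial>lborel)"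
    by (subst nn_integral_density) simp_all
  also have "\<dots> = (\<integral>\<^sup>+ z. ennreal (G / Gamma a) * (ennreal (h z * z powr (a - 1)) * indicator {0..} z) \<partial>lborel)"
    using G_pos a_pos h by (intro nn_integral_cong) (simp add: ennreal_mult[of "G / Gamma a" "_ powr _"] ennreal_mult[of "h _"] mult_ac del: times_divide_eq_left)
  also have "\<dots> = ennreal (G / Gamma a) * (\<integral>\<^sup>+ z. ennreal (h z * z powr (a - 1)) * indicator {0..} z \<partial>lborel)"
    by (subst nn_integral_cmult) simp_all
  finally show ?thesis .
qed

text \<open>Under the normalised weight \<open>exp (- Z) / G\<close> the variable \<open>Z\<close>
  has the gamma distribution with shape \<open>a\<close>, whose moments are the Pochhammer
  symbols.\<close>

lemma moment:
  assumes p: "p \<ge> 0"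
  shows "has_bochner_integral lborel (\<lambda>t. Z t powr p * exp (- Z t)) (G * poch a p)"
proof (rule has_bochner_integral_nn_integral)
  have "(\<integral>\<^sup>+ t. ennreal (Z t powr p * exp (- Z t)) \<partial>lborel)
      = ennreal (G / Gamma a) * (\<integral>\<^sup>+ z. ennreal (z powr p * exp (- z) * z powr (a - 1)) * indicator {0..} z \<partial>lborel)"
    by (rule nn_integral_Z) auto
  also have "(\<integral>\<^sup>+ z. ennreal (z powr p * exp (- z) * z powr (a - 1)) * indicator {0..} z \<partial>lborel)
      = (\<integral>\<^sup>+ z. ennreal (z powr (a + p - 1) * exp (- z)) * indicator {0..} z \<partial>lborel)"
    by (intro nn_integral_cong) (simp add: mult_ac powr_add[symmetric] algebra_simps)
  also have "\<dots> = ennreal (Gamma (a + p))" using a_pos p by (intro nn_integral_Gamma) simp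
  also have "ennreal (G / Gamma a) * ennreal (Gamma (a + p)) = ennreal (G * poch a p)"
    using G_pos a_pos p by (simp add: poch_def flip: ennreal_mult)
  finally show "(\<integral>\<^sup>+ t. ennreal (Z t powr p * exp (- Z t)) \<partial>lborel) = ennreal (G * poch a p)" .
  show "0 \<le> G * poch a p" using G_pos a_pos p by (simp add: poch_def)
qed auto

text \<open>Separate from \<open>moment\<close> because \<open>0 powr 0 = 0\<close>: with exponent 0
  that integrand would vanish at the origin.\<close>

lemma total: "has_bochner_integral lborel (\<lambda>t. exp (- Z t)) G"
proof (rule has_bochner_integral_nn_integral)
  have "(\<integral>\<^sup>+ t. ennreal (exp (- Z t)) \<partial>lborel)
      = ennreal (G / Gamma a) * (\<integral>\<^sup>+ z. ennreal (exp (- z) * z powr (a - 1)) * indicator {0..} z \<partial>lborel)"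
    by (rule nn_integral_Z) auto
  also have "(\<integral>\<^sup>+ z. ennreal (exp (- z) * z powr (a - 1)) * indicator {0..} z \<partial>lborel) = ennreal (Gamma a)"
    using nn_integral_Gamma[OF a_pos] by (simp add: mult.commute)
  also have "ennreal (G / Gamma a) * ennreal (Gamma a) = ennreal G"
    using G_pos Gamma_real_pos[OF a_pos] by (simp flip: ennreal_mult add: less_imp_neq[symmetric])
  finally show "(\<integral>\<^sup>+ t. ennreal (exp (- Z t)) \<partial>lborel) = ennreal G" .
qed (use G_pos in auto)

lemma tail:
  assumes a: "a \<ge> 1" and x: "x \<ge> a"
  shows "(\<integral>t. indicator {t. x < Z t} t * exp (- Z t) \<partial>lborel) \<le> G / Gamma a * (a * x powr (a - 1) * exp (- x))"
proof -
  define h where "h = (\<lambda>z. indicator {x<..} z * exp (- z) :: real)"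
  have h_meas [measurable]: "h \<in> borel_measurable borel" unfolding h_def by measurable
  have "(\<integral>\<^sup>+ t. ennreal (h (Z t)) \<partial>lborel)
      = ennreal (G / Gamma a) * (\<integral>\<^sup>+ z. ennreal (h z * z powr (a - 1)) * indicator {0..} z \<partial>lborel)"
    by (rule nn_integral_Z) (auto simp: h_def)
  also have "(\<integral>\<^sup>+ z. ennreal (h z * z powr (a - 1)) * indicator {0..} z \<partial>lborel)
      \<le> (\<integral>\<^sup>+ z. ennreal (z powr (a - 1) * exp (- z)) * indicator {x..} z \<partial>lborel)"
    by (intro nn_integral_mono) (simp add: h_def indicator_def mult.commute)
  also have "\<dots> \<le> ennreal (a * x powr (a - 1) * exp (- x))" by (rule nn_integral_Gamma_tail[OF a x])
  also have "ennreal (G / Gamma a) * ennreal (a * x powr (a - 1) * exp (- x)) = ennreal (G / Gamma a * (a * x powr (a - 1) * exp (- x)))"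
    using G_pos a_pos by (simp flip: ennreal_mult)
  finally have le: "(\<integral>\<^sup>+ t. ennreal (h (Z t)) \<partial>lborel) \<le> ennreal (G / Gamma a * (a * x powr (a - 1) * exp (- x)))"
    by (simp add: mult_left_mono)
  have "(\<integral>t. h (Z t) \<partial>lborel) = enn2real (\<integral>\<^sup>+ t. ennreal (h (Z t)) \<partial>lborel)"
    by (intro integral_eq_nn_integral) (auto simp: h_def)
  also have "\<dots> \<le> enn2real (ennreal (G / Gamma a * (a * x powr (a - 1) * exp (- x))))"
    using le by (intro enn2real_mono) auto
  also have "\<dots> = G / Gamma a * (a * x powr (a - 1) * exp (- x))"
    using G_pos a_pos by simp
  finally show ?thesis by (simp add: h_def indicator_def)
qed

end

subsection \<open>Stirling's lower bound at half-integers\<close>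

text \<open>The left side is the midpoint rule for the integral of \<open>1 / s\<close> from 1 to
  \<open>1 + t\<close>, which underestimates a convex function.\<close>

lemma ln_one_plus_ge:
  fixes t :: real
  assumes "t \<ge> 0"
  shows "2 * t / (2 + t) \<le> ln (1 + t)"
proof -
  have "ln (1 + 0) - 2 * 0 / (2 + 0) \<le> ln (1 + t) - 2 * t / (2 + t)"
  proof (rule DERIV_nonneg_imp_nondecreasing[OF assms], intro exI conjI)
    fix s :: real assume s: "0 \<le> s" "s \<le> t"
    show "((\<lambda>t. ln (1 + t) - 2 * t / (2 + t)) has_real_derivative s\<^sup>2 / ((1 + s) * (2 + s)\<^sup>2)) (at s)"
      using s by (auto intro!: derivative_eq_intros simp: power2_eq_square)
        (simp add: divide_simps, simp add: algebra_simps)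
    show "0 \<le> s\<^sup>2 / ((1 + s) * (2 + s)\<^sup>2)" using s by simp
  qed
  then show ?thesis by simp
qed

text \<open>The right side is the trapezoidal rule for the same integral, which overestimates a
  convex function.\<close>

lemma ln_one_plus_le:
  fixes t :: real
  assumes "t \<ge> 0"
  shows "ln (1 + t) \<le> t * (2 + t) / (2 * (1 + t))"
proof -
  have "0 * (2 + 0) / (2 * (1 + 0)) - ln (1 + 0) \<le> t * (2 + t) / (2 * (1 + t)) - ln (1 + t)"
  proof (rule DERIV_nonneg_imp_nondecreasing[OF assms], intro exI conjI)
    fix s :: real assume s: "0 \<le> s" "s \<le> t"
    show "((\<lambda>t. t * (2 + t) / (2 * (1 + t)) - ln (1 + t)) has_real_derivative s\<^sup>2 / (2 * (1 + s)\<^sup>2)) (at s)"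
      using s by (auto intro!: derivative_eq_intros simp: power2_eq_square)
        (simp add: divide_simps, simp add: algebra_simps)
    show "0 \<le> s\<^sup>2 / (2 * (1 + s)\<^sup>2)" by simp
  qed
  then show ?thesis by simp
qed

text \<open>The logarithm of the quotient of \<open>Gamma x\<close> and Stirling's expression
  without its constant. Stirling's lower bound says that it is at least
  \<open>ln (2 * pi) / 2\<close>.\<close>

definition stirling_error :: "real \<Rightarrow> real"
  where "stirling_error x = ln (Gamma x) - (x - 1/2) * ln x + x"

lemma stirling_error_plus1:
  assumes "x > 0"
  shows "stirling_error x - stirling_error (x + 1) = (x + 1/2) * ln (1 + 1 / x) - 1"
proof -
  have "Gamma (x + 1) = x * Gamma x"
    by (rule Gamma_plus1) (use assms in \<open>auto dest: nonpos_Ints_nonpos\<close>)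
  moreover have "1 + 1 / x = (x + 1) / x" using assms by (simp add: field_simps)
  moreover have "Gamma x \<noteq> 0" using Gamma_real_pos[OF assms] by simp
  ultimately show ?thesis
    using assms by (simp add: stirling_error_def ln_mult ln_div algebra_simps)
qed

lemma stirling_error_decreasing:
  assumes "x > 0"
  shows "stirling_error (x + 1) \<le> stirling_error x"
proof -
  have "1 = (x + 1/2) * (2 * (1 / x) / (2 + 1 / x))" using assms by (simp add: field_simps)
  also have "\<dots> \<le> (x + 1/2) * ln (1 + 1 / x)"
    using assms by (intro mult_left_mono ln_one_plus_ge) auto
  finally show ?thesis using stirling_error_plus1[OF assms] by linarith
qed

text \<open>The trapezoidal bound makes the decrease at most a telescoping difference. Summed up,
  this bounds the decreasing sequence along \<open>x + k\<close> from below, so it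
  converges.\<close>

lemma stirling_error_decrease_le:
  assumes "x > 0"
  shows "stirling_error x - 1 / (4 * x) \<le> stirling_error (x + 1) - 1 / (4 * (x + 1))"
proof -
  have "(x + 1/2) * ln (1 + 1 / x) \<le> (x + 1/2) * ((1 / x) * (2 + 1 / x) / (2 * (1 + 1 / x)))"
    using assms by (intro mult_left_mono ln_one_plus_le) auto
  also have "\<dots> = 1 + (1 / (4 * x) - 1 / (4 * (x + 1)))"
    using assms by (simp add: divide_simps) (simp add: algebra_simps)
  finally show ?thesis using stirling_error_plus1[OF assms] by linarith
qed

lemma stirling_error_limit:
  assumes x: "x > 0"
  obtains L where "(\<lambda>k. stirling_error (x + real k)) \<longlonglongrightarrow> L" "L \<le> stirling_error x"
proof -
  define X where "X = (\<lambda>k. stirling_error (x + real k))"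
  have dec: "decseq X"
  proof (rule decseq_SucI)
    fix k show "X (Suc k) \<le> X k"
      using stirling_error_decreasing[of "x + real k"] x by (simp add: X_def add_ac)
  qed
  have "stirling_error x - 1 / (4 * x) \<le> X k - 1 / (4 * (x + real k))" for k
  proof (induction k)
    case (Suc k)
    then show ?case
      using stirling_error_decrease_le[of "x + real k"] x by (simp add: X_def add_ac)
  qed (simp add: X_def)
  moreover have "0 \<le> 1 / (4 * (x + real k))" for k using x by simp
  ultimately have "stirling_error x - 1 / (4 * x) \<le> X k" for k
    by (smt (verit))
  then obtain L where L: "X \<longlonglongrightarrow> L" and "\<forall>i. L \<le> X i"
    using decseq_convergent[OF dec] by blast
  then have "L \<le> stirling_error x" by (metis X_def add.right_neutral of_nat_0)
  with L show ?thesis using that by (simp add: X_def)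
qed

lemma Gamma_legendre_duplication_real:
  fixes x :: real
  assumes "x > 0"
  shows "Gamma x * Gamma (x + 1/2) = exp ((1 - 2 * x) * ln 2) * sqrt pi * Gamma (2 * x)"
proof -
  have "complex_of_real x \<notin> \<int>\<^sub>\<le>\<^sub>0" "complex_of_real x + 1/2 \<notin> \<int>\<^sub>\<le>\<^sub>0"
    using assms by (auto elim!: nonpos_Ints_cases simp: complex_eq_iff)
  from Gamma_legendre_duplication[OF this]
  have "Gamma (complex_of_real x) * Gamma (complex_of_real (x + 1/2))
      = exp (complex_of_real ((1 - 2 * x) * ln 2)) * complex_of_real (sqrt pi) * Gamma (complex_of_real (2 * x))"
    by simp
  then have "complex_of_real (Gamma x * Gamma (x + 1/2)) = complex_of_real (exp ((1 - 2 * x) * ln 2) * sqrt pi * Gamma (2 * x))"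
    by (simp only: exp_of_real Gamma_complex_of_real of_real_mult[symmetric])
  then show ?thesis by (simp only: of_real_eq_iff)
qed

lemma stirling_error_duplication:
  assumes "x > 0"
  shows "stirling_error x + stirling_error (x + 1/2) - stirling_error (2 * x)
    = ln (2 * pi) / 2 + (1/2 - x * ln (1 + 1 / (2 * x)))"
proof -
  have "ln (Gamma x * Gamma (x + 1/2)) = ln (exp ((1 - 2 * x) * ln 2) * sqrt pi * Gamma (2 * x))"
    using Gamma_legendre_duplication_real[OF assms] by simp
  then have "ln (Gamma x) + ln (Gamma (x + 1/2)) = (1 - 2 * x) * ln 2 + ln pi / 2 + ln (Gamma (2 * x))"
    using assms Gamma_real_pos[of x] Gamma_real_pos[of "x + 1/2"] Gamma_real_pos[of "2 * x"]
    by (simp add: ln_mult ln_sqrt less_imp_neq[symmetric])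
  moreover have "ln (1 + 1 / (2 * x)) = ln (x + 1/2) - ln x"
  proof -
    have "1 + 1 / (2 * x) = (x + 1/2) / x" using assms by (simp add: field_simps)
    then show ?thesis using assms by (simp add: ln_div)
  qed
  then have "x * ln (1 + 1 / (2 * x)) = x * ln (x + 1/2) - x * ln x"
    by (simp only: right_diff_distrib)
  moreover have "ln (2 * x) = ln 2 + ln x" "ln (2 * pi) = ln 2 + ln pi"
    using assms by (simp_all add: ln_mult)
  ultimately show ?thesis
    by (simp add: stirling_error_def algebra_simps add_divide_distrib)
qed

text \<open>Log-convexity of \<open>Gamma\<close> at the midpoint of \<open>x\<close> and
  \<open>x + 1\<close>; the bracket collects the elementary terms and tends to 0.\<close>

lemma stirling_error_midpoint:
  assumes "x > 0"
  shows "2 * stirling_error (x + 1/2) + (2 * x * ln (x + 1/2) - (x - 1/2) * ln x - (x + 1/2) * ln (x + 1))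
    \<le> stirling_error x + stirling_error (x + 1)"
proof -
  have "(ln \<circ> Gamma) ((1 - 1/2) *\<^sub>R x + (1/2) *\<^sub>R (x + 1)) \<le> (1 - 1/2) * (ln \<circ> Gamma) x + (1/2) * (ln \<circ> Gamma) (x + 1)"
    using assms by (intro convex_onD[OF log_convex_Gamma_real]) auto
  moreover have "(1 - 1/2) *\<^sub>R x + (1/2) *\<^sub>R (x + 1) = x + 1/2" by (simp add: field_simps)
  ultimately show ?thesis by (simp add: stirling_error_def algebra_simps)
qed

text \<open>
  The duplication formula at the integers gives the limit at the half-odd integers; log-convexity
  carries the lower bound over to the integers.
\<close>

lemma stirling_error_half_nat_ge:
  assumes "m > 0"
  shows "ln (2 * pi) / 2 \<le> stirling_error (real m / 2)"
proof -
  define c where "c = ln (2 * pi) / 2"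
  obtain L where L: "(\<lambda>k. stirling_error (1 + real k)) \<longlonglongrightarrow> L"
    using stirling_error_limit[of 1] by auto
  obtain M where M: "(\<lambda>k. stirling_error (1/2 + real k)) \<longlonglongrightarrow> M"
    using stirling_error_limit[of "1/2"] by auto
  have M': "(\<lambda>k. stirling_error (1 + real k + 1/2)) \<longlonglongrightarrow> M"
    using LIMSEQ_Suc[OF M] by (simp add: add_ac)
  have L2: "(\<lambda>k. stirling_error (2 * (1 + real k))) \<longlonglongrightarrow> L"
  proof -
    have "strict_mono (\<lambda>k::nat. 2 * k + 1)" by (auto simp: strict_mono_def)
    from LIMSEQ_subseq_LIMSEQ[OF L this] show ?thesis by (simp add: o_def algebra_simps)
  qed
  \<comment> \<open>The unknown limit \<open>L\<close> along the integers enters once for the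
    argument and once for its double, and cancels; the duplication formula thus determines
    \<open>M\<close> alone.\<close>
  have "(\<lambda>k. stirling_error (1 + real k) + stirling_error (1 + real k + 1/2) - stirling_error (2 * (1 + real k))) \<longlonglongrightarrow> L + M - L"
    by (intro tendsto_intros L M' L2)
  moreover have "(\<lambda>k. stirling_error (1 + real k) + stirling_error (1 + real k + 1/2) - stirling_error (2 * (1 + real k))) \<longlonglongrightarrow> c"
  proof -
    have "(\<lambda>k. c + (1/2 - (1 + real k) * ln (1 + 1 / (2 * (1 + real k))))) \<longlonglongrightarrow> c + 0"
      by (intro tendsto_intros) real_asymp
    then show ?thesis by (subst stirling_error_duplication) (simp_all add: c_def)
  qed
  ultimately have Mc: "M = c" using LIMSEQ_unique by fastforce
  have "2 * M + 0 \<le> L + L"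
  proof (rule LIMSEQ_le)
    show "(\<lambda>k. 2 * stirling_error (1 + real k + 1/2) + (2 * (1 + real k) * ln (1 + real k + 1/2)
        - (1 + real k - 1/2) * ln (1 + real k) - (1 + real k + 1/2) * ln (1 + real k + 1))) \<longlonglongrightarrow> 2 * M + 0"
      by (intro tendsto_intros M') real_asymp
    show "(\<lambda>k. stirling_error (1 + real k) + stirling_error (1 + real k + 1)) \<longlonglongrightarrow> L + L"
      using LIMSEQ_Suc[OF L] by (intro tendsto_intros L) (simp add: add_ac)
    show "\<exists>N. \<forall>k\<ge>N. 2 * stirling_error (1 + real k + 1/2) + (2 * (1 + real k) * ln (1 + real k + 1/2)
        - (1 + real k - 1/2) * ln (1 + real k) - (1 + real k + 1/2) * ln (1 + real k + 1))
        \<le> stirling_error (1 + real k) + stirling_error (1 + real k + 1)"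
      by (intro exI[of _ 0] allI impI stirling_error_midpoint) simp
  qed
  then have Lc: "c \<le> L" using Mc by simp
  show ?thesis
  proof (cases "even m")
    case True
    then obtain j where j: "m = 2 * j" by blast
    obtain L' where L': "(\<lambda>k. stirling_error (real j + real k)) \<longlonglongrightarrow> L'" "L' \<le> stirling_error (real j)"
      using stirling_error_limit[of "real j"] assms j by auto
    have "(\<lambda>k. stirling_error (1 + real (k + (j - 1)))) \<longlonglongrightarrow> L"
      using LIMSEQ_ignore_initial_segment[OF L] .
    moreover have "1 + real (k + (j - 1)) = real j + real k" for k using assms j by simp
    ultimately have "(\<lambda>k. stirling_error (real j + real k)) \<longlonglongrightarrow> L" by (simp only:)
    then have "L' = L" by (rule LIMSEQ_unique[OF L'(1)])
    then show ?thesis using Lc L'(2) j by (simp add: c_def)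
  next
    case False
    then obtain j where j: "m = 2 * j + 1" using oddE by blast
    then have m2: "real m / 2 = 1/2 + real j" by simp
    obtain L' where L': "(\<lambda>k. stirling_error (1/2 + real j + real k)) \<longlonglongrightarrow> L'" "L' \<le> stirling_error (1/2 + real j)"
      using stirling_error_limit[of "1/2 + real j"] by auto
    have "(\<lambda>k. stirling_error (1/2 + real (k + j))) \<longlonglongrightarrow> M"
      using LIMSEQ_ignore_initial_segment[OF M] .
    moreover have "1/2 + real (k + j) = 1/2 + real j + real k" for k by simp
    ultimately have "(\<lambda>k. stirling_error (1/2 + real j + real k)) \<longlonglongrightarrow> M" by (simp only:)
    then have "L' = M" by (rule LIMSEQ_unique[OF L'(1)])
    then show ?thesis using Mc L'(2) by (simp only: m2 c_def)
  qed
qed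

lemma Gamma_half_nat_ge:
  assumes "m > 0" and a: "a = real m / 2"
  shows "sqrt (2 * pi) * a powr (a - 1/2) * exp (- a) \<le> Gamma a"
proof -
  have "a > 0" using assms by simp
  have "ln (2 * pi) / 2 + (a - 1/2) * ln a - a \<le> ln (Gamma a)"
    using stirling_error_half_nat_ge[OF assms(1)] by (simp add: stirling_error_def a)
  then have "exp (ln (2 * pi) / 2 + (a - 1/2) * ln a - a) \<le> Gamma a"
    by (rule ln_ge_iff[OF Gamma_real_pos[OF \<open>a > 0\<close>], THEN iffD1])
  moreover have "exp (ln (2 * pi) / 2) = sqrt (2 * pi)"
  proof -
    have "ln (sqrt (2 * pi)) = ln (2 * pi) / 2" by (rule ln_sqrt) simp
    moreover have "exp (ln (sqrt (2 * pi))) = sqrt (2 * pi)" by (rule exp_ln) simp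
    ultimately show ?thesis by (simp only:)
  qed
  moreover have "a powr (a - 1/2) = exp ((a - 1/2) * ln a)"
    using \<open>a > 0\<close> by (simp add: powr_def)
  moreover have "exp (ln (2 * pi) / 2 + (a - 1/2) * ln a - a) = exp (ln (2 * pi) / 2) * exp ((a - 1/2) * ln a) * exp (- a)"
    by (simp only: diff_conv_add_uminus exp_add)
  ultimately show ?thesis by (simp only:)
qed

subsection \<open>The threshold\<close>

text \<open>Above the infimum there is a smaller point from which \<open>N\<close> has no gaps. At
  the infimum itself membership comes from \<open>N\<close> being closed.\<close>

lemma threshold_le_imp_mem:
  assumes N: "closed N" "bdd_below N" and "{m..} \<subseteq> N" and n: "threshold N \<le> n"
  shows "n \<in> N"
proof -
  define S where "S = {m \<in> N. {m..} \<subseteq> N}"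
  have S: "S \<noteq> {}" "S \<subseteq> N" "bdd_below S"
    using assms by (auto simp: S_def intro: bdd_below_mono)
  have "Inf S \<in> closure S" using S by (intro closure_contains_Inf)
  also have "closure S \<subseteq> N" using S N by (intro closure_minimal)
  finally have "Inf S \<in> N" .
  show ?thesis
  proof (cases "n = Inf S")
    case False
    then have "Inf S < n" using n by (simp add: threshold_def S_def)
    then obtain m' where "m' \<in> S" "m' < n" using S by (auto simp: cInf_less_iff)
    then show ?thesis by (auto simp: S_def)
  qed (use \<open>Inf S \<in> N\<close> in simp)
qed

lemma threshold_log_conditions:
  fixes d \<alpha> \<xi> A B c :: real
  assumes pos: "d > 0" "\<alpha> > 1" "\<xi> > 0" and c: "c > 0"
  defines "N \<equiv> {n. n \<ge> 1 \<and> d \<le> (d + 2 * \<alpha>) * ln n \<and> (d + 2 * \<alpha>) * ln n \<le> \<xi> * n} \<inter>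
    {n. n \<ge> 1 \<and> A * (ln n powr (3/2) / n powr (1/2)) + B * (ln n powr (1 + \<alpha>/2) / n powr (\<alpha>/2)) \<le> c}"
  assumes n: "threshold N \<le> n"
  shows "n \<in> N"
proof -
  have "closed N"
  proof -
    have cont: "continuous_on {1..} (\<lambda>n::real. ln n)" by (intro continuous_intros) auto
    have "N = {n \<in> {1..}. d \<le> (d + 2 * \<alpha>) * ln n} \<inter> {n \<in> {1..}. (d + 2 * \<alpha>) * ln n \<le> \<xi> * n} \<inter>
      {n \<in> {1..}. A * (ln n powr (3/2) / n powr (1/2)) + B * (ln n powr (1 + \<alpha>/2) / n powr (\<alpha>/2)) \<le> c}"
      by (auto simp: N_def)
    also have "closed \<dots>"
    proof (intro closed_Int continuous_on_closed_Collect_le closed_atLeast)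
      \<comment> \<open>At \<open>n = 1\<close> the base \<open>ln n\<close> is 0, where the power
        is continuous because the exponent is positive.\<close>
      have ln_powr: "continuous_on {1..} (\<lambda>n::real. ln n powr p)" if "p > 0" for p
        by (rule continuous_on_powr'[OF cont continuous_on_const]) (use that in auto)
      have powr: "continuous_on {1..} (\<lambda>n::real. n powr p)" for p
        by (rule continuous_on_powr[OF continuous_on_id continuous_on_const]) auto
      have quot: "continuous_on {1..} (\<lambda>n::real. C * (ln n powr p / n powr q))" if "p > 0" for C p q
        by (intro continuous_on_mult continuous_on_divide continuous_on_const ln_powr powr that) auto
      show "continuous_on {1..} (\<lambda>n. A * (ln n powr (3/2) / n powr (1/2)) + B * (ln n powr (1 + \<alpha>/2) / n powr (\<alpha>/2)))"
        using pos by (intro continuous_on_add quot) auto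
      show "continuous_on {1..} (\<lambda>n. (d + 2 * \<alpha>) * ln n)" "continuous_on {1..} (\<lambda>n. (d + 2 * \<alpha>) * ln n)"
        by (intro continuous_on_mult continuous_on_const cont)+
      show "continuous_on {1..} (\<lambda>n::real. \<xi> * n)" by (intro continuous_intros)
    qed (rule continuous_on_const)+
    finally show ?thesis .
  qed
  moreover have "bdd_below N" by (rule bdd_belowI[of _ 1]) (auto simp: N_def)
  moreover have "eventually (\<lambda>n. n \<in> N) at_top"
  proof -
    have "eventually (\<lambda>n::real. d \<le> (d + 2 * \<alpha>) * ln n) at_top"
      using pos by real_asymp
    moreover have "eventually (\<lambda>n::real. (d + 2 * \<alpha>) * ln n \<le> \<xi> * n) at_top"
      using pos by real_asymp
    moreover have "eventually (\<lambda>n::real. A * (ln n powr (3/2) / n powr (1/2)) + B * (ln n powr (1 + \<alpha>/2) / n powr (\<alpha>/2)) \<le> c) at_top"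
    proof -
      have "((\<lambda>n::real. ln n powr (3/2) / n powr (1/2)) \<longlongrightarrow> 0) at_top" by real_asymp
      moreover have "((\<lambda>n::real. ln n powr (1 + \<alpha>/2) / n powr (\<alpha>/2)) \<longlongrightarrow> 0) at_top"
        using pos by real_asymp
      ultimately have "((\<lambda>n::real. A * (ln n powr (3/2) / n powr (1/2)) + B * (ln n powr (1 + \<alpha>/2) / n powr (\<alpha>/2))) \<longlongrightarrow> A * 0 + B * 0) at_top"
        by (intro tendsto_intros)
      then have "eventually (\<lambda>n::real. A * (ln n powr (3/2) / n powr (1/2)) + B * (ln n powr (1 + \<alpha>/2) / n powr (\<alpha>/2)) < c) at_top"
        using c by (intro order_tendstoD) auto
      then show ?thesis by eventually_elim simp
    qed
    ultimately show ?thesis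
      using eventually_ge_at_top[of 1] by eventually_elim (simp add: N_def)
  qed
  then obtain m where "\<forall>n\<ge>m. n \<in> N" by (auto simp: eventually_at_top_linorder)
  then have "{m..} \<subseteq> N" by auto
  ultimately show ?thesis using threshold_le_imp_mem n by blast
qed

subsection \<open>Bounds for the Laplace integral\<close>

lemma integral_odd_eq_0:
  fixes h :: "'a::euclidean_space \<Rightarrow> real"
  assumes [measurable]: "h \<in> borel_measurable borel" and odd: "\<And>t. h (- t) = - h t"
  shows "(\<integral>t. h t \<partial>lborel) = 0"
proof -
  have "distr lborel borel uminus = (lborel :: 'a measure)"
    using lborel_affine[of "-1" "0 :: 'a"] by (simp add: density_1)
  then have "(\<integral>t. h t \<partial>lborel) = (\<integral>t. h t \<partial>distr lborel borel uminus)" by simp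
  also have "\<dots> = (\<integral>t. h (- t) \<partial>lborel)" by (rule integral_distr) auto
  also have "\<dots> = - (\<integral>t. h t \<partial>lborel)" by (simp add: odd)
  finally show ?thesis by simp
qed

section \<open>The cubic Taylor term\<close>

lemma d3_uminus: "d3 f x (- t) = - d3 f x t"
  by (simp add: d3_def sum_negf)

lemma d3_scaleR: "d3 f x (c *\<^sub>R t) = c ^ 3 * d3 f x t"
  by (simp add: d3_def sum_distrib_left power3_eq_cube mult_ac)

lemma d3_measurable [measurable]: "d3 f x \<in> borel_measurable borel"
  unfolding d3_def by (intro borel_measurable_continuous_onI continuous_intros)

text \<open>With all coefficients replaced by their maximum, the triple sum becomes the cube of the
  sum of the \<open>\<bar>t $ i\<bar>\<close>, which is at most \<open>sqrt d * norm t\<close>. This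
  is the origin of \<open>d powr (3/2)\<close> in \<open>D\<close>.\<close>

lemma abs_d3_le:
  fixes f :: "real ^ 'd::finite \<Rightarrow> real"
  shows "\<bar>d3 f x t\<bar> \<le> real CARD('d) powr (3/2) * (MAX (i, j, k) \<in> UNIV. \<bar>partial_deriv [i, j, k] f x\<bar>) * norm t ^ 3"
proof -
  define M where "M = (MAX (i, j, k) \<in> UNIV. \<bar>partial_deriv [i, j, k] f x\<bar>)"
  define s where "s = (\<Sum>i\<in>UNIV. \<bar>t $ i\<bar>)"
  have M: "\<bar>partial_deriv [i, j, k] f x\<bar> \<le> M" for i j k
    unfolding M_def by (rule Max_ge) (auto intro!: image_eqI[of _ _ "(i, j, k)"])
  have "M \<ge> 0" using M order.trans[OF abs_ge_zero] by blast
  have s: "s \<ge> 0" by (simp add: s_def sum_nonneg)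
  have "s\<^sup>2 \<le> (\<Sum>i\<in>UNIV. \<bar>t $ i\<bar>\<^sup>2) * CARD('d)"
    unfolding s_def by (rule sum_squared_le_sum_of_squares)
  also have "(\<Sum>i\<in>UNIV. \<bar>t $ i\<bar>\<^sup>2) = (norm t)\<^sup>2"
    unfolding power2_norm_eq_inner inner_vec_def by (simp add: power2_eq_square)
  also have "(norm t)\<^sup>2 * CARD('d) = (sqrt CARD('d) * norm t)\<^sup>2" by (simp add: power_mult_distrib)
  finally have "s \<le> sqrt CARD('d) * norm t" by (rule power2_le_imp_le) simp
  then have "s ^ 3 \<le> (sqrt CARD('d) * norm t) ^ 3" using s by (intro power_mono)
  also have "\<dots> = sqrt CARD('d) ^ 3 * norm t ^ 3" by (simp add: power_mult_distrib)
  also have "sqrt CARD('d) ^ 3 = real CARD('d) powr (3/2)"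
    using powr_realpow[of "sqrt CARD('d)" 3] by (simp add: powr_half_sqrt[symmetric] powr_powr)
  finally have s3: "s ^ 3 \<le> real CARD('d) powr (3/2) * norm t ^ 3" .
  have "\<bar>d3 f x t\<bar> \<le> (\<Sum>i\<in>UNIV. \<Sum>j\<in>UNIV. \<Sum>k\<in>UNIV. M * (\<bar>t $ i\<bar> * (\<bar>t $ j\<bar> * \<bar>t $ k\<bar>)))"
    unfolding d3_def
    by (intro order.trans[OF sum_abs] sum_mono) (simp only: abs_mult mult.assoc M mult_right_mono mult_nonneg_nonneg abs_ge_zero)
  also have "\<dots> = M * s ^ 3"
  proof -
    have "(\<Sum>i\<in>UNIV. \<bar>t $ i\<bar> * w) = s * w" for w by (simp add: s_def sum_distrib_right)
    then show ?thesis by (simp add: power3_eq_cube flip: sum_distrib_left s_def)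
  qed
  also have "\<dots> \<le> M * (real CARD('d) powr (3/2) * norm t ^ 3)"
    using s3 \<open>M \<ge> 0\<close> by (intro mult_left_mono)
  finally show ?thesis by (simp add: M_def mult_ac)
qed

text \<open>The origin of \<open>Kl\<close>. The bound \<open>ln n \<le> n / exp 1\<close> turns the
  logarithms in \<open>x powr (a - 1)\<close> into powers of \<open>n\<close> with a factor
  \<open>exp (1 - a)\<close>; Stirling's bound for \<open>Gamma a\<close> has the factor
  \<open>exp (- a)\<close>, and of the two only e survives.\<close>

lemma Gamma_tail_constant_le:
  fixes d \<alpha> n :: real
  assumes m: "m \<ge> 2" and a: "a = real m / 2" and \<alpha>: "\<alpha> > 0" and n: "n \<ge> 1"
    and x: "x = (a + \<alpha>) * ln n"
  shows "a * x powr (a - 1) * exp (- x) / Gamma a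
    \<le> exp 1 / 2 * sqrt (real m / pi) * (1 + \<alpha> / a) powr (a - 1) / n powr (1 + \<alpha>)"
proof -
  have a1: "a \<ge> 1" using m by (simp add: a)
  have "ln n \<le> n / exp 1"
    using ln_le_minus_one[of "n / exp 1"] n by (simp add: ln_div)
  then have "ln n powr (a - 1) \<le> (n / exp 1) powr (a - 1)"
    using a1 n by (intro powr_mono2) auto
  also have "\<dots> = n powr (a - 1) / exp 1 powr (a - 1)"
    using n by (simp add: powr_divide)
  also have "\<dots> = n powr (a - 1) * exp (1 - a)"
    by (simp add: powr_def exp_diff)
  finally have ln_le: "ln n powr (a - 1) \<le> n powr (a - 1) * exp (1 - a)" .
  have "a + \<alpha> = a * (1 + \<alpha> / a)" using a1 by (simp add: field_simps)
  then have "x powr (a - 1) = a powr (a - 1) * (1 + \<alpha> / a) powr (a - 1) * ln n powr (a - 1)"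
    using a1 \<alpha> n by (simp add: x powr_mult)
  moreover have "exp (- x) = n powr - (a + \<alpha>)" using n by (simp add: x powr_def algebra_simps)
  ultimately have "a * x powr (a - 1) * exp (- x)
      = a * a powr (a - 1) * (1 + \<alpha> / a) powr (a - 1) * n powr - (a + \<alpha>) * ln n powr (a - 1)"
    by simp
  also have "\<dots> \<le> a * a powr (a - 1) * (1 + \<alpha> / a) powr (a - 1) * n powr - (a + \<alpha>) * (n powr (a - 1) * exp (1 - a))"
    using ln_le a1 by (intro mult_left_mono) auto
  also have "\<dots> = a powr a * (1 + \<alpha> / a) powr (a - 1) * exp (1 - a) * (n powr - (a + \<alpha>) * n powr (a - 1))"
  proof -
    have "a * a powr (a - 1) = a powr a" using powr_add[of a 1 "a - 1"] a1 by simp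
    then show ?thesis by (simp only: mult_ac)
  qed
  also have "n powr - (a + \<alpha>) * n powr (a - 1) = n powr - (1 + \<alpha>)"
    by (simp add: algebra_simps flip: powr_add)
  finally have num: "a * x powr (a - 1) * exp (- x) \<le> a powr a * (1 + \<alpha> / a) powr (a - 1) * exp (1 - a) * n powr - (1 + \<alpha>)" .
  define g where "g = sqrt (2 * pi) * a powr (a - 1/2) * exp (- a)"
  have g: "g > 0" using a1 by (simp add: g_def)
  have "g \<le> Gamma a" unfolding g_def by (rule Gamma_half_nat_ge[OF _ a]) (use m in simp)
  then have "a * x powr (a - 1) * exp (- x) / Gamma a
      \<le> (a powr a * (1 + \<alpha> / a) powr (a - 1) * exp (1 - a) * n powr - (1 + \<alpha>)) / g"
    using num a1 g by (intro frac_le) auto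
  also have "\<dots> = (a powr a / a powr (a - 1/2)) * (exp (1 - a) / exp (- a)) / sqrt (2 * pi) * (1 + \<alpha> / a) powr (a - 1) * n powr - (1 + \<alpha>)"
    by (simp add: g_def mult_ac)
  also have "a powr a / a powr (a - 1/2) = sqrt a"
    using a1 by (simp add: powr_half_sqrt flip: powr_diff)
  also have "exp (1 - a) / exp (- a) = exp 1" by (simp flip: exp_diff)
  also have "sqrt a * exp 1 / sqrt (2 * pi) = exp 1 / 2 * sqrt (real m / pi)"
  proof -
    have "sqrt a / sqrt (2 * pi) = sqrt ((real m / pi) / 4)"
      by (simp add: a flip: real_sqrt_divide)
    also have "\<dots> = sqrt (real m / pi) / 2" by (simp only: real_sqrt_divide real_sqrt_four)
    finally have half: "sqrt a / sqrt (2 * pi) = sqrt (real m / pi) / 2" .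
    have "sqrt a * exp 1 / sqrt (2 * pi) = exp 1 * (sqrt a / sqrt (2 * pi))" by simp
    then show ?thesis unfolding half by simp
  qed
  finally show ?thesis by (simp only: powr_minus_divide times_divide_eq_right mult_1_right)
qed

section \<open>Integrals of the majorant and the minorant\<close>

lemma scaling_factor:
  fixes n l p k :: real
  assumes "n > 0" "l > 0"
  shows "n powr k * (2 / (n * l)) powr p = (2 / l) powr p / n powr (p - k)"
  using assms by (simp add: powr_divide powr_mult powr_diff field_simps)

text \<open>Of the cubic term only oddness, measurability and cubic growth are kept in
  \<open>u\<close>; \<open>v\<close> is the remainder bound multiplied by \<open>n\<close>.\<close>

locale laplace_bounds = gaussian_form H n Z G a
  for H :: "real ^ 'd ^ 'd::finite" and n Z G a +
  fixes l D C \<alpha> :: real and u v :: "real ^ 'd \<Rightarrow> real"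
  assumes l: "l > 0" "\<And>t. l * (norm t)\<^sup>2 \<le> t \<bullet> (H *v t)"
    and D: "D \<ge> 0" and C: "C \<ge> 0" and \<alpha>: "\<alpha> > 0"
    and u_measurable [measurable]: "u \<in> borel_measurable borel"
    and u_odd: "\<And>t. u (- t) = - u t" and u_le: "\<And>t. \<bar>u t\<bar> \<le> n * D * norm t ^ 3"
    and v_eq: "v = (\<lambda>t. n * C * norm t powr (2 + \<alpha>))"
begin

lemma norm_le: "(norm t)\<^sup>2 \<le> 2 / (n * l) * Z t"
  using l n by (simp add: Z_def field_simps)

lemma norm_powr_le:
  assumes "p \<ge> 0"
  shows "norm t powr (2 * p) \<le> (2 / (n * l)) powr p * Z t powr p"
proof -
  have "norm t powr (2 * p) = ((norm t)\<^sup>2) powr p"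
    by (cases "t = 0") (simp_all add: powr_powr flip: powr_numeral)
  also have "\<dots> \<le> (2 / (n * l) * Z t) powr p"
    using assms norm_le by (intro powr_mono2) auto
  also have "\<dots> = (2 / (n * l)) powr p * Z t powr p"
    by (rule powr_mult)
  finally show ?thesis .
qed

lemma u_le_Z: "\<bar>u t\<bar> \<le> n * D * ((2 / (n * l)) powr (3/2) * Z t powr (3/2))"
proof -
  have "norm t ^ 3 = norm t powr (2 * (3/2))"
    by (cases "t = 0") (simp_all flip: powr_numeral)
  also have "\<dots> \<le> (2 / (n * l)) powr (3/2) * Z t powr (3/2)" by (rule norm_powr_le) simp
  finally have "n * D * norm t ^ 3 \<le> n * D * ((2 / (n * l)) powr (3/2) * Z t powr (3/2))"
    using n D by (intro mult_left_mono) auto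
  with u_le[of t] show ?thesis by linarith
qed

lemma v_le_Z: "v t \<le> n * C * ((2 / (n * l)) powr (1 + \<alpha>/2) * Z t powr (1 + \<alpha>/2))"
proof -
  have "norm t powr (2 + \<alpha>) \<le> (2 / (n * l)) powr (1 + \<alpha>/2) * Z t powr (1 + \<alpha>/2)"
    using norm_powr_le[of "1 + \<alpha>/2" t] \<alpha> by simp
  then show ?thesis unfolding v_eq using n C by (intro mult_left_mono) auto
qed

lemma v_nonneg: "0 \<le> v t" using n C by (simp add: v_eq)

lemma v_even: "v (- t) = v t" by (simp add: v_eq)

lemma v_measurable [measurable]: "v \<in> borel_measurable borel" unfolding v_eq by measurable

lemma Z_even: "Z (- t) = Z t" by (simp add: Z_def linear_neg[OF matrix_vector_mul_linear])

text \<open>A term bounded by a power of \<open>Z\<close> is integrable against the Gaussian weight,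
  and a single gamma moment bounds its integral.\<close>

lemma dominated:
  assumes [measurable]: "g \<in> borel_measurable borel" and p: "p \<ge> 0" and c: "c \<ge> 0"
    and le: "\<And>t. \<bar>g t\<bar> \<le> c * Z t powr p"
  shows "integrable lborel (\<lambda>t. g t * exp (- Z t))"
    and "(\<integral>t. g t * exp (- Z t) \<partial>lborel) \<le> G * (c * poch a p)"
proof -
  have int: "has_bochner_integral lborel (\<lambda>t. c * (Z t powr p * exp (- Z t))) (c * (G * poch a p))"
    by (rule has_bochner_integral_mult_right) (rule moment[OF p])
  have bound: "\<bar>g t * exp (- Z t)\<bar> \<le> c * (Z t powr p * exp (- Z t))" for t
    using mult_right_mono[OF le[of t], of "exp (- Z t)"] by (simp add: abs_mult mult.assoc)
  show integrable: "integrable lborel (\<lambda>t. g t * exp (- Z t))"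
  proof (rule Bochner_Integration.integrable_bound)
    show "integrable lborel (\<lambda>t. c * (Z t powr p * exp (- Z t)))" using int by (rule integrable.intros)
    show "AE t in lborel. norm (g t * exp (- Z t)) \<le> norm (c * (Z t powr p * exp (- Z t)))"
      using bound c by (intro AE_I2) auto
  qed simp
  have "(\<integral>t. g t * exp (- Z t) \<partial>lborel) \<le> (\<integral>t. c * (Z t powr p * exp (- Z t)) \<partial>lborel)"
    using bound by (intro integral_mono integrable integrable.intros[OF int]) (auto simp: abs_le_iff)
  then show "(\<integral>t. g t * exp (- Z t) \<partial>lborel) \<le> G * (c * poch a p)"
    unfolding has_bochner_integral_integral_eq[OF int] by (simp only: mult_ac)
qed

end

context laplace_bounds
begin

text \<open>In terms of \<open>Z\<close>, \<open>u\<close> has order \<open>n powr (- 1/2)\<close>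
  and \<open>v\<close> has order \<open>n powr (- \<alpha>/2)\<close>, which gives the powers of
  \<open>n\<close> in the bounds. For \<open>u\<close> and \<open>u * v\<close> integrability is all
  that is asked, as these odd terms cancel.\<close>

lemma
  shows integrable_v: "integrable lborel (\<lambda>t. v t * exp (- Z t))"
    and integral_v: "(\<integral>t. v t * exp (- Z t) \<partial>lborel)
      \<le> G * (C * (2 / l) powr (1 + \<alpha>/2) * poch a (1 + \<alpha>/2) / n powr (\<alpha>/2))"
    and integrable_v2: "integrable lborel (\<lambda>t. (v t)\<^sup>2 * exp (- Z t))"
    and integral_v2: "(\<integral>t. (v t)\<^sup>2 * exp (- Z t) \<partial>lborel)
      \<le> G * (C\<^sup>2 * (2 / l) powr (2 + \<alpha>) * poch a (2 + \<alpha>) / n powr \<alpha>)"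
    and integrable_u2: "integrable lborel (\<lambda>t. (u t)\<^sup>2 * exp (- Z t))"
    and integral_u2: "(\<integral>t. (u t)\<^sup>2 * exp (- Z t) \<partial>lborel)
      \<le> G * (D\<^sup>2 * (2 / l) ^ 3 * poch a 3 / n)"
    and integrable_u: "integrable lborel (\<lambda>t. u t * exp (- Z t))"
    and integrable_uv: "integrable lborel (\<lambda>t. u t * v t * exp (- Z t))"
proof -
  define k where "k = 2 / (n * l)"
  have k: "k > 0" using n l by (simp add: k_def)
  define cu cv where "cu = n * D * k powr (3/2)" and "cv = n * C * k powr (1 + \<alpha>/2)"
  have cu: "cu \<ge> 0" and cv: "cv \<ge> 0" using n D C by (simp_all add: cu_def cv_def)
  have u: "\<bar>u t\<bar> \<le> cu * Z t powr (3/2)" for t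
    using u_le_Z[of t] by (simp add: cu_def k_def mult.assoc)
  have v: "\<bar>v t\<bar> \<le> cv * Z t powr (1 + \<alpha>/2)" for t
    using v_le_Z[of t] v_nonneg[of t] by (simp add: cv_def k_def mult.assoc)
  have sq: "(z powr p)\<^sup>2 = z powr (2 * p)" for z p :: real
    by (simp add: power2_eq_square flip: powr_add)
  have u2: "\<bar>(u t)\<^sup>2\<bar> \<le> cu\<^sup>2 * Z t powr 3" for t
    using power_mono[OF u[of t], of 2] by (simp add: power_mult_distrib sq)
  have v2: "\<bar>(v t)\<^sup>2\<bar> \<le> cv\<^sup>2 * Z t powr (2 + \<alpha>)" for t
    using power_mono[OF v[of t], of 2] by (simp add: power_mult_distrib sq)
  have uv: "\<bar>u t * v t\<bar> \<le> cu * cv * Z t powr (3/2 + (1 + \<alpha>/2))" for t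
  proof -
    have "\<bar>u t\<bar> * \<bar>v t\<bar> \<le> (cu * Z t powr (3/2)) * (cv * Z t powr (1 + \<alpha>/2))"
      using cu by (intro mult_mono u v) auto
    also have "\<dots> = cu * cv * Z t powr (3/2 + (1 + \<alpha>/2))"
      by (simp only: powr_add mult_ac)
    finally show ?thesis by (simp only: abs_mult)
  qed
  show "integrable lborel (\<lambda>t. v t * exp (- Z t))"
    by (rule dominated[OF _ _ cv v]) (use \<alpha> in auto)
  show "integrable lborel (\<lambda>t. (v t)\<^sup>2 * exp (- Z t))"
    by (rule dominated[OF _ _ _ v2]) (use \<alpha> in auto)
  show "integrable lborel (\<lambda>t. (u t)\<^sup>2 * exp (- Z t))"
    by (rule dominated[OF _ _ _ u2]) auto
  show "integrable lborel (\<lambda>t. u t * exp (- Z t))"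
    by (rule dominated[OF _ _ cu u]) auto
  show "integrable lborel (\<lambda>t. u t * v t * exp (- Z t))"
    by (rule dominated[OF _ _ _ uv]) (use \<alpha> cu cv in auto)
  have "cv = C * (2 / l) powr (1 + \<alpha>/2) / n powr (\<alpha>/2)"
    using scaling_factor[of n l 1 "1 + \<alpha>/2"] n l by (simp add: cv_def k_def mult.assoc mult.left_commute[of n])
  moreover have "(\<integral>t. v t * exp (- Z t) \<partial>lborel) \<le> G * (cv * poch a (1 + \<alpha>/2))"
    by (rule dominated[OF _ _ cv v]) (use \<alpha> in auto)
  ultimately show "(\<integral>t. v t * exp (- Z t) \<partial>lborel)
      \<le> G * (C * (2 / l) powr (1 + \<alpha>/2) * poch a (1 + \<alpha>/2) / n powr (\<alpha>/2))" by simp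
  have "cv\<^sup>2 = C\<^sup>2 * (2 / l) powr (2 + \<alpha>) / n powr \<alpha>"
    using scaling_factor[of n l 2 "2 + \<alpha>"] n l
    by (simp add: cv_def k_def power_mult_distrib sq mult.assoc mult.left_commute[of "n\<^sup>2"] powr_numeral)
  moreover have "(\<integral>t. (v t)\<^sup>2 * exp (- Z t) \<partial>lborel) \<le> G * (cv\<^sup>2 * poch a (2 + \<alpha>))"
    by (rule dominated[OF _ _ _ v2]) (use \<alpha> in auto)
  ultimately show "(\<integral>t. (v t)\<^sup>2 * exp (- Z t) \<partial>lborel)
      \<le> G * (C\<^sup>2 * (2 / l) powr (2 + \<alpha>) * poch a (2 + \<alpha>) / n powr \<alpha>)" by simp
  have "cu\<^sup>2 = D\<^sup>2 * (2 / l) ^ 3 / n"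
    using scaling_factor[of n l 2 3] n l
    by (simp add: cu_def k_def power_mult_distrib sq mult.assoc mult.left_commute[of "n\<^sup>2"] powr_numeral)
  moreover have "(\<integral>t. (u t)\<^sup>2 * exp (- Z t) \<partial>lborel) \<le> G * (cu\<^sup>2 * poch a 3)"
    by (rule dominated[OF _ _ _ u2]) auto
  ultimately show "(\<integral>t. (u t)\<^sup>2 * exp (- Z t) \<partial>lborel)
      \<le> G * (D\<^sup>2 * (2 / l) ^ 3 * poch a 3 / n)" by simp
qed

lemma
  shows integrable_majorant: "integrable lborel (\<lambda>t. exp (- Z t) * (1 + (u t + v t) + (u t + v t)\<^sup>2))"
    and integral_majorant: "(\<integral>t. exp (- Z t) * (1 + (u t + v t) + (u t + v t)\<^sup>2) \<partial>lborel)
      \<le> G * (1 + C * (2 / l) powr (1 + \<alpha>/2) * poch a (1 + \<alpha>/2) / n powr (\<alpha>/2)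
          + D\<^sup>2 * (2 / l) ^ 3 * poch a 3 / n + C\<^sup>2 * (2 / l) powr (2 + \<alpha>) * poch a (2 + \<alpha>) / n powr \<alpha>)"
proof -
  have eq: "exp (- Z t) * (1 + (u t + v t) + (u t + v t)\<^sup>2) = exp (- Z t) + u t * exp (- Z t) + v t * exp (- Z t)
      + (u t)\<^sup>2 * exp (- Z t) + 2 * (u t * v t * exp (- Z t)) + (v t)\<^sup>2 * exp (- Z t)" for t
    by (simp add: power2_eq_square algebra_simps)
  note [simp] = integrable.intros[OF total] integrable_v integrable_v2 integrable_u2 integrable_u integrable_uv
  show "integrable lborel (\<lambda>t. exp (- Z t) * (1 + (u t + v t) + (u t + v t)\<^sup>2))"
    unfolding eq by simp
  have "(\<integral>t. u t * exp (- Z t) \<partial>lborel) = 0" "(\<integral>t. u t * v t * exp (- Z t) \<partial>lborel) = 0"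
    by (rule integral_odd_eq_0; simp add: u_odd v_even Z_even)+
  moreover have "(\<integral>t. exp (- Z t) \<partial>lborel) = G" by (rule has_bochner_integral_integral_eq[OF total])
  ultimately have "(\<integral>t. exp (- Z t) * (1 + (u t + v t) + (u t + v t)\<^sup>2) \<partial>lborel)
      = G + (\<integral>t. v t * exp (- Z t) \<partial>lborel) + (\<integral>t. (u t)\<^sup>2 * exp (- Z t) \<partial>lborel) + (\<integral>t. (v t)\<^sup>2 * exp (- Z t) \<partial>lborel)"
    unfolding eq by simp
  also have "\<dots> \<le> G + G * (C * (2 / l) powr (1 + \<alpha>/2) * poch a (1 + \<alpha>/2) / n powr (\<alpha>/2))
      + G * (D\<^sup>2 * (2 / l) ^ 3 * poch a 3 / n) + G * (C\<^sup>2 * (2 / l) powr (2 + \<alpha>) * poch a (2 + \<alpha>) / n powr \<alpha>)"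
    by (intro add_mono order.refl integral_v integral_u2 integral_v2)
  finally show "(\<integral>t. exp (- Z t) * (1 + (u t + v t) + (u t + v t)\<^sup>2) \<partial>lborel)
      \<le> G * (1 + C * (2 / l) powr (1 + \<alpha>/2) * poch a (1 + \<alpha>/2) / n powr (\<alpha>/2)
          + D\<^sup>2 * (2 / l) ^ 3 * poch a 3 / n + C\<^sup>2 * (2 / l) powr (2 + \<alpha>) * poch a (2 + \<alpha>) / n powr \<alpha>)"
    by (simp add: distrib_left)
qed

lemma
  assumes a: "a \<ge> 1" and x: "x \<ge> a"
  shows integrable_minorant: "integrable lborel (\<lambda>t. indicator {t. Z t \<le> x} t * (exp (- Z t) * (1 + u t - v t)))"
    and integral_minorant: "G * (1 - C * (2 / l) powr (1 + \<alpha>/2) * poch a (1 + \<alpha>/2) / n powr (\<alpha>/2)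
          - a * x powr (a - 1) * exp (- x) / Gamma a)
      \<le> (\<integral>t. indicator {t. Z t \<le> x} t * (exp (- Z t) * (1 + u t - v t)) \<partial>lborel)"
proof -
  let ?U = "\<lambda>t. indicator {t. Z t \<le> x} t :: real" and ?V = "\<lambda>t. indicator {t. x < Z t} t :: real"
  \<comment> \<open>The constant 1 is written as its full integral minus the tail, \<open>u\<close>
    stays odd because the ellipsoid is symmetric, and the subtracted \<open>v\<close> may afterwards
    be enlarged to the whole space.\<close>
  have eq: "?U t * (exp (- Z t) * (1 + u t - v t))
      = exp (- Z t) - ?V t * exp (- Z t) + ?U t * (u t * exp (- Z t)) - ?U t * (v t * exp (- Z t))" for t
    by (simp add: indicator_def algebra_simps)
  have sets [measurable]: "{t. Z t \<le> x} \<in> sets borel" "{t. x < Z t} \<in> sets borel" by measurable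
  have int: "integrable lborel (\<lambda>t. ?V t * exp (- Z t))" "integrable lborel (\<lambda>t. ?U t * (u t * exp (- Z t)))"
    "integrable lborel (\<lambda>t. ?U t * (v t * exp (- Z t)))"
    using integrable.intros[OF total] integrable_u integrable_v
    by (auto intro!: integrable_real_mult_indicator[of _ lborel, unfolded mult.commute[of _ "indicator _ _"]])
  note [simp] = integrable.intros[OF total] int
  show "integrable lborel (\<lambda>t. ?U t * (exp (- Z t) * (1 + u t - v t)))" unfolding eq by simp
  have odd: "(\<integral>t. ?U t * (u t * exp (- Z t)) \<partial>lborel) = 0"
    by (rule integral_odd_eq_0) (simp_all add: u_odd Z_even indicator_def)
  have v_le: "(\<integral>t. ?U t * (v t * exp (- Z t)) \<partial>lborel) \<le> (\<integral>t. v t * exp (- Z t) \<partial>lborel)"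
    using v_nonneg by (intro integral_mono int integrable_v) (simp add: indicator_def)
  have G: "(\<integral>t. exp (- Z t) \<partial>lborel) = G" by (rule has_bochner_integral_integral_eq[OF total])
  have "(\<integral>t. ?U t * (exp (- Z t) * (1 + u t - v t)) \<partial>lborel)
      = G - (\<integral>t. ?V t * exp (- Z t) \<partial>lborel) - (\<integral>t. ?U t * (v t * exp (- Z t)) \<partial>lborel)"
    unfolding eq using odd G by simp
  also have "\<dots> \<ge> G - G / Gamma a * (a * x powr (a - 1) * exp (- x))
      - G * (C * (2 / l) powr (1 + \<alpha>/2) * poch a (1 + \<alpha>/2) / n powr (\<alpha>/2))"
    by (intro diff_mono order.refl tail[OF a x] order.trans[OF v_le integral_v])
  finally show "G * (1 - C * (2 / l) powr (1 + \<alpha>/2) * poch a (1 + \<alpha>/2) / n powr (\<alpha>/2)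
          - a * x powr (a - 1) * exp (- x) / Gamma a)
      \<le> (\<integral>t. ?U t * (exp (- Z t) * (1 + u t - v t)) \<partial>lborel)"
    by (simp add: algebra_simps)
qed

end

text \<open>For \<open>n \<ge> n1\<close> the integral \<open>I n\<close> exists and
  \<open>exp (- n * f t)\<close> splits into \<open>exp (- (n - n1) * f t)\<close>, which is small
  where \<open>f\<close> is bounded below, and \<open>exp (- n1 * f t)\<close>, whose integral is
  the factor \<open>I n1\<close> in \<open>Ku\<close>. The estimates rest on membership in
  \<open>N1 \<inter> N2\<close>; for \<open>n \<ge> n0\<close> it follows from the definition of the
  threshold.\<close>

theorem theorem2p1:
  fixes \<Omega> :: "(real ^ 'd::finite) set"
    and f :: "real ^ 'd \<Rightarrow> real"
    and H :: "real ^ 'd ^ 'd"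
    and d n1 lmin D r C \<alpha> \<delta> \<Delta> \<xi> n0 Ka1 Ka2 K1 Kl Ku :: real
    and N1 N2 :: "real set"
    and I :: "real \<Rightarrow> real"
  assumes dim: "CARD('d) \<ge> 2" and d: "d = real CARD('d)"
    and Omega_meas: "\<Omega> \<in> sets lebesgue"
    and f_meas: "f \<in> borel_measurable (lebesgue_on \<Omega>)"
    and f_min: "0 \<in> \<Omega>" "\<And>t. t \<in> \<Omega> \<Longrightarrow> f 0 \<le> f t" "f 0 = 0"
    and I: "I = laplace_integral \<Omega> f"
    and n1: "n1 > 0" "\<And>n. n \<ge> n1 \<Longrightarrow> laplace_integrable \<Omega> f n"
    and grad: "\<And>i. partial_exists [i] f 0" "gradient f 0 = 0"
    and hess: "\<And>i j. partial_exists [i, j] f 0" "H = hessian f 0" "positive_definite H"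
    and lmin: "is_smallest_eigenvalue H lmin"
    and third: "\<And>i j k. partial_exists [i, j, k] f 0"
    and D: "D = d powr (3/2) / 6 * (MAX (i, j, k) \<in> UNIV. \<bar>partial_deriv [i, j, k] f 0\<bar>)"
    and A1: "r > 0" "C > 0" "\<alpha> > 1" "cball 0 r \<subseteq> \<Omega>"
      "\<And>t. t \<in> cball 0 r \<Longrightarrow>
         \<bar>f t - 1/2 * d2 f 0 t - 1/6 * d3 f 0 t\<bar> \<le> C * norm t powr (2 + \<alpha>)"
    and A2: "\<delta> > 0" "\<Delta> > 0" "cball 0 \<delta> \<subseteq> \<Omega>" "convex_on (cball 0 \<delta>) f"
      "\<And>t. t \<in> \<Omega> - cball 0 (min \<delta> r) \<Longrightarrow> f t \<ge> \<Delta>"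
    and xi: "\<xi> = min (r\<^sup>2 * lmin) (2 * \<Delta>)"
    and N1: "N1 = {n. n \<ge> 1 \<and> d \<le> (d + 2 * \<alpha>) * ln n \<and> (d + 2 * \<alpha>) * ln n \<le> \<xi> * n}"
    and N2: "N2 = {n. n \<ge> 1 \<and>
        D * ((d + 2 * \<alpha>) / lmin) powr (3/2) * (ln n powr (3/2) / n powr (1/2))
        + C * ((d + 2 * \<alpha>) / lmin) powr (1 + \<alpha>/2) * (ln n powr (1 + \<alpha>/2) / n powr (\<alpha>/2))
        \<le> 7/4}"
    and n0: "n0 = threshold (N1 \<inter> N2)"
    and Ka1: "Ka1 = C * (2 / lmin) powr (1 + \<alpha>/2) * poch (d/2) (1 + \<alpha>/2)"
    and Ka2: "Ka2 = C\<^sup>2 * (2 / lmin) powr (2 + \<alpha>) * poch (d/2) (2 + \<alpha>)"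
    and K1: "K1 = D\<^sup>2 * (2 / lmin) ^ 3 * poch (d/2) 3"
    and Kl: "Kl = exp 1 / 2 * sqrt (d / pi) * (1 + 2 * \<alpha> / d) powr (d/2 - 1)"
    and Ku: "Ku = 7 * sqrt (det H) / (4 * (2 * pi) powr (d/2)) * I n1 * exp (\<xi> * n1 / 2)"
  shows "\<forall>n. n \<ge> n1 \<and> (n \<ge> n0 \<or> n \<in> N1 \<inter> N2) \<longrightarrow>
      I n \<ge> 1 / sqrt (det H) * (2 * pi / n) powr (d/2)
              * (1 - Ka1 / n powr (\<alpha>/2) - Kl / n powr (1 + \<alpha>)) \<and>
      I n \<le> 1 / sqrt (det H) * (2 * pi / n) powr (d/2)
              * (1 + Ka1 / n powr (\<alpha>/2) + K1 / n + (Ka2 + Ku) / n powr \<alpha>)"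
proof (intro allI impI, elim conjE)
  fix n assume n_ge: "n \<ge> n1" and n_mem: "n \<ge> n0 \<or> n \<in> N1 \<inter> N2"
  define a where a_half: "a = d / 2"
  define x where "x = (a + \<alpha>) * ln n"
  define G where "G = 1 / sqrt (det H) * (2 * pi / n) powr a"
  define Z where "Z = (\<lambda>t. n / 2 * (t \<bullet> (H *v t)))"
  define u where "u = (\<lambda>t. - n / 6 * d3 f 0 t)"
  define v where "v = (\<lambda>t :: real ^ 'd. n * C * norm t powr (2 + \<alpha>))"
  define y where "y = (\<lambda>t. u t + v t)"
  have a1: "a \<ge> 1" and d2: "d \<ge> 2" using dim by (simp_all add: a_half d)
  have sym: "transpose H = H" using hess(3) by (simp add: positive_definite_def)
  obtain w where w: "w \<noteq> 0" "H *v w = lmin *\<^sub>R w"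
    using lmin by (auto simp: is_smallest_eigenvalue_def is_eigenvalue_def)
  have "0 < w \<bullet> (H *v w)" using hess(3) w(1) by (simp add: positive_definite_def)
  also have "\<dots> = lmin * (norm w)\<^sup>2" by (simp add: w(2) power2_norm_eq_inner)
  finally have lpos: "lmin > 0" by (simp add: zero_less_mult_iff)
  have Dnn: "D \<ge> 0"
  proof -
    have "0 \<le> (MAX (i, j, k) \<in> UNIV. \<bar>partial_deriv [i, j, k] f 0\<bar>)"
      by (rule order.trans[OF abs_ge_zero Max_ge])
        (auto intro!: image_eqI[of _ _ "(undefined, undefined, undefined)"])
    then show ?thesis using d2 by (simp add: D)
  qed
  have xi_pos: "\<xi> > 0" using A1 A2 lpos by (simp add: xi)
  have "n \<in> N1 \<inter> N2"
    using n_mem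
  proof
    assume "n \<ge> n0"
    define A where "A = D * ((d + 2 * \<alpha>) / lmin) powr (3/2)"
    define B where "B = C * ((d + 2 * \<alpha>) / lmin) powr (1 + \<alpha>/2)"
    have "threshold (N1 \<inter> N2) \<le> n" using \<open>n \<ge> n0\<close> n0 by simp
    then show "n \<in> N1 \<inter> N2"
      unfolding N1 N2 A_def[symmetric] B_def[symmetric]
      by (rule threshold_log_conditions[rotated 4]) (use d2 A1 xi_pos in auto)
  qed
  then have n_ge1: "n \<ge> 1" and N1': "d \<le> (d + 2 * \<alpha>) * ln n" "(d + 2 * \<alpha>) * ln n \<le> \<xi> * n"
    and N2': "D * ((d + 2 * \<alpha>) / lmin) powr (3/2) * (ln n powr (3/2) / n powr (1/2))
        + C * ((d + 2 * \<alpha>) / lmin) powr (1 + \<alpha>/2) * (ln n powr (1 + \<alpha>/2) / n powr (\<alpha>/2)) \<le> 7/4"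
    by (simp_all add: N1 N2)
  have npos: "n > 0" using n_ge1 by simp
  have x2: "2 * x = (d + 2 * \<alpha>) * ln n" by (simp add: x_def a_half algebra_simps)
  have xa: "x \<ge> a" using x2 N1'(1) by (simp add: a_half)
  have xX: "x \<le> n * \<xi> / 2" using x2 N1'(2) by (simp add: mult.commute)
  have u_le: "\<bar>u t\<bar> \<le> n * D * norm t ^ 3" for t
  proof -
    have "n / 6 * \<bar>d3 f 0 t\<bar> \<le> n / 6 * (real CARD('d) powr (3/2) * (MAX (i, j, k) \<in> UNIV. \<bar>partial_deriv [i, j, k] f 0\<bar>) * norm t ^ 3)"
      using npos by (intro mult_left_mono abs_d3_le) auto
    then show ?thesis using npos by (simp add: u_def D d abs_mult mult_ac)
  qed
  interpret laplace_bounds H n Z G a lmin D C \<alpha> u v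
  proof
    show "lmin * (norm t)\<^sup>2 \<le> t \<bullet> (H *v t)" for t
      by (rule smallest_eigenvalue_le_form[OF sym lmin])
  qed (use hess(3) npos lpos Dnn A1 u_le in \<open>simp_all add: Z_def G_def a_half d u_def v_def d3_uminus\<close>)
  have taylor: "\<bar>n * f t - (Z t - u t)\<bar> \<le> v t" if "t \<in> cball 0 r" for t
  proof -
    have "n * f t - (Z t - u t) = n * (f t - 1/2 * d2 f 0 t - 1/6 * d3 f 0 t)"
      by (simp add: Z_def u_def d2_def hess(2) algebra_simps)
    then have "\<bar>n * f t - (Z t - u t)\<bar> = n * \<bar>f t - 1/2 * d2 f 0 t - 1/6 * d3 f 0 t\<bar>"
      using npos by (simp add: abs_mult)
    also have "\<dots> \<le> n * (C * norm t powr (2 + \<alpha>))"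
      using npos A1(5)[OF that] by (intro mult_left_mono) auto
    finally show ?thesis by (simp add: v_def)
  qed
  \<comment> \<open>Since \<open>2 * x = (d + 2 * \<alpha>) * ln n\<close>, inserting
    \<open>Z t \<le> x\<close> into the bounds for \<open>u\<close> and \<open>v\<close> reproduces
    the left side of the condition in \<open>N2\<close> term by term.\<close>
  have small: "\<bar>u t\<bar> + v t \<le> 7/4" if "Z t \<le> x" for t
  proof -
    have ln0: "ln n \<ge> 0" using n_ge1 by simp
    have scale: "n * (2 / (n * lmin)) powr p * Z t powr p \<le> ((d + 2 * \<alpha>) / lmin) powr p * (ln n powr p / n powr (p - 1))"
      if "p > 0" for p
    proof -
      have "Z t powr p \<le> x powr p" using that \<open>Z t \<le> x\<close> Z_nonneg by (intro powr_mono2) auto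
      then have "n * (2 / (n * lmin)) powr p * Z t powr p \<le> n * (2 / (n * lmin)) powr p * x powr p"
        using npos by (intro mult_left_mono) auto
      also have "\<dots> = (2 / lmin) powr p / n powr (p - 1) * x powr p"
        using scaling_factor[OF npos lpos, of 1 p] npos by simp
      also have "(2 / lmin) powr p / n powr (p - 1) * x powr p = (2 / lmin * x) powr p / n powr (p - 1)"
        by (subst powr_mult) (rule times_divide_eq_left)
      also have "2 / lmin * x = (d + 2 * \<alpha>) / lmin * ln n"
        using x2 by (simp add: field_simps)
      also have "((d + 2 * \<alpha>) / lmin * ln n) powr p / n powr (p - 1) = ((d + 2 * \<alpha>) / lmin) powr p * (ln n powr p / n powr (p - 1))"
        by (subst powr_mult) (rule times_divide_eq_right[symmetric])
      finally show ?thesis .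
    qed
    have "\<bar>u t\<bar> \<le> D * (n * (2 / (n * lmin)) powr (3/2) * Z t powr (3/2))"
      using u_le_Z[of t] by (simp only: mult_ac)
    also have "\<dots> \<le> D * (((d + 2 * \<alpha>) / lmin) powr (3/2) * (ln n powr (3/2) / n powr (3/2 - 1)))"
      by (intro mult_left_mono scale Dnn) simp
    finally have u1: "\<bar>u t\<bar> \<le> D * ((d + 2 * \<alpha>) / lmin) powr (3/2) * (ln n powr (3/2) / n powr (1/2))"
      by simp
    have "v t \<le> C * (n * (2 / (n * lmin)) powr (1 + \<alpha>/2) * Z t powr (1 + \<alpha>/2))"
      using v_le_Z[of t] by (simp only: mult_ac)
    also have "\<dots> \<le> C * (((d + 2 * \<alpha>) / lmin) powr (1 + \<alpha>/2) * (ln n powr (1 + \<alpha>/2) / n powr (1 + \<alpha>/2 - 1)))"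
      using A1 by (intro mult_left_mono scale) auto
    finally have "v t \<le> C * ((d + 2 * \<alpha>) / lmin) powr (1 + \<alpha>/2) * (ln n powr (1 + \<alpha>/2) / n powr (\<alpha>/2))"
      by simp
    with u1 N2' show ?thesis by linarith
  qed
  \<comment> \<open>Explains the first entry of \<open>\<xi>\<close>: \<open>lmin * (norm t)\<^sup>2
    \<le> 2 * x / n \<le> \<xi> \<le> r\<^sup>2 * lmin\<close>.\<close>
  have in_ball: "t \<in> cball 0 r" if "Z t \<le> x" for t
  proof -
    have "(norm t)\<^sup>2 \<le> 2 / (n * lmin) * Z t" by (rule norm_le)
    also have "\<dots> \<le> 2 / (n * lmin) * (n * \<xi> / 2)"
      using that xX npos lpos by (intro mult_left_mono) auto
    also have "\<dots> = \<xi> / lmin" using npos by simp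
    also have "\<dots> \<le> r\<^sup>2 * lmin / lmin" using lpos by (intro divide_right_mono) (auto simp: xi)
    also have "\<dots> = r\<^sup>2" using lpos by simp
    finally have "(norm t)\<^sup>2 \<le> r\<^sup>2" .
    then have "norm t \<le> r" by (rule power2_le_imp_le) (use A1(1) in simp)
    then show ?thesis by simp
  qed
  have f_nonneg: "f t \<ge> 0" if "t \<in> \<Omega>" for t using f_min(2)[OF that] f_min(3) by simp
  \<comment> \<open>A constant error \<open>7/4 * exp (- x)\<close> need not be integrable over
    \<open>\<Omega>\<close>, so it is carried by \<open>exp (- n1 * f t)\<close>. The factor
    \<open>exp (n1 * \<xi> / 2)\<close> compensates for that weight wherever
    \<open>f t \<le> \<xi> / 2\<close>.\<close>
  define \<kappa> where "\<kappa> = 7/4 * exp (- x) * exp (n1 * \<xi> / 2)"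
  have \<kappa>: "\<kappa> \<ge> 0" by (simp add: \<kappa>_def)
  have major_nonneg: "0 \<le> exp (- Z t) * (1 + y t + (y t)\<^sup>2)" for t
  proof -
    have "0 \<le> (y t + 1/2)\<^sup>2 + 3/4" by simp
    also have "\<dots> = 1 + y t + (y t)\<^sup>2" by (simp add: power2_eq_square algebra_simps)
    finally show ?thesis by simp
  qed
  have far: "exp (- n * f t) \<le> exp (- Z t) * (1 + y t + (y t)\<^sup>2) + \<kappa> * exp (- n1 * f t)"
    if "\<xi> / 2 \<le> f t" for t
  proof -
    have "(n - n1) * (\<xi> / 2) \<le> (n - n1) * f t" using that n_ge by (intro mult_left_mono) auto
    then have "- n * f t \<le> - x + n1 * \<xi> / 2 + - n1 * f t" using xX by (simp add: field_simps)
    then have "exp (- n * f t) \<le> exp (- x + n1 * \<xi> / 2 + - n1 * f t)" by simp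
    also have "\<dots> = exp (- x) * exp (n1 * \<xi> / 2) * exp (- n1 * f t)" by (simp only: exp_add)
    also have "\<dots> \<le> \<kappa> * exp (- n1 * f t)" by (simp add: \<kappa>_def)
    finally show ?thesis using major_nonneg[of t] by linarith
  qed
  have pointwise: "exp (- n * f t) \<le> exp (- Z t) * (1 + y t + (y t)\<^sup>2) + \<kappa> * exp (- n1 * f t)"
    if t: "t \<in> \<Omega>" for t
  proof -
    consider "Z t \<le> x" | "t \<notin> cball 0 (min \<delta> r)" | "x < Z t" "t \<in> cball 0 (min \<delta> r)" by linarith
    then show ?thesis
    proof cases
      case 1
      have "- n * f t \<le> - Z t + y t"
        using taylor[OF in_ball[OF 1]] by (simp add: y_def abs_le_iff)
      then have "exp (- n * f t) \<le> exp (- Z t) * exp (y t)" by (simp flip: exp_add)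
      also have "\<dots> \<le> exp (- Z t) * (1 + y t + (y t)\<^sup>2)"
        using small[OF 1] by (intro mult_left_mono exp_le_quadratic) (auto simp: y_def)
      finally show ?thesis using mult_nonneg_nonneg[OF \<kappa>, of "exp (- n1 * f t)"] by simp
    next
      case 2
      \<comment> \<open>The second entry of \<open>\<xi>\<close>:
        \<open>\<xi> \<le> 2 * \<Delta>\<close> puts every point outside the ball within reach of
        \<open>far\<close>.\<close>
      then have "\<Delta> \<le> f t" using A2(5) t by simp
      then show ?thesis by (intro far) (simp add: xi min_le_iff_disj)
    next
      case 3
      define \<psi> where "\<psi> = (\<lambda>s. n * f (s *\<^sub>R t))"
      \<comment> \<open>\<open>h *\<^sub>R t\<close> is the point of the ray on the boundary of the
        ellipsoid, where \<open>small\<close> supplies the smallness assumption.\<close>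
      define h where "h = sqrt (x / Z t)"
      have Zt: "Z t > 0" using 3 xa a1 by linarith
      have h: "0 < h" "h \<le> 1" "Z t * h\<^sup>2 = x"
        using 3(1) Zt xa a1 by (simp_all add: h_def)
      have inball: "s *\<^sub>R t \<in> cball 0 (min \<delta> r)" if "0 \<le> s" "s \<le> 1" for s
        using mult_right_mono[OF that(2) norm_ge_zero[of t]] 3(2) that by simp
      have scale: "Z (s *\<^sub>R t) = Z t * s\<^sup>2" "u (s *\<^sub>R t) = u t * s ^ 3" "v (s *\<^sub>R t) = v t * s powr (2 + \<alpha>)" if "0 \<le> s" for s
        using that by (simp_all add: Z_def u_def v_def d3_scaleR matrix_vector_mult_scaleR power2_eq_square powr_mult)
      have "exp (- \<psi> 1) \<le> exp (- Z t) * (1 + (u t + v t) + (u t + v t)\<^sup>2) + 7/4 * exp (- (Z t * h\<^sup>2))"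
      proof (rule exp_bound_ray[of \<psi> h "Z t" "v t" \<alpha> "u t"])
        show "convex_on {0..1} \<psi>"
        proof (rule convex_onI)
          fix c p q :: real assume c: "0 < c" "c < 1" and pq: "p \<in> {0..1}" "q \<in> {0..1}"
          have "((1 - c) *\<^sub>R p + c *\<^sub>R q) *\<^sub>R t = (1 - c) *\<^sub>R (p *\<^sub>R t) + c *\<^sub>R (q *\<^sub>R t)"
            by (simp add: algebra_simps)
          moreover have "f ((1 - c) *\<^sub>R (p *\<^sub>R t) + c *\<^sub>R (q *\<^sub>R t)) \<le> (1 - c) * f (p *\<^sub>R t) + c * f (q *\<^sub>R t)"
            using c pq inball[of p] inball[of q] by (intro convex_onD[OF A2(4)]) auto
          ultimately have "\<psi> ((1 - c) *\<^sub>R p + c *\<^sub>R q) \<le> n * ((1 - c) * f (p *\<^sub>R t) + c * f (q *\<^sub>R t))"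
            unfolding \<psi>_def using npos by (simp only: mult_le_cancel_left_pos)
          then show "\<psi> ((1 - c) *\<^sub>R p + c *\<^sub>R q) \<le> (1 - c) * \<psi> p + c * \<psi> q"
            by (simp add: \<psi>_def algebra_simps)
        qed simp
        show "\<psi> 0 = 0" by (simp add: \<psi>_def f_min(3))
        show "\<bar>\<psi> s - (Z t * s\<^sup>2 - u t * s ^ 3)\<bar> \<le> v t * s powr (2 + \<alpha>)" if "0 \<le> s" "s \<le> 1" for s
          using taylor[of "s *\<^sub>R t"] inball[OF that] scale[OF that(1)] by (simp add: \<psi>_def)
        show "\<bar>u t\<bar> * h ^ 3 + v t * h powr (2 + \<alpha>) \<le> 7/4"
          using small[of "h *\<^sub>R t"] scale[of h] h by (simp add: abs_mult)
      qed (use h Zt v_nonneg A1 in auto)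
      then have near: "exp (- n * f t) \<le> exp (- Z t) * (1 + y t + (y t)\<^sup>2) + 7/4 * exp (- x)"
        by (simp add: \<psi>_def h(3) y_def)
      \<comment> \<open>Trading \<open>exp (- x)\<close> for a multiple of
        \<open>exp (- n1 * f t)\<close> requires \<open>f t \<le> \<xi> / 2\<close>; larger values
        of \<open>f\<close> inside the ball are covered by \<open>far\<close>.\<close>
      show ?thesis
      proof (cases "\<xi> / 2 \<le> f t")
        case False
        then have "n1 * f t \<le> n1 * (\<xi> / 2)" using n1(1) by (intro mult_left_mono) auto
        then have "1 \<le> exp (n1 * \<xi> / 2) * exp (- n1 * f t)" by (simp flip: exp_add)
        then have "7/4 * exp (- x) * 1 \<le> 7/4 * exp (- x) * (exp (n1 * \<xi> / 2) * exp (- n1 * f t))"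
          by (intro mult_left_mono) auto
        then have "7/4 * exp (- x) \<le> \<kappa> * exp (- n1 * f t)"
          by (simp only: \<kappa>_def mult.assoc mult_1_right)
        then show ?thesis using near by linarith
      qed (rule far)
    qed
  qed
  have int_I: "integrable lebesgue (\<lambda>t. indicator \<Omega> t * exp (- m * f t))" if "m \<ge> n1" for m
    using n1(2)[OF that] by (simp add: laplace_integrable_def set_integrable_def)
  have I_eq: "I m = (\<integral>t. indicator \<Omega> t * exp (- m * f t) \<partial>lebesgue)" for m
    by (simp add: I laplace_integral_def set_lebesgue_integral_def)
  \<comment> \<open>\<open>\<Omega>\<close> and \<open>f\<close> are only Lebesgue measurable,
    whereas the Gaussian integrals were computed for \<open>lborel\<close>.\<close>
  have to_lebesgue: "integrable lebesgue g" "(\<integral>t. g t \<partial>lebesgue) = (\<integral>t. g t \<partial>lborel)"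
    if "integrable lborel g" for g :: "real ^ 'd \<Rightarrow> real"
    using that by (simp_all add: integrable_completion integral_completion borel_measurable_integrable)
  have exp_x: "exp (- x) = n powr - (a + \<alpha>)" using npos by (simp add: x_def powr_def algebra_simps)
  have "I n \<le> (\<integral>t. exp (- Z t) * (1 + y t + (y t)\<^sup>2) + \<kappa> * (indicator \<Omega> t * exp (- n1 * f t)) \<partial>lebesgue)"
    unfolding I_eq
  proof (rule integral_mono)
    show "integrable lebesgue (\<lambda>t. exp (- Z t) * (1 + y t + (y t)\<^sup>2) + \<kappa> * (indicator \<Omega> t * exp (- n1 * f t)))"
      unfolding y_def by (intro Bochner_Integration.integrable_add integrable_mult_right to_lebesgue(1) integrable_majorant int_I) simp
    show "indicator \<Omega> t * exp (- n * f t) \<le> exp (- Z t) * (1 + y t + (y t)\<^sup>2) + \<kappa> * (indicator \<Omega> t * exp (- n1 * f t))" for t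
      using pointwise[of t] major_nonneg[of t] by (cases "t \<in> \<Omega>") auto
  qed (rule int_I[OF n_ge])
  also have "\<dots> = (\<integral>t. exp (- Z t) * (1 + y t + (y t)\<^sup>2) \<partial>lborel) + \<kappa> * I n1"
    unfolding I_eq y_def using to_lebesgue[OF integrable_majorant] int_I[of n1] by simp
  also have "\<dots> \<le> G * (1 + Ka1 / n powr (\<alpha>/2) + K1 / n + Ka2 / n powr \<alpha>) + \<kappa> * I n1"
    using integral_majorant by (simp add: y_def Ka1 K1 Ka2 a_half)
  \<comment> \<open>\<open>exp (- x)\<close> is \<open>n powr (- a)\<close> times
    \<open>n powr (- \<alpha>)\<close>. The first factor is absorbed by \<open>G\<close>, and the
    remaining constants of \<open>G\<close> reappear inverted in \<open>Ku\<close>.\<close>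
  also have "\<kappa> * I n1 = G * (Ku / n powr \<alpha>)"
  proof -
    have "sqrt (det H) > 0" using det_pos by simp
    moreover have "(2 * pi / n) powr a = (2 * pi) powr a / n powr a"
      using npos by (simp add: powr_divide)
    moreover have "exp (- x) = 1 / (n powr a * n powr \<alpha>)"
      unfolding exp_x by (simp only: powr_minus_divide powr_add)
    ultimately show ?thesis
      by (simp add: \<kappa>_def G_def Ku a_half[symmetric] field_simps)
  qed
  finally have upper: "I n \<le> G * (1 + Ka1 / n powr (\<alpha>/2) + K1 / n + (Ka2 + Ku) / n powr \<alpha>)"
    by (simp add: algebra_simps add_divide_distrib)
  have "G * (1 - Ka1 / n powr (\<alpha>/2) - Kl / n powr (1 + \<alpha>))
      \<le> G * (1 - C * (2 / lmin) powr (1 + \<alpha>/2) * poch a (1 + \<alpha>/2) / n powr (\<alpha>/2)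
          - a * x powr (a - 1) * exp (- x) / Gamma a)"
  proof (intro mult_left_mono diff_mono)
    have "a * x powr (a - 1) * exp (- x) / Gamma a
        \<le> exp 1 / 2 * sqrt (real CARD('d) / pi) * (1 + \<alpha> / a) powr (a - 1) / n powr (1 + \<alpha>)"
      by (rule Gamma_tail_constant_le) (use dim A1 n_ge1 in \<open>auto simp: a_half d x_def\<close>)
    then show "a * x powr (a - 1) * exp (- x) / Gamma a \<le> Kl / n powr (1 + \<alpha>)"
      by (simp add: Kl a_half d mult.commute)
  qed (use G_pos in \<open>simp_all add: Ka1 a_half\<close>)
  also have "\<dots> \<le> (\<integral>t. indicator {t. Z t \<le> x} t * (exp (- Z t) * (1 + u t - v t)) \<partial>lborel)"
    by (rule integral_minorant[OF a1 xa])
  also have "\<dots> = (\<integral>t. indicator {t. Z t \<le> x} t * (exp (- Z t) * (1 + u t - v t)) \<partial>lebesgue)"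
    by (rule to_lebesgue(2)[OF integrable_minorant[OF a1 xa], symmetric])
  also have "\<dots> \<le> I n"
    unfolding I_eq
  proof (rule integral_mono)
    show "indicator {t. Z t \<le> x} t * (exp (- Z t) * (1 + u t - v t)) \<le> indicator \<Omega> t * exp (- n * f t)" for t
    proof (cases "Z t \<le> x")
      case True
      have "- Z t + (u t - v t) \<le> - n * f t"
        using taylor[OF in_ball[OF True]] by (simp add: abs_le_iff)
      then have "exp (- Z t) * exp (u t - v t) \<le> exp (- n * f t)" by (simp flip: exp_add)
      moreover have "exp (- Z t) * (1 + (u t - v t)) \<le> exp (- Z t) * exp (u t - v t)"
        by (intro mult_left_mono exp_ge_add_one_self) simp
      moreover have "t \<in> \<Omega>" using in_ball[OF True] A1(4) by blast
      ultimately show ?thesis using True by (simp add: algebra_simps)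
    qed simp
  qed (intro to_lebesgue(1) integrable_minorant a1 xa, rule int_I[OF n_ge])
  finally show "I n \<ge> 1 / sqrt (det H) * (2 * pi / n) powr (d/2)
        * (1 - Ka1 / n powr (\<alpha>/2) - Kl / n powr (1 + \<alpha>)) \<and>
      I n \<le> 1 / sqrt (det H) * (2 * pi / n) powr (d/2)
        * (1 + Ka1 / n powr (\<alpha>/2) + K1 / n + (Ka2 + Ku) / n powr \<alpha>)"
    using upper by (simp add: G_def a_half)
qed

end
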